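(* Let $H_c(V,\Gamma)$ be a symplectic reflection algebra at $t=1$, let $U_c(V,\Gamma)$ be its spherical subalgebra, and let $\mathcal{G}$ be the filtration on $U_c(V,\Gamma)$ induced by the filtration $F_0=\mathbb{C}\Gamma$, $F_1=\mathbb{C}\Gamma+\mathbb{C}\Gamma V$, $F_n=F_1^n$ ($n\ge2$) of $H_c(V,\Gamma)$. Then $\mathrm{gr}_{\mathcal G}U_c(V,\Gamma)\simeq S(V)^\Gamma$. Hence $U_c(V,\Gamma)$ is vaguely commutative.
   Context: $(V,\omega)$ is a finite-dimensional complex symplectic vector space and $\Gamma\subset Sp(V)$ a finite group. $S\subset\Gamma$ is the set of symplectic reflections, i.e. elements $s$ with $\mathrm{rank}(1-s)=2$; for $s\in S$, $\omega_s$ is the skew form on $V$ that equals $\omega$ on $\mathrm{im}(1-s)$ and has radical $\ker(1-s)$. Let $c:S\to\mathbb{C}$ be conjugation-invariant. The symplectic reflection algebra at $t=1$ is $H_c(V,\Gamma)=(T(V)\rtimes\Gamma)/\big(xy-yx-\omega(x,y)-\sum_{s\in S}c(s)\omega_s(x,y)s : x,y\in V\big)$. With $\mathbf e=\frac1{|\Gamma|}\sum_{g\in\Gamma}g$, the spherical subalgebra is $U_c(V,\Gamma)=\mathbf eH_c(V,\Gamma)\mathbf e$ (with unit $\mathbf e$), and the induced filtration is $\mathcal G=\{U_c(V,\Gamma)\cap F_n\}_{n\ge0}$. $S(V)$ is the symmetric algebra. For an algebra $A$ with filtration $\mathcal F=\{F_i\}_{i\ge0}$ (increasing subspaces, $1\in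 F_0$, $F_iF_j\subset F_{i+j}$, $A=\bigcup F_i$), $\mathrm{gr}_{\mathcal F}A=\bigoplus_{i\ge0}F_i/F_{i-1}$, $F_{-1}=0$. A finitely generated algebra $A$ is vaguely commutative if it has a filtration $\mathcal F$ with all $F_i$ finite-dimensional such that $\mathrm{gr}_{\mathcal F}A$ is finitely generated and commutative ($F_0$ may be strictly larger than the base field). *)

theory Defs
  imports
    Complex_Main
    "HOL-Library.Poly_Mapping"
    "HOL-Algebra.Module"
    "HOL-Algebra.Subrings"
    "HOL-Algebra.QuotRing"
begin

section \<open>Associative algebras over the complex numbers\<close>

text \<open>
  A \<open>\<complex>\<close>-algebra is represented by a \<open>module\<close> record, i.e. a ring together with a scalar
  multiplication. The library locale \<open>algebra\<close> is restricted to commutative algebras, so the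
  noncommutative notion is introduced here.
\<close>

type_synonym 'a calg = "(complex, 'a) module"

definition complex_ring :: "complex ring"
  where "complex_ring = \<lparr>carrier = UNIV, mult = (*), one = 1, zero = 0, add = (+)\<rparr>"

definition calgebra :: "'a calg \<Rightarrow> bool"
  where "calgebra A \<longleftrightarrow> ring A \<and> Module.module complex_ring A \<and>
    (\<forall>a. \<forall>x\<in>carrier A. \<forall>y\<in>carrier A.
       (a \<odot>\<^bsub>A\<^esub> x) \<otimes>\<^bsub>A\<^esub> y = a \<odot>\<^bsub>A\<^esub> (x \<otimes>\<^bsub>A\<^esub> y) \<and>
       x \<otimes>\<^bsub>A\<^esub> (a \<odot>\<^bsub>A\<^esub> y) = a \<odot>\<^bsub>A\<^esub> (x \<otimes>\<^bsub>A\<^esub> y))"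

definition lin_span :: "'a calg \<Rightarrow> 'a set \<Rightarrow> 'a set"
  where "lin_span A Y = \<Inter>{W. submodule W complex_ring A \<and> Y \<subseteq> W}"

definition finite_dim :: "'a calg \<Rightarrow> 'a set \<Rightarrow> bool"
  where "finite_dim A W \<longleftrightarrow> (\<exists>B. finite B \<and> B \<subseteq> carrier A \<and> W = lin_span A B)"

definition csubalgebra :: "'a set \<Rightarrow> 'a calg \<Rightarrow> bool"
  where "csubalgebra B A \<longleftrightarrow> subring B A \<and> submodule B complex_ring A"

definition finitely_generated :: "'a calg \<Rightarrow> bool"
  where "finitely_generated A \<longleftrightarrow> (\<exists>Y. finite Y \<and> Y \<subseteq> carrier A \<and>
    (\<forall>B. csubalgebra B A \<and> Y \<subseteq> B \<longrightarrow> B = carrier A))"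

definition commutative :: "'a calg \<Rightarrow> bool"
  where "commutative A \<longleftrightarrow> (\<forall>x\<in>carrier A. \<forall>y\<in>carrier A. x \<otimes>\<^bsub>A\<^esub> y = y \<otimes>\<^bsub>A\<^esub> x)"

definition quot_alg :: "'a calg \<Rightarrow> 'a set \<Rightarrow> 'a set calg"
  where "quot_alg A I =
    ring.extend (A Quot I) (module.fields (\<lambda>a Y. \<Union>x\<in>Y. I +>\<^bsub>A\<^esub> (a \<odot>\<^bsub>A\<^esub> x)))"

definition subspace_mult :: "'a calg \<Rightarrow> 'a set \<Rightarrow> 'a set \<Rightarrow> 'a set"
  where "subspace_mult A W W' = lin_span A {x \<otimes>\<^bsub>A\<^esub> y | x y. x \<in> W \<and> y \<in> W'}"

primrec subspace_power :: "'a calg \<Rightarrow> 'a set \<Rightarrow> nat \<Rightarrow> 'a set"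
  where
    "subspace_power A W 0 = lin_span A {\<one>\<^bsub>A\<^esub>}"
  | "subspace_power A W (Suc n) = subspace_mult A (subspace_power A W n) W"


section \<open>Filtrations, associated graded algebras, vague commutativity\<close>

definition filtration :: "'a calg \<Rightarrow> (nat \<Rightarrow> 'a set) \<Rightarrow> bool"
  where "filtration A F \<longleftrightarrow>
    (\<forall>i. submodule (F i) complex_ring A) \<and>
    (\<forall>i. F i \<subseteq> F (Suc i)) \<and>
    \<one>\<^bsub>A\<^esub> \<in> F 0 \<and>
    (\<forall>i j. \<forall>x\<in>F i. \<forall>y\<in>F j. x \<otimes>\<^bsub>A\<^esub> y \<in> F (i + j)) \<and>
    carrier A = (\<Union>i. F i)"

text \<open>The space \<open>F\<^bsub>i-1\<^esub>\<close>, with the convention \<open>F\<^bsub>-1\<^esub> = 0\<close>.\<close>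

definition prev :: "'a calg \<Rightarrow> (nat \<Rightarrow> 'a set) \<Rightarrow> nat \<Rightarrow> 'a set"
  where "prev A F i = (case i of 0 \<Rightarrow> {\<zero>\<^bsub>A\<^esub>} | Suc j \<Rightarrow> F j)"

text \<open>
  An element of the associated graded algebra is a finitely supported family whose \<open>i\<close>-th member
  is a coset of \<open>F\<^bsub>i-1\<^esub>\<close> in \<open>F\<^bsub>i\<^esub>\<close>; the zero of \<open>F\<^bsub>i\<^esub>/F\<^bsub>i-1\<^esub>\<close> is the coset \<open>F\<^bsub>i-1\<^esub>\<close> itself.
  The \<open>n\<close>-th member of a product is the class of \<open>\<Sum>\<^bsub>i\<le>n\<^esub> a\<^bsub>i\<^esub> b\<^bsub>n-i\<^esub>\<close> for
  arbitrary choices of representatives \<open>a\<^bsub>i\<^esub>\<close>, \<open>b\<^bsub>i\<^esub>\<close> of the members of the factors.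
\<close>

definition gr :: "'a calg \<Rightarrow> (nat \<Rightarrow> 'a set) \<Rightarrow> (nat \<Rightarrow> 'a set) calg"
  where "gr A F =
    \<lparr>carrier = {x. (\<forall>i. \<exists>a\<in>F i. x i = prev A F i +>\<^bsub>A\<^esub> a) \<and> finite {i. x i \<noteq> prev A F i}},
     mult = (\<lambda>x y n. \<Union>{prev A F n +>\<^bsub>A\<^esub> (\<Oplus>\<^bsub>A\<^esub>i\<in>{..n}. a i \<otimes>\<^bsub>A\<^esub> b (n - i)) | a b.
               (\<forall>i. a i \<in> x i) \<and> (\<forall>i. b i \<in> y i)}),
     one = (\<lambda>i. if i = 0 then prev A F 0 +>\<^bsub>A\<^esub> \<one>\<^bsub>A\<^esub> else prev A F i),
     zero = prev A F,
     add = (\<lambda>x y i. x i <+>\<^bsub>A\<^esub> y i),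
     smult = (\<lambda>c x i. \<Union>a\<in>x i. prev A F i +>\<^bsub>A\<^esub> (c \<odot>\<^bsub>A\<^esub> a))\<rparr>"

definition gr_component :: "'a calg \<Rightarrow> (nat \<Rightarrow> 'a set) \<Rightarrow> nat \<Rightarrow> (nat \<Rightarrow> 'a set) set"
  where "gr_component A F n = {x \<in> carrier (gr A F). \<forall>i. i \<noteq> n \<longrightarrow> x i = prev A F i}"

definition vaguely_commutative :: "'a calg \<Rightarrow> bool"
  where "vaguely_commutative A \<longleftrightarrow> calgebra A \<and> finitely_generated A \<and>
    (\<exists>F. filtration A F \<and> (\<forall>i. finite_dim A (F i)) \<and>
         finitely_generated (gr A F) \<and> commutative (gr A F))"

definition graded_iso :: "'a calg \<Rightarrow> (nat \<Rightarrow> 'a set) \<Rightarrow> 'b calg \<Rightarrow> (nat \<Rightarrow> 'b set) \<Rightarrow> ('a \<Rightarrow> 'b) \<Rightarrow> bool"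
  where "graded_iso A A' B B' \<phi> \<longleftrightarrow> \<phi> \<in> ring_iso A B \<and>
    (\<forall>c. \<forall>x\<in>carrier A. \<phi> (c \<odot>\<^bsub>A\<^esub> x) = c \<odot>\<^bsub>B\<^esub> \<phi> x) \<and> (\<forall>n. \<phi> ` A' n = B' n)"


section \<open>Tensor and symmetric algebras\<close>

text \<open>
  Lists with concatenation form the free monoid, so \<open>'v list \<Rightarrow>\<^sub>0 complex\<close> carries the
  multiplication of the free associative algebra on the set \<open>'v\<close>.
\<close>

instantiation list :: (type) monoid_add
begin

definition zero_list :: "'a list" where "zero_list = []"

definition plus_list :: "'a list \<Rightarrow> 'a list \<Rightarrow> 'a list" where "plus_list = (@)"

instance by standard (simp_all add: zero_list_def plus_list_def)

end

definition free_alg :: "('v list \<Rightarrow>\<^sub>0 complex) calg"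
  where "free_alg = \<lparr>carrier = UNIV, mult = (*), one = 1, zero = 0, add = (+),
    smult = (\<lambda>a p. Poly_Mapping.single [] a * p)\<rparr>"

text \<open>
  \<open>T(V)\<close> is the free algebra on the set \<open>V\<close> modulo linearity of the inclusion of \<open>V\<close>. In degree \<open>n\<close>
  this is the free vector space on \<open>V\<^sup>n\<close> modulo multilinearity, i.e. the \<open>n\<close>-th tensor power.
\<close>

definition tensor_ideal :: "(complex \<Rightarrow> 'v::ab_group_add \<Rightarrow> 'v) \<Rightarrow> ('v list \<Rightarrow>\<^sub>0 complex) set"
  where "tensor_ideal scale = Idl\<^bsub>free_alg\<^esub>
    ({Poly_Mapping.single [x + y] 1 - Poly_Mapping.single [x] 1 - Poly_Mapping.single [y] 1 | x y. True} \<union>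
     {Poly_Mapping.single [scale a x] 1 - Poly_Mapping.single [x] a | a x. True})"

definition tensor_alg :: "(complex \<Rightarrow> 'v::ab_group_add \<Rightarrow> 'v) \<Rightarrow> ('v list \<Rightarrow>\<^sub>0 complex) set calg"
  where "tensor_alg scale = quot_alg free_alg (tensor_ideal scale)"

definition tensor_vec :: "(complex \<Rightarrow> 'v::ab_group_add \<Rightarrow> 'v) \<Rightarrow> 'v \<Rightarrow> ('v list \<Rightarrow>\<^sub>0 complex) set"
  where "tensor_vec scale v = tensor_ideal scale +>\<^bsub>free_alg\<^esub> Poly_Mapping.single [v] 1"

definition tensor_power :: "(complex \<Rightarrow> 'v::ab_group_add \<Rightarrow> 'v) \<Rightarrow> nat \<Rightarrow> ('v list \<Rightarrow>\<^sub>0 complex) set set"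
  where "tensor_power scale n =
    {tensor_ideal scale +>\<^bsub>free_alg\<^esub> p | p. \<forall>w\<in>Poly_Mapping.keys p. length w = n}"

definition sym_ideal :: "(complex \<Rightarrow> 'v::ab_group_add \<Rightarrow> 'v) \<Rightarrow> ('v list \<Rightarrow>\<^sub>0 complex) set set"
  where "sym_ideal scale = (let T = tensor_alg scale; \<iota> = tensor_vec scale in
    Idl\<^bsub>T\<^esub> {\<iota> x \<otimes>\<^bsub>T\<^esub> \<iota> y \<ominus>\<^bsub>T\<^esub> \<iota> y \<otimes>\<^bsub>T\<^esub> \<iota> x | x y. True})"

definition sym_alg :: "(complex \<Rightarrow> 'v::ab_group_add \<Rightarrow> 'v) \<Rightarrow> ('v list \<Rightarrow>\<^sub>0 complex) set set calg"
  where "sym_alg scale = quot_alg (tensor_alg scale) (sym_ideal scale)"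

definition sym_power :: "(complex \<Rightarrow> 'v::ab_group_add \<Rightarrow> 'v) \<Rightarrow> nat \<Rightarrow> ('v list \<Rightarrow>\<^sub>0 complex) set set set"
  where "sym_power scale n =
    {sym_ideal scale +>\<^bsub>tensor_alg scale\<^esub> t | t. t \<in> tensor_power scale n}"

text \<open>
  A linear automorphism \<open>g\<close> of \<open>V\<close> acts on words letterwise, and this action maps the ideals above
  onto themselves. Hence the induced maps on \<open>T(V)\<close> and \<open>S(V)\<close> send a coset to its image.
\<close>

definition free_act :: "('v \<Rightarrow> 'v) \<Rightarrow> ('v list \<Rightarrow>\<^sub>0 complex) \<Rightarrow> ('v list \<Rightarrow>\<^sub>0 complex)"
  where "free_act g p =
    (\<Sum>w\<in>Poly_Mapping.keys p. Poly_Mapping.single (map g w) (Poly_Mapping.lookup p w))"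

definition tensor_act :: "('v \<Rightarrow> 'v) \<Rightarrow> ('v list \<Rightarrow>\<^sub>0 complex) set \<Rightarrow> ('v list \<Rightarrow>\<^sub>0 complex) set"
  where "tensor_act g t = free_act g ` t"

definition sym_act :: "('v \<Rightarrow> 'v) \<Rightarrow> ('v list \<Rightarrow>\<^sub>0 complex) set set \<Rightarrow> ('v list \<Rightarrow>\<^sub>0 complex) set set"
  where "sym_act g p = tensor_act g ` p"

definition sym_invariants ::
    "(complex \<Rightarrow> 'v::ab_group_add \<Rightarrow> 'v) \<Rightarrow> ('v \<Rightarrow> 'v) set \<Rightarrow> ('v list \<Rightarrow>\<^sub>0 complex) set set calg"
  where "sym_invariants scale \<Gamma> = (sym_alg scale)
    \<lparr>carrier := {p \<in> carrier (sym_alg scale). \<forall>g\<in>\<Gamma>. sym_act g p = p}\<rparr>"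

definition sym_invariants_component ::
    "(complex \<Rightarrow> 'v::ab_group_add \<Rightarrow> 'v) \<Rightarrow> ('v \<Rightarrow> 'v) set \<Rightarrow> nat \<Rightarrow> ('v list \<Rightarrow>\<^sub>0 complex) set set set"
  where "sym_invariants_component scale \<Gamma> n = carrier (sym_invariants scale \<Gamma>) \<inter> sym_power scale n"


section \<open>Symplectic reflections\<close>

definition bilinear_form :: "(complex \<Rightarrow> 'v::ab_group_add \<Rightarrow> 'v) \<Rightarrow> ('v \<Rightarrow> 'v \<Rightarrow> complex) \<Rightarrow> bool"
  where "bilinear_form scale \<omega> \<longleftrightarrow>
    (\<forall>x. Vector_Spaces.linear scale (*) (\<lambda>y. \<omega> x y)) \<and>
    (\<forall>y. Vector_Spaces.linear scale (*) (\<lambda>x. \<omega> x y))"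

definition skew_form :: "(complex \<Rightarrow> 'v::ab_group_add \<Rightarrow> 'v) \<Rightarrow> ('v \<Rightarrow> 'v \<Rightarrow> complex) \<Rightarrow> bool"
  where "skew_form scale \<omega> \<longleftrightarrow> bilinear_form scale \<omega> \<and> (\<forall>x y. \<omega> x y = - \<omega> y x)"

definition radical :: "('v \<Rightarrow> 'v \<Rightarrow> complex) \<Rightarrow> 'v set"
  where "radical \<omega> = {x. \<forall>y. \<omega> x y = 0}"

definition symplectic_space :: "(complex \<Rightarrow> 'v::ab_group_add \<Rightarrow> 'v) \<Rightarrow> ('v \<Rightarrow> 'v \<Rightarrow> complex) \<Rightarrow> bool"
  where "symplectic_space scale \<omega> \<longleftrightarrow>
    (\<exists>B. finite_dimensional_vector_space scale B) \<and> skew_form scale \<omega> \<and> radical \<omega> = {0}"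

definition Sp :: "(complex \<Rightarrow> 'v::ab_group_add \<Rightarrow> 'v) \<Rightarrow> ('v \<Rightarrow> 'v \<Rightarrow> complex) \<Rightarrow> ('v \<Rightarrow> 'v) monoid"
  where "Sp scale \<omega> =
    \<lparr>carrier = {g. Vector_Spaces.linear scale scale g \<and> bij g \<and> (\<forall>x y. \<omega> (g x) (g y) = \<omega> x y)},
     mult = (\<circ>), one = id\<rparr>"

definition sympl_reflections ::
    "(complex \<Rightarrow> 'v::ab_group_add \<Rightarrow> 'v) \<Rightarrow> ('v \<Rightarrow> 'v) set \<Rightarrow> ('v \<Rightarrow> 'v) set"
  where "sympl_reflections scale \<Gamma> = {s \<in> \<Gamma>. vector_space.dim scale (range (\<lambda>v. v - s v)) = 2}"

text \<open>
  The form \<open>\<omega>\<^sub>s\<close>. For \<open>s\<close> of finite order in \<open>Sp(V)\<close>, \<open>V\<close> is the \<open>\<omega>\<close>-orthogonal direct sum of the image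
  and the kernel of \<open>1 - s\<close>, so exactly one form fits the description.
\<close>

definition reflection_form ::
    "(complex \<Rightarrow> 'v::ab_group_add \<Rightarrow> 'v) \<Rightarrow> ('v \<Rightarrow> 'v \<Rightarrow> complex) \<Rightarrow> ('v \<Rightarrow> 'v) \<Rightarrow> 'v \<Rightarrow> 'v \<Rightarrow> complex"
  where "reflection_form scale \<omega> s = (THE \<eta>. skew_form scale \<eta> \<and>
    (\<forall>x\<in>range (\<lambda>v. v - s v). \<forall>y\<in>range (\<lambda>v. v - s v). \<eta> x y = \<omega> x y) \<and>
    radical \<eta> = {v. v - s v = 0})"

definition conj_invariant ::
    "(complex \<Rightarrow> 'v::ab_group_add \<Rightarrow> 'v) \<Rightarrow> ('v \<Rightarrow> 'v) set \<Rightarrow> (('v \<Rightarrow> 'v) \<Rightarrow> complex) \<Rightarrow> bool"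
  where "conj_invariant scale \<Gamma> c \<longleftrightarrow>
    (\<forall>g\<in>\<Gamma>. \<forall>s\<in>sympl_reflections scale \<Gamma>. c (g \<circ> s \<circ> inv_into UNIV g) = c s)"


section \<open>Symplectic reflection algebras at \<open>t = 1\<close>\<close>

text \<open>
  The element \<open>\<Sum>\<^bsub>g\<in>\<Gamma>\<^esub> f\<^bsub>g\<^esub> g\<close> of the skew group algebra of \<open>\<Gamma>\<close> over \<open>T(V)\<close> is represented by its
  coefficient function \<open>f\<close>, set to zero outside \<open>\<Gamma>\<close>. The multiplication extends
  \<open>(a k) (b l) = (a k(b)) (k l)\<close> bilinearly.
\<close>

type_synonym 'v skew = "('v \<Rightarrow> 'v) \<Rightarrow> ('v list \<Rightarrow>\<^sub>0 complex) set"

definition skew_alg :: "(complex \<Rightarrow> 'v::ab_group_add \<Rightarrow> 'v) \<Rightarrow> ('v \<Rightarrow> 'v) set \<Rightarrow> 'v skew calg"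
  where "skew_alg scale \<Gamma> = (let T = tensor_alg scale in
    \<lparr>carrier = {f. (\<forall>g\<in>\<Gamma>. f g \<in> carrier T) \<and> (\<forall>g. g \<notin> \<Gamma> \<longrightarrow> f g = \<zero>\<^bsub>T\<^esub>)},
     mult = (\<lambda>f h g. \<Oplus>\<^bsub>T\<^esub>k\<in>\<Gamma>. f k \<otimes>\<^bsub>T\<^esub> tensor_act k (h (inv_into UNIV k \<circ> g))),
     one = (\<lambda>g. if g = id then \<one>\<^bsub>T\<^esub> else \<zero>\<^bsub>T\<^esub>),
     zero = (\<lambda>g. \<zero>\<^bsub>T\<^esub>),
     add = (\<lambda>f h g. f g \<oplus>\<^bsub>T\<^esub> h g),
     smult = (\<lambda>a f g. a \<odot>\<^bsub>T\<^esub> f g)\<rparr>)"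

definition skew_grp :: "(complex \<Rightarrow> 'v::ab_group_add \<Rightarrow> 'v) \<Rightarrow> ('v \<Rightarrow> 'v) \<Rightarrow> 'v skew"
  where "skew_grp scale g = (\<lambda>k. if k = g then \<one>\<^bsub>tensor_alg scale\<^esub> else \<zero>\<^bsub>tensor_alg scale\<^esub>)"

definition skew_vec :: "(complex \<Rightarrow> 'v::ab_group_add \<Rightarrow> 'v) \<Rightarrow> 'v \<Rightarrow> 'v skew"
  where "skew_vec scale v = (\<lambda>k. if k = id then tensor_vec scale v else \<zero>\<^bsub>tensor_alg scale\<^esub>)"

definition sra_ideal ::
    "(complex \<Rightarrow> 'v::ab_group_add \<Rightarrow> 'v) \<Rightarrow> ('v \<Rightarrow> 'v \<Rightarrow> complex) \<Rightarrow> ('v \<Rightarrow> 'v) set \<Rightarrow>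
      (('v \<Rightarrow> 'v) \<Rightarrow> complex) \<Rightarrow> 'v skew set"
  where "sra_ideal scale \<omega> \<Gamma> c = (let A = skew_alg scale \<Gamma>; \<iota> = skew_vec scale in
    Idl\<^bsub>A\<^esub> {\<iota> x \<otimes>\<^bsub>A\<^esub> \<iota> y \<ominus>\<^bsub>A\<^esub> \<iota> y \<otimes>\<^bsub>A\<^esub> \<iota> x \<ominus>\<^bsub>A\<^esub> \<omega> x y \<odot>\<^bsub>A\<^esub> \<one>\<^bsub>A\<^esub> \<ominus>\<^bsub>A\<^esub>
            (\<Oplus>\<^bsub>A\<^esub>s\<in>sympl_reflections scale \<Gamma>.
               (c s * reflection_form scale \<omega> s x y) \<odot>\<^bsub>A\<^esub> skew_grp scale s) | x y. True})"

definition sra ::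
    "(complex \<Rightarrow> 'v::ab_group_add \<Rightarrow> 'v) \<Rightarrow> ('v \<Rightarrow> 'v \<Rightarrow> complex) \<Rightarrow> ('v \<Rightarrow> 'v) set \<Rightarrow>
      (('v \<Rightarrow> 'v) \<Rightarrow> complex) \<Rightarrow> 'v skew set calg"
  where "sra scale \<omega> \<Gamma> c = quot_alg (skew_alg scale \<Gamma>) (sra_ideal scale \<omega> \<Gamma> c)"

definition sra_grp ::
    "(complex \<Rightarrow> 'v::ab_group_add \<Rightarrow> 'v) \<Rightarrow> ('v \<Rightarrow> 'v \<Rightarrow> complex) \<Rightarrow> ('v \<Rightarrow> 'v) set \<Rightarrow>
      (('v \<Rightarrow> 'v) \<Rightarrow> complex) \<Rightarrow> ('v \<Rightarrow> 'v) \<Rightarrow> 'v skew set"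
  where "sra_grp scale \<omega> \<Gamma> c g = sra_ideal scale \<omega> \<Gamma> c +>\<^bsub>skew_alg scale \<Gamma>\<^esub> skew_grp scale g"

definition sra_vec ::
    "(complex \<Rightarrow> 'v::ab_group_add \<Rightarrow> 'v) \<Rightarrow> ('v \<Rightarrow> 'v \<Rightarrow> complex) \<Rightarrow> ('v \<Rightarrow> 'v) set \<Rightarrow>
      (('v \<Rightarrow> 'v) \<Rightarrow> complex) \<Rightarrow> 'v \<Rightarrow> 'v skew set"
  where "sra_vec scale \<omega> \<Gamma> c v = sra_ideal scale \<omega> \<Gamma> c +>\<^bsub>skew_alg scale \<Gamma>\<^esub> skew_vec scale v"

definition sra_filtration ::
    "(complex \<Rightarrow> 'v::ab_group_add \<Rightarrow> 'v) \<Rightarrow> ('v \<Rightarrow> 'v \<Rightarrow> complex) \<Rightarrow> ('v \<Rightarrow> 'v) set \<Rightarrow>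
      (('v \<Rightarrow> 'v) \<Rightarrow> complex) \<Rightarrow> nat \<Rightarrow> 'v skew set set"
  where "sra_filtration scale \<omega> \<Gamma> c n = (let
      H = sra scale \<omega> \<Gamma> c;
      C\<Gamma> = lin_span H (sra_grp scale \<omega> \<Gamma> c ` \<Gamma>);
      C\<Gamma>V = lin_span H {sra_grp scale \<omega> \<Gamma> c g \<otimes>\<^bsub>H\<^esub> sra_vec scale \<omega> \<Gamma> c v | g v. g \<in> \<Gamma>}
    in if n = 0 then C\<Gamma> else subspace_power H (C\<Gamma> <+>\<^bsub>H\<^esub> C\<Gamma>V) n)"

definition sra_idem ::
    "(complex \<Rightarrow> 'v::ab_group_add \<Rightarrow> 'v) \<Rightarrow> ('v \<Rightarrow> 'v \<Rightarrow> complex) \<Rightarrow> ('v \<Rightarrow> 'v) set \<Rightarrow>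
      (('v \<Rightarrow> 'v) \<Rightarrow> complex) \<Rightarrow> 'v skew set"
  where "sra_idem scale \<omega> \<Gamma> c = (let H = sra scale \<omega> \<Gamma> c in
    (1 / of_nat (card \<Gamma>)) \<odot>\<^bsub>H\<^esub> (\<Oplus>\<^bsub>H\<^esub>g\<in>\<Gamma>. sra_grp scale \<omega> \<Gamma> c g))"

definition spherical ::
    "(complex \<Rightarrow> 'v::ab_group_add \<Rightarrow> 'v) \<Rightarrow> ('v \<Rightarrow> 'v \<Rightarrow> complex) \<Rightarrow> ('v \<Rightarrow> 'v) set \<Rightarrow>
      (('v \<Rightarrow> 'v) \<Rightarrow> complex) \<Rightarrow> 'v skew set calg"
  where "spherical scale \<omega> \<Gamma> c = (let H = sra scale \<omega> \<Gamma> c; e = sra_idem scale \<omega> \<Gamma> c in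
    H\<lparr>carrier := {e \<otimes>\<^bsub>H\<^esub> h \<otimes>\<^bsub>H\<^esub> e | h. h \<in> carrier H}, one := e\<rparr>)"

definition spherical_filtration ::
    "(complex \<Rightarrow> 'v::ab_group_add \<Rightarrow> 'v) \<Rightarrow> ('v \<Rightarrow> 'v \<Rightarrow> complex) \<Rightarrow> ('v \<Rightarrow> 'v) set \<Rightarrow>
      (('v \<Rightarrow> 'v) \<Rightarrow> complex) \<Rightarrow> nat \<Rightarrow> 'v skew set set"
  where "spherical_filtration scale \<omega> \<Gamma> c n =
    carrier (spherical scale \<omega> \<Gamma> c) \<inter> sra_filtration scale \<omega> \<Gamma> c n"

end

theory Submission
  imports Defs
begin

text \<open>
  Let \<open>e\<close> be the averaging idempotent. Since \<open>e w g e = w' e\<close> with \<open>w'\<close> the average of \<open>w\<close> over \<open>\<Gamma>\<close>, the map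
  \<open>t \<mapsto> t e\<close> is a filtered algebra surjection from \<open>T(V)\<^sup>\<Gamma>\<close> onto the spherical subalgebra. An invariant
  tensor of degree \<open>n\<close> is sent into filtration degree \<open>n - 1\<close> iff it vanishes in \<open>S(V)\<close>; the nontrivial
  direction is the Poincare--Birkhoff--Witt property. For the latter, let \<open>F\<^sub>n\<close> be spanned by the words of
  length at most \<open>n\<close> times elements of \<open>\<Gamma>\<close>, and \<open>I\<^sub>n \<subseteq> F\<^sub>n\<close> by the multiples of the relations of length
  at most \<open>n\<close>. A potential \<open>D\<close> on words of length \<open>n\<close> with \<open>D (u x y v) - D (u y x v) = u [x, y] v\<close> modulo
  \<open>I\<^bsub>n-1\<^esub>\<close>, where \<open>[x, y]\<close> is the prescribed commutator in \<open>\<complex>\<Gamma>\<close>, gives a retraction of \<open>F\<^sub>n\<close> onto \<open>F\<^bsub>n-1\<^esub>\<close>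
  mapping \<open>I\<^sub>n\<close> to \<open>I\<^bsub>n-1\<^esub>\<close>, so \<open>I\<^sub>n \<inter> F\<^bsub>n-1\<^esub> = I\<^bsub>n-1\<^esub>\<close>. It exists because the braid relation of transpositions
  amounts to a Jacobi identity, which holds since \<open>\<omega>\<^sub>s\<close> lives on the plane \<open>im (1 - s)\<close>. Finite generation
  follows from Noether's bound for \<open>S(V)\<^sup>\<Gamma>\<close> by lifting homogeneous generators.
\<close>

section \<open>Monoid algebras over the complex numbers\<close>

text \<open>The algebras in question are iterated quotients, so their elements are cosets of cosets.
  All computation is done upstairs instead, in monoid algebras over words in arbitrary vectors: each
  algebra is recorded as a homomorphic image of a subalgebra there, and afterwards only kernels and
  degrees are compared. The price is that letters are not linear upstairs. Linearity becomes one
  more family of relations, of degree 1, carried along in the filtration \<open>I n\<close>. This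
  shapes the construction of the potential: sorting needs an order and so works on words in a basis;
  the result is extended multilinearly, and the exchange rule is recovered slot by slot, exactly in
  the two exchanged slots, but only modulo linearity relations in the others. The Jacobi identity
  holds because an alternating trilinear expression on a plane vanishes. In the end the associated
  graded algebra and S(V)^\<Gamma> are both images of one algebra \<open>PG\<close> of invariant
  combinations of words, with the same kernel \<open>KS\<close>, so their isomorphism respects
  degrees without further work.\<close>

abbreviation (input) single where "single \<equiv> Poly_Mapping.single"
abbreviation (input) lookup where "lookup \<equiv> Poly_Mapping.lookup"
abbreviation (input) keys where "keys \<equiv> Poly_Mapping.keys"
abbreviation (input) mon :: "'m \<Rightarrow> ('m \<Rightarrow>\<^sub>0 complex)" where "mon k \<equiv> Poly_Mapping.single k 1"

definition smul :: "complex \<Rightarrow> ('m::monoid_add \<Rightarrow>\<^sub>0 complex) \<Rightarrow> ('m \<Rightarrow>\<^sub>0 complex)"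
  where "smul a x = single 0 a * x"

lemma lookup_smul [simp]: "lookup (smul a x) k = a * lookup x k"
  unfolding smul_def mult_map_scale_conv_mult[symmetric] by (simp add: map.rep_eq when_def)

interpretation pm: vector_space smul
  by unfold_locales (auto intro!: poly_mapping_eqI simp: lookup_add algebra_simps)

lemma smul_single [simp]: "smul a (single k b) = single k (a * b)"
  by (simp add: smul_def mult_single)

lemma poly_mapping_sum_single:
  "x = (\<Sum>k\<in>keys x. single k (lookup x k))"
  by (rule poly_mapping_eqI)
    (auto simp: lookup_sum lookup_single when_def in_keys_iff sum.delta' cong: if_cong)

lemma poly_mapping_in_span:
  "keys x \<subseteq> M \<Longrightarrow> x \<in> pm.span (mon ` M)"
  using pm.span_scale[OF pm.span_base[of _ "mon ` M"]]
  by (subst poly_mapping_sum_single, intro pm.span_sum) fastforce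

lemma span_singles:
  "pm.span (mon ` M) = {x. keys x \<subseteq> M}"
proof
  have "pm.subspace {x::'a \<Rightarrow>\<^sub>0 complex. keys x \<subseteq> M}"
    by (auto simp: pm.subspace_def in_keys_iff lookup_add subset_iff) (metis add.right_neutral)
  then show "pm.span (mon ` M) \<subseteq> {x::'a \<Rightarrow>\<^sub>0 complex. keys x \<subseteq> M}"
    by (intro pm.span_minimal) auto
qed (auto intro: poly_mapping_in_span)

text \<open>Linear identities are checked on monomials once the predicate cuts out a subspace; two
  nested uses handle bilinear identities.\<close>

lemma poly_mapping_linear_induct [case_names subspace single]:
  assumes "pm.subspace {x. Q x}" and "\<And>k. Q (mon k)"
  shows "Q (x :: 'm::monoid_add \<Rightarrow>\<^sub>0 complex)"
  using pm.span_induct[OF poly_mapping_in_span[of x UNIV], of Q] assms by auto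

text \<open>Scalars sit at the neutral element of the monoid, which commutes with everything, so
  they are central although words do not commute.\<close>

lemma single_smult_commute: "single 0 a * (x :: 'm::monoid_add \<Rightarrow>\<^sub>0 complex) = x * single 0 a"
proof (induction x rule: poly_mapping_linear_induct)
  case subspace
  have "single 0 a * smul c x = smul c (single 0 a * x)" for c and x :: "'m \<Rightarrow>\<^sub>0 complex"
    by (simp add: smul_def mult_single mult.assoc[symmetric] mult.commute)
  then show ?case
    by (auto simp: pm.subspace_def ring_distribs) (simp add: smul_def mult.assoc)
qed (simp add: mult_single)

lemma smul_mult_left [simp]: "smul a x * y = smul a (x * y)"
  by (simp add: smul_def mult.assoc)

lemma smul_mult_right [simp]: "x * smul a y = smul a (x * y)"
  by (metis smul_def mult.assoc single_smult_commute)

lemma subspace_mult_left: "pm.subspace W \<Longrightarrow> pm.subspace {x. a * x \<in> W}"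
  by (auto simp: pm.subspace_def ring_distribs)

lemma subspace_mult_right: "pm.subspace W \<Longrightarrow> pm.subspace {x. x * a \<in> W}"
  by (auto simp: pm.subspace_def ring_distribs)

definition lin_ext :: "('m \<Rightarrow> ('n::monoid_add \<Rightarrow>\<^sub>0 complex)) \<Rightarrow> ('m \<Rightarrow>\<^sub>0 complex) \<Rightarrow> ('n \<Rightarrow>\<^sub>0 complex)"
  where "lin_ext D x = (\<Sum>k\<in>keys x. smul (lookup x k) (D k))"

lemma lin_ext_superset:
  "finite A \<Longrightarrow> keys x \<subseteq> A \<Longrightarrow> lin_ext D x = (\<Sum>k\<in>A. smul (lookup x k) (D k))"
  unfolding lin_ext_def by (rule sum.mono_neutral_left) (auto simp: in_keys_iff)

lemma lin_ext_add: "lin_ext D (x + y) = lin_ext D x + lin_ext D y"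
proof -
  let ?A = "keys x \<union> keys y"
  have "lin_ext D z = (\<Sum>k\<in>?A. smul (lookup z k) (D k))" if "z \<in> {x, y, x + y}" for z
    using that keys_add[of x y] by (intro lin_ext_superset) auto
  then show ?thesis by (simp add: lookup_add pm.scale_left_distrib sum.distrib)
qed

lemma lin_ext_smul: "lin_ext D (smul a x) = smul a (lin_ext D x)"
proof -
  have "lin_ext D (smul a x) = (\<Sum>k\<in>keys x. smul (lookup (smul a x) k) (D k))"
    by (rule lin_ext_superset) (auto simp: in_keys_iff)
  then show ?thesis by (simp add: lin_ext_def pm.scale_sum_right)
qed

lemma lin_ext_0 [simp]: "lin_ext D 0 = 0"
  by (simp add: lin_ext_def)

lemma lin_ext_single [simp]: "lin_ext D (single k a) = smul a (D k)"
  by (simp add: lin_ext_def)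

lemma lin_ext_uminus: "lin_ext D (- x) = - lin_ext D x"
  using lin_ext_add[of D x "- x"] by (simp add: eq_neg_iff_add_eq_0 add.commute)

lemma lin_ext_diff: "lin_ext D (x - y) = lin_ext D x - lin_ext D y"
  using lin_ext_add[of D x "- y"] by (simp add: lin_ext_uminus)

lemma lin_ext_sum: "lin_ext D (\<Sum>i\<in>A. x i) = (\<Sum>i\<in>A. lin_ext D (x i))"
  by (induction A rule: infinite_finite_induct) (auto simp: lin_ext_add)

lemma subspace_lin_ext: "pm.subspace W \<Longrightarrow> pm.subspace {x. lin_ext D x \<in> W}"
  by (auto simp: pm.subspace_def lin_ext_add lin_ext_smul)

lemma lin_ext_id: "lin_ext mon x = x"
  using poly_mapping_sum_single[of x] by (simp add: lin_ext_def)

lemma lin_ext_mult: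
  assumes "\<And>k l. D (k + l) = D k * D l"
  shows "lin_ext D (x * y) = lin_ext D x * lin_ext D y"
proof (induction x rule: poly_mapping_linear_induct)
  case subspace
  then show ?case by (auto simp: pm.subspace_def lin_ext_add lin_ext_smul ring_distribs)
next
  case (single k)
  show ?case
  proof (induction y rule: poly_mapping_linear_induct)
    case subspace
    then show ?case by (auto simp: pm.subspace_def lin_ext_add lin_ext_smul ring_distribs)
  qed (simp add: mult_single assms)
qed

section \<open>Presentations of algebras by subalgebras of monoid algebras\<close>

definition subalg :: "('m::monoid_add \<Rightarrow>\<^sub>0 complex) set \<Rightarrow> bool"
  where "subalg R \<longleftrightarrow> pm.subspace R \<and> 1 \<in> R \<and> (\<forall>x\<in>R. \<forall>y\<in>R. x * y \<in> R)"

lemma subalgD: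
  assumes "subalg R"
  shows "pm.subspace R" "0 \<in> R" "1 \<in> R" "\<And>x y. x \<in> R \<Longrightarrow> y \<in> R \<Longrightarrow> x + y \<in> R"
    "\<And>x y. x \<in> R \<Longrightarrow> y \<in> R \<Longrightarrow> x - y \<in> R" "\<And>x y. x \<in> R \<Longrightarrow> y \<in> R \<Longrightarrow> x * y \<in> R"
    "\<And>a x. x \<in> R \<Longrightarrow> smul a x \<in> R" "\<And>x. x \<in> R \<Longrightarrow> - x \<in> R"
  using assms by (auto simp: subalg_def intro: pm.subspace_add pm.subspace_diff pm.subspace_scale pm.subspace_0 pm.subspace_neg)

text \<open>Nothing is assumed about the record \<open>A\<close>: its algebra axioms are inherited
  from \<open>R\<close> through the surjection. Only the restriction to \<open>R\<close> is
  constrained, so one map can serve both a free algebra and its invariants.\<close>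

definition presents :: "('m::monoid_add \<Rightarrow>\<^sub>0 complex) set \<Rightarrow> (('m \<Rightarrow>\<^sub>0 complex) \<Rightarrow> 'a) \<Rightarrow> 'a calg \<Rightarrow> bool"
  where "presents R f A \<longleftrightarrow> subalg R \<and> f ` R = carrier A \<and> f 0 = \<zero>\<^bsub>A\<^esub> \<and> f 1 = \<one>\<^bsub>A\<^esub> \<and>
    (\<forall>x\<in>R. \<forall>y\<in>R. f (x + y) = f x \<oplus>\<^bsub>A\<^esub> f y \<and> f (x * y) = f x \<otimes>\<^bsub>A\<^esub> f y) \<and>
    (\<forall>a. \<forall>x\<in>R. f (smul a x) = a \<odot>\<^bsub>A\<^esub> f x)"

lemma cring_complex_ring: "cring complex_ring"
proof (rule cringI)
  show "abelian_group complex_ring"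
    by (rule abelian_groupI) (auto simp: complex_ring_def intro: exI[of _ "- x" for x])
  show "Group.comm_monoid complex_ring"
    by unfold_locales (auto simp: complex_ring_def)
qed (auto simp: complex_ring_def algebra_simps)

locale presentation =
  fixes R :: "('m::monoid_add \<Rightarrow>\<^sub>0 complex) set" and f :: "('m \<Rightarrow>\<^sub>0 complex) \<Rightarrow> 'a" and A :: "'a calg" (structure)
  assumes pres: "presents R f A"
begin

lemma subalg_R: "subalg R"
  using pres by (simp add: presents_def)

lemmas R = subalgD[OF subalg_R]

lemma f_hom: "f 0 = \<zero>" "f 1 = \<one>"
  "\<And>x y. x \<in> R \<Longrightarrow> y \<in> R \<Longrightarrow> f (x + y) = f x \<oplus> f y"
  "\<And>x y. x \<in> R \<Longrightarrow> y \<in> R \<Longrightarrow> f (x * y) = f x \<otimes> f y"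
  "\<And>a x. x \<in> R \<Longrightarrow> f (smul a x) = a \<odot> f x"
  and f_carrier: "f ` R = carrier A"
  using pres unfolding presents_def by blast+

lemma f_closed [simp, intro]: "x \<in> R \<Longrightarrow> f x \<in> carrier A"
  using f_carrier by blast

lemma carrierE:
  assumes "u \<in> carrier A"
  obtains x where "x \<in> R" "u = f x"
  using assms f_carrier by (metis imageE)

lemma abelian: "abelian_group A"
proof (rule abelian_groupI)
  fix u assume "u \<in> carrier A"
  then obtain x where x: "x \<in> R" "u = f x" by (rule carrierE)
  have "f (- x) \<oplus> u = \<zero>"
    using x R(8) f_hom(3)[of "- x" x] f_hom(1) by simp
  then show "\<exists>y\<in>carrier A. y \<oplus> u = \<zero>" using x R(8) by blast
next
  show "x \<oplus> y \<in> carrier A" if "x \<in> carrier A" "y \<in> carrier A" for x y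
    using that by (auto elim!: carrierE simp: f_hom(3)[symmetric] R)
  show "\<zero> \<in> carrier A" using R(2) f_hom(1) by (metis f_closed)
  show "x \<oplus> y \<oplus> z = x \<oplus> (y \<oplus> z)" if "x \<in> carrier A" "y \<in> carrier A" "z \<in> carrier A" for x y z
    using that by (auto elim!: carrierE simp: f_hom(3)[symmetric] R add.assoc)
  show "x \<oplus> y = y \<oplus> x" if "x \<in> carrier A" "y \<in> carrier A" for x y
    using that by (auto elim!: carrierE simp: f_hom(3)[symmetric] R add.commute)
  show "\<zero> \<oplus> x = x" if "x \<in> carrier A" for x
    using that by (auto elim!: carrierE simp: f_hom(3)[symmetric] f_hom(1)[symmetric] R)
qed

lemma ring: "ring A"
proof (rule ringI[OF abelian])
  show "Group.monoid A"
    by (rule monoidI; (auto elim!: carrierE simp: f_hom(4)[symmetric] R mult.assoc)?)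
       (auto elim!: carrierE simp: f_hom(2,4)[symmetric] R)
qed (auto elim!: carrierE simp: f_hom(3,4)[symmetric] R ring_distribs)

sublocale A: ring A by (rule ring)

lemma f_minus: "x \<in> R \<Longrightarrow> f (- x) = \<ominus> f x"
  using f_hom(3)[of "- x" x] R(8) f_hom(1) by (intro A.minus_equality[symmetric]) auto

lemma f_diff: "x \<in> R \<Longrightarrow> y \<in> R \<Longrightarrow> f (x - y) = f x \<ominus> f y"
  using f_hom(3)[of x "- y"] R(8) by (simp add: f_minus a_minus_def)

lemma f_finsum: "finite I \<Longrightarrow> (\<And>i. i \<in> I \<Longrightarrow> x i \<in> R) \<Longrightarrow> f (\<Sum>i\<in>I. x i) = (\<Oplus>i\<in>I. f (x i))"
proof (induction I rule: finite_induct)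
  case empty then show ?case by (simp add: f_hom)
next
  case (insert j I)
  have "(\<Sum>i\<in>I. x i) \<in> R" using insert.prems R(1) by (intro pm.subspace_sum) auto
  then show ?case using insert by (subst A.finsum_insert) (auto simp: f_hom)
qed

lemma f_eq_iff: "x \<in> R \<Longrightarrow> y \<in> R \<Longrightarrow> f x = f y \<longleftrightarrow> f (x - y) = \<zero>"
  by (simp add: f_diff A.r_right_minus_eq)

lemma module: "Module.module complex_ring A"
proof (rule moduleI[OF cring_complex_ring abelian])
  show "x \<in> carrier A \<Longrightarrow> a \<odot> x \<in> carrier A" for a x
    by (auto elim!: carrierE simp: f_hom(5)[symmetric] R)
qed (auto elim!: carrierE simp: f_hom(3,5)[symmetric] R complex_ring_def pm.scale_left_distrib pm.scale_right_distrib)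

lemma calgebra: "calgebra A"
  unfolding calgebra_def
  by (auto simp: ring module elim!: carrierE) (auto simp: f_hom(4,5)[symmetric] R)

lemma submodule_image:
  assumes "pm.subspace W" "W \<subseteq> R"
  shows "submodule (f ` W) complex_ring A"
proof -
  interpret M: Module.module complex_ring A by (rule module)
  show ?thesis
  proof (rule M.submoduleI)
    show "f ` W \<subseteq> carrier A" using assms by auto
    show "\<zero> \<in> f ` W" using assms pm.subspace_0 f_hom(1) by (metis imageI)
    show "\<ominus> x \<in> f ` W" if "x \<in> f ` W" for x
      using that assms by (auto simp: f_minus[symmetric] subset_iff pm.subspace_neg intro!: imageI)
    show "x \<oplus> y \<in> f ` W" if "x \<in> f ` W" "y \<in> f ` W" for x y
      using that assms by (auto simp: f_hom(3)[symmetric] subset_iff pm.subspace_add intro!: imageI)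
    show "a \<odot> x \<in> f ` W" if "x \<in> f ` W" for a x
      using that assms by (auto simp: f_hom(5)[symmetric] subset_iff pm.subspace_scale intro!: imageI)
  qed
qed

lemma subspace_preimage:
  assumes "submodule W complex_ring A"
  shows "pm.subspace {x \<in> R. f x \<in> W}"
proof -
  interpret M: Module.module complex_ring A by (rule module)
  interpret W: submodule W complex_ring A by (rule assms)
  have "a \<odot> x \<in> W" if "x \<in> W" for a x
    using that W.smult_closed by (simp add: complex_ring_def)
  moreover have "\<zero> \<in> W" using W.one_closed by simp
  moreover have "x \<oplus> y \<in> W" if "x \<in> W" "y \<in> W" for x y using W.m_closed that by simp
  ultimately show ?thesis
    by (auto simp: pm.subspace_def R f_hom)
qed

lemma span_subset_R: "Y \<subseteq> R \<Longrightarrow> pm.span Y \<subseteq> R"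
  by (rule pm.span_minimal) (auto simp: R)

lemma lin_span_image:
  assumes "Y \<subseteq> R"
  shows "lin_span A (f ` Y) = f ` pm.span Y"
proof
  show "lin_span A (f ` Y) \<subseteq> f ` pm.span Y"
    unfolding lin_span_def using assms
    by (intro Inter_lower) (auto intro!: submodule_image span_subset_R intro: pm.span_base)
  show "f ` pm.span Y \<subseteq> lin_span A (f ` Y)"
    unfolding lin_span_def
  proof (intro Inter_greatest, clarify)
    fix W x assume W: "submodule W complex_ring A" "f ` Y \<subseteq> W" and x: "x \<in> pm.span Y"
    have "pm.span Y \<subseteq> {x \<in> R. f x \<in> W}"
      using W assms by (intro pm.span_minimal subspace_preimage) auto
    then show "f x \<in> W" using x by auto
  qed
qed

lemma subspace_mult_image:
  assumes "W \<subseteq> R" "W' \<subseteq> R"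
  shows "subspace_mult A (f ` W) (f ` W') = f ` pm.span {x * y | x y. x \<in> W \<and> y \<in> W'}"
proof -
  have "{x \<otimes> y | x y. x \<in> f ` W \<and> y \<in> f ` W'} = f ` {x * y | x y. x \<in> W \<and> y \<in> W'}"
    using assms by (force simp: f_hom(4) subset_iff image_iff)
  moreover have "{x * y | x y. x \<in> W \<and> y \<in> W'} \<subseteq> R" using assms by (auto simp: subset_iff R)
  ultimately show ?thesis unfolding subspace_mult_def by (simp add: lin_span_image)
qed

lemma finite_dim_image:
  assumes "finite Y" "Y \<subseteq> R"
  shows "finite_dim A (f ` pm.span Y)"
  unfolding finite_dim_def using assms lin_span_image by (intro exI[of _ "f ` Y"]) auto

end

definition ideal_span :: "('m::monoid_add \<Rightarrow>\<^sub>0 complex) set \<Rightarrow> ('m \<Rightarrow>\<^sub>0 complex) set \<Rightarrow> ('m \<Rightarrow>\<^sub>0 complex) set"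
  where "ideal_span R X = pm.span {a * x * b | a x b. a \<in> R \<and> x \<in> X \<and> b \<in> R}"

lemma subspace_ideal_span [simp, intro]: "pm.subspace (ideal_span R X)"
  by (simp add: ideal_span_def)

lemma ideal_span_subset: "subalg R \<Longrightarrow> X \<subseteq> R \<Longrightarrow> ideal_span R X \<subseteq> R"
  unfolding ideal_span_def by (rule pm.span_minimal) (auto simp: subalgD subset_iff)

lemma ideal_span_base: "subalg R \<Longrightarrow> x \<in> X \<Longrightarrow> x \<in> ideal_span R X"
  unfolding ideal_span_def by (rule pm.span_base) (force simp: subalgD intro: exI[of _ 1])

lemma ideal_span_mult_left:
  assumes "subalg R" "a \<in> R" "x \<in> ideal_span R X"
  shows "a * x \<in> ideal_span R X"
proof -
  have "a * (b * y * c) = (a * b) * y * c" for b y c by (simp add: mult.assoc)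
  then have "ideal_span R X \<subseteq> {x. a * x \<in> ideal_span R X}"
    unfolding ideal_span_def
    using assms by (intro pm.span_minimal subspace_mult_left) (auto intro!: pm.span_base simp: subalgD, metis subalgD(6))
  then show ?thesis using assms by auto
qed

lemma ideal_span_mult_right:
  assumes "subalg R" "a \<in> R" "x \<in> ideal_span R X"
  shows "x * a \<in> ideal_span R X"
proof -
  have "(b * y * c) * a = b * y * (c * a)" for b y c by (simp add: mult.assoc)
  then have "ideal_span R X \<subseteq> {x. x * a \<in> ideal_span R X}"
    unfolding ideal_span_def
    using assms by (intro pm.span_minimal subspace_mult_right) (auto intro!: pm.span_base simp: subalgD, metis subalgD(6))
  then show ?thesis using assms by auto
qed

lemma ideal_span_minimal:
  assumes "pm.subspace W" "\<And>a x b. a \<in> R \<Longrightarrow> x \<in> X \<Longrightarrow> b \<in> R \<Longrightarrow> a * x * b \<in> W"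
  shows "ideal_span R X \<subseteq> W"
  unfolding ideal_span_def using assms by (intro pm.span_minimal) auto

context presentation
begin

text \<open>The library ideal is closed under addition and ring multiplication, while
  \<open>ideal_span\<close> is a linear span. They agree because a scalar multiple of x is the
  product of x with a multiple of the unit.\<close>

lemma Idl_image:
  assumes "X \<subseteq> R"
  shows "Idl (f ` X) = f ` ideal_span R X"
proof
  have sub: "ideal_span R X \<subseteq> R" using ideal_span_subset[OF subalg_R assms] .
  interpret M: Module.module complex_ring A by (rule module)
  interpret W: submodule "f ` ideal_span R X" complex_ring A
    by (rule submodule_image[OF _ sub]) simp
  have "ideal (f ` ideal_span R X) A"
  proof (rule idealI[OF ring])
    show "subgroup (f ` ideal_span R X) (add_monoid A)" by (rule W.subgroup_axioms)
  next
    fix a x assume a: "a \<in> f ` ideal_span R X" and x: "x \<in> carrier A"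
    then obtain b y where b: "a = f b" "b \<in> ideal_span R X" and y: "x = f y" "y \<in> R" by (auto elim: carrierE)
    then show "x \<otimes> a \<in> f ` ideal_span R X" "a \<otimes> x \<in> f ` ideal_span R X"
      using sub ideal_span_mult_left[OF subalg_R y(2) b(2)] ideal_span_mult_right[OF subalg_R y(2) b(2)]
      by (auto simp: f_hom(4)[symmetric] subset_iff)
  qed
  then show "Idl (f ` X) \<subseteq> f ` ideal_span R X"
    by (rule A.genideal_minimal) (auto intro: ideal_span_base[OF subalg_R])
  have "f ` X \<subseteq> carrier A" using assms by auto
  then interpret J: ideal "Idl (f ` X)" A by (rule A.genideal_ideal)
  have sm: "submodule (Idl (f ` X)) complex_ring A"
  proof (rule M.submoduleI)
    fix a x assume x: "x \<in> Idl (f ` X)"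
    then obtain y where y: "y \<in> R" "x = f y" by (metis J.a_Hcarr carrierE)
    have "a \<odot> x = f (smul a 1) \<otimes> x"
      using y by (simp add: f_hom(4)[symmetric] f_hom(5)[symmetric] R)
    then show "a \<odot> x \<in> Idl (f ` X)" using x R by (auto intro: J.I_l_closed)
  qed (auto simp: J.a_Hcarr)
  have "ideal_span R X \<subseteq> {x \<in> R. f x \<in> Idl (f ` X)}"
  proof (rule ideal_span_minimal[OF subspace_preimage[OF sm]])
    fix a x b assume "a \<in> R" "x \<in> X" "b \<in> R"
    moreover have "f x \<in> Idl (f ` X)" using A.genideal_self[OF \<open>f ` X \<subseteq> carrier A\<close>] \<open>x \<in> X\<close> by blast
    ultimately show "a * x * b \<in> {x \<in> R. f x \<in> Idl (f ` X)}"
      using assms by (auto simp: f_hom(4) subset_iff R J.I_l_closed J.I_r_closed)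
  qed
  then show "f ` ideal_span R X \<subseteq> Idl (f ` X)" by auto
qed

text \<open>The new kernel is the old one plus the ideal spanned by the relations. This is the
  passage from the free algebra to T(V), from T(V) to S(V), and from the skew group algebra to
  H.\<close>

lemma quot_presents:
  assumes "X \<subseteq> R"
  defines "J \<equiv> Idl (f ` X)"
  shows "presents R (\<lambda>x. J +> f x) (quot_alg A J)"
    and "x \<in> R \<Longrightarrow> J +> f x = \<zero>\<^bsub>quot_alg A J\<^esub> \<longleftrightarrow> (\<exists>z\<in>ideal_span R X. f (x - z) = \<zero>)"
proof -
  have sub: "ideal_span R X \<subseteq> R" using ideal_span_subset[OF subalg_R assms(1)] .
  have "f ` X \<subseteq> carrier A" using assms by auto
  then interpret J: ideal J A unfolding J_def by (rule A.genideal_ideal)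
  interpret M: Module.module complex_ring A by (rule module)
  have J: "J = f ` ideal_span R X" unfolding J_def by (rule Idl_image[OF assms(1)])
  have smJ: "a \<odot> u \<in> J" if "u \<in> J" for a u
    using that sub unfolding J by (auto simp: f_hom(5)[symmetric] subset_iff intro!: imageI pm.subspace_scale)
  \<comment> \<open>The union defining the scalar action on a quotient is a union of equal
    cosets.\<close>
  have sm: "(\<Union>u\<in>J +> f x. J +> (a \<odot> u)) = J +> (a \<odot> f x)" if x: "x \<in> R" for a x
  proof -
    have "J +> (a \<odot> u) = J +> (a \<odot> f x)" if u: "u \<in> J +> f x" for u
    proof -
      from u obtain j where j: "j \<in> J" "u = j \<oplus> f x" by (auto simp: a_r_coset_def')
      have cl: "b \<odot> v \<in> carrier A" if "v \<in> carrier A" for b v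
        using that M.smult_closed[of b v] by (simp add: complex_ring_def)
      have "a \<odot> u = a \<odot> j \<oplus> a \<odot> f x"
        using j x M.smult_r_distr[of a j "f x"] by (simp add: complex_ring_def J.a_Hcarr)
      then have "a \<odot> u \<in> J +> (a \<odot> f x)" using smJ j by (auto simp: a_r_coset_def')
      then show ?thesis using J.a_repr_independence' cl x by (metis f_closed)
    qed
    moreover have "f x \<in> J +> f x" using x J.a_rcos_self by auto
    ultimately show ?thesis by blast
  qed
  show "presents R (\<lambda>x. J +> f x) (quot_alg A J)"
    unfolding presents_def quot_alg_def ring.extend_def FactRing_def module.fields_def
    using subalg_R f_carrier[symmetric]
    by (auto simp: f_hom A_RCOSETS_def' J.rcoset_mult_add J.a_rcos_sum sm J.a_rcos_const)
  show "J +> f x = \<zero>\<^bsub>quot_alg A J\<^esub> \<longleftrightarrow> (\<exists>z\<in>ideal_span R X. f (x - z) = \<zero>)" if x: "x \<in> R"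
  proof -
    have "J +> f x = \<zero>\<^bsub>quot_alg A J\<^esub> \<longleftrightarrow> J +> f x = J"
      by (simp add: quot_alg_def ring.extend_def FactRing_def module.fields_def)
    also have "\<dots> \<longleftrightarrow> f x \<in> J"
      using x J.a_rcos_self J.a_rcos_const by (metis f_closed)
    also have "\<dots> \<longleftrightarrow> (\<exists>z\<in>ideal_span R X. f x = f z)" unfolding J by auto
    also have "\<dots> \<longleftrightarrow> (\<exists>z\<in>ideal_span R X. f (x - z) = \<zero>)"
      using f_eq_iff[OF x] sub by blast
    finally show ?thesis .
  qed
qed

end

section \<open>Generation and comparison of presented algebras\<close>

inductive_set alg_gen :: "('m::monoid_add \<Rightarrow>\<^sub>0 complex) set \<Rightarrow> ('m \<Rightarrow>\<^sub>0 complex) set" for Y where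
  one: "1 \<in> alg_gen Y"
| base: "y \<in> Y \<Longrightarrow> y \<in> alg_gen Y"
| add: "x \<in> alg_gen Y \<Longrightarrow> y \<in> alg_gen Y \<Longrightarrow> x + y \<in> alg_gen Y"
| mult: "x \<in> alg_gen Y \<Longrightarrow> y \<in> alg_gen Y \<Longrightarrow> x * y \<in> alg_gen Y"
| smul: "x \<in> alg_gen Y \<Longrightarrow> smul a x \<in> alg_gen Y"

lemma alg_gen_zero: "0 \<in> alg_gen Y"
  using alg_gen.smul[OF alg_gen.one, of 0] by simp

lemma subalg_alg_gen: "subalg (alg_gen Y)"
  unfolding subalg_def pm.subspace_def by (auto intro: alg_gen.intros alg_gen_zero)

lemma alg_gen_minimal: "subalg R \<Longrightarrow> Y \<subseteq> R \<Longrightarrow> alg_gen Y \<subseteq> R"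
proof
  fix x assume "subalg R" "Y \<subseteq> R" "x \<in> alg_gen Y"
  from this(3) show "x \<in> R" using \<open>subalg R\<close> \<open>Y \<subseteq> R\<close> by induction (auto simp: subalgD)
qed

context presentation
begin

text \<open>Equality is required only after applying \<open>f\<close>, so generation may be checked
  modulo the kernel.\<close>

lemma finitely_generated_if:
  assumes "finite Y" "Y \<subseteq> R" "\<And>x. x \<in> R \<Longrightarrow> \<exists>y\<in>alg_gen Y. f x = f y"
  shows "finitely_generated A"
  unfolding finitely_generated_def
proof (intro exI[of _ "f ` Y"] conjI allI impI)
  fix B assume "csubalgebra B A \<and> f ` Y \<subseteq> B"
  then have B: "subring B A" "submodule B complex_ring A" "f ` Y \<subseteq> B" by (auto simp: csubalgebra_def)
  interpret B: submodule B complex_ring A by (rule B(2))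
  interpret B': subring B A by (rule B(1))
  have "f y \<in> B" if "y \<in> alg_gen Y" for y
    using that
  proof (induction)
    case one then show ?case by (simp add: f_hom B'.one_closed)
  next
    case (base y) then show ?case using B by auto
  next
    case (add x y)
    then show ?case using alg_gen_minimal[OF subalg_R assms(2)] B.m_closed by (auto simp: f_hom subset_iff)
  next
    case (mult x y)
    then show ?case using alg_gen_minimal[OF subalg_R assms(2)] B'.m_closed by (auto simp: f_hom subset_iff)
  next
    case (smul x a)
    then show ?case using alg_gen_minimal[OF subalg_R assms(2)] B.smult_closed
      by (auto simp: f_hom subset_iff complex_ring_def)
  qed
  then have "carrier A \<subseteq> B" using assms(3) by (metis carrierE subsetI)
  moreover have "B \<subseteq> carrier A" using B.subset by simp
  ultimately show "B = carrier A" by simp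
qed (use assms in auto)

lemma commutative_if:
  assumes "\<And>x y. x \<in> R \<Longrightarrow> y \<in> R \<Longrightarrow> f (x * y) = f (y * x)"
  shows "commutative A"
  unfolding commutative_def using assms by (auto elim!: carrierE simp: f_hom(4)[symmetric])

lemma coset_eq_image:
  assumes "pm.subspace W" "W \<subseteq> R" "x \<in> R"
  shows "f ` W +> f x = f ` {w + x | w. w \<in> W}"
  using assms by (auto simp: a_r_coset_def' f_hom(3) subset_iff image_iff) (metis f_hom(3))+

lemma coset_mem_iff:
  assumes "pm.subspace W" "W \<subseteq> R" "x \<in> R" "y \<in> R"
  shows "f y \<in> f ` W +> f x \<longleftrightarrow> f (y - x) \<in> f ` W"
proof
  assume "f y \<in> f ` W +> f x"
  then obtain w where w: "w \<in> W" "f y = f (w + x)" using assms coset_eq_image by auto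
  then have "f (y - (w + x)) = \<zero>" using assms R f_eq_iff by (metis subsetD)
  then have "f (y - x - w) = \<zero>" by (simp add: algebra_simps)
  then have "f (y - x) = f w" using assms R f_eq_iff w by (metis subsetD)
  then show "f (y - x) \<in> f ` W" using w by auto
next
  assume "f (y - x) \<in> f ` W"
  then obtain w where w: "w \<in> W" "f (y - x) = f w" by auto
  have "f (w + x) = f (y - x + x)"
    using w assms R by (metis f_hom(3) subsetD)
  then show "f y \<in> f ` W +> f x" using coset_eq_image[OF assms(1,2,3)] w by (auto simp: image_iff)
qed

lemma coset_eq_iff:
  assumes "pm.subspace W" "W \<subseteq> R" "x \<in> R" "y \<in> R"
  shows "f ` W +> f x = f ` W +> f y \<longleftrightarrow> f (x - y) \<in> f ` W"
proof -
  interpret W: submodule "f ` W" complex_ring A using assms by (intro submodule_image)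
  interpret W: abelian_subgroup "f ` W" A
    using abelian W.subgroup_axioms by (intro abelian_subgroupI3) (auto simp: additive_subgroup_def)
  show ?thesis
    using assms coset_mem_iff[OF assms(1,2,4,3)] W.a_repr_independence' W.a_repr_independenceD
    by (metis f_closed)
qed

lemma coset_eqI:
  assumes "pm.subspace W" "W \<subseteq> R" "x \<in> R" "y \<in> R" "x - y \<in> W"
  shows "f ` W +> f x = f ` W +> f y"
  using assms by (simp add: coset_eq_iff)

lemma coset_add:
  assumes "pm.subspace W" "W \<subseteq> R" "x \<in> R" "y \<in> R"
  shows "(f ` W +> f x) <+> (f ` W +> f y) = f ` W +> f (x + y)"
proof -
  interpret W: submodule "f ` W" complex_ring A using assms by (intro submodule_image)
  interpret W: abelian_subgroup "f ` W" A
    using abelian W.subgroup_axioms by (intro abelian_subgroupI3) (auto simp: additive_subgroup_def)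
  show ?thesis using assms by (simp add: W.a_rcos_sum f_hom)
qed

lemma coset_smult:
  assumes "pm.subspace W" "W \<subseteq> R" "x \<in> R"
  shows "(\<Union>u\<in>f ` W +> f x. f ` W +> (a \<odot> u)) = f ` W +> f (smul a x)"
proof -
  have "f ` W +> (a \<odot> u) = f ` W +> f (smul a x)" if "u \<in> f ` W +> f x" for u
  proof -
    from that obtain w where w: "w \<in> W" "u = f (w + x)" using assms coset_eq_image by auto
    then have wR: "w \<in> R" using assms by auto
    have "smul a (w + x) - smul a x \<in> W"
      using w assms by (simp add: pm.scale_right_distrib pm.subspace_scale)
    then have "f ` W +> f (smul a (w + x)) = f ` W +> f (smul a x)"
      using assms wR by (intro coset_eqI) (auto simp: R)
    then show ?thesis using w wR assms R by (simp add: f_hom)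
  qed
  moreover have "f x \<in> f ` W +> f x" using assms
    by (simp add: coset_mem_iff f_hom) (metis f_hom(1) image_eqI pm.subspace_0)
  ultimately show ?thesis by blast
qed

end

text \<open>Both algebras are \<open>R\<close> modulo the same kernel. The last clause is kept
  because it later determines the images of the graded components.\<close>

lemma presents_same_kernel_iso:
  assumes "presents R f A" "presents R g B" "\<And>x. x \<in> R \<Longrightarrow> f x = \<zero>\<^bsub>A\<^esub> \<longleftrightarrow> g x = \<zero>\<^bsub>B\<^esub>"
  obtains \<phi> where "\<phi> \<in> ring_iso A B" "\<And>c x. x \<in> carrier A \<Longrightarrow> \<phi> (c \<odot>\<^bsub>A\<^esub> x) = c \<odot>\<^bsub>B\<^esub> \<phi> x"
    "\<And>x. x \<in> R \<Longrightarrow> \<phi> (f x) = g x"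
proof -
  interpret A: presentation R f A by (rule presentation.intro, fact)
  interpret B: presentation R g B by (rule presentation.intro, fact)
  have eq: "f x = f y \<longleftrightarrow> g x = g y" if "x \<in> R" "y \<in> R" for x y
    using that A.f_eq_iff B.f_eq_iff assms(3) A.R by metis
  \<comment> \<open>Uses a chosen preimage; by \<open>eq\<close> the value does not depend on the
    choice.\<close>
  define \<phi> where "\<phi> u = g (SOME x. x \<in> R \<and> f x = u)" for u
  have \<phi>: "\<phi> (f x) = g x" if "x \<in> R" for x
    unfolding \<phi>_def using someI[of "\<lambda>y. y \<in> R \<and> f y = f x" x] that eq by metis
  have "\<phi> \<in> ring_hom A B"
    by (rule ring_hom_memI)
       (auto elim!: A.carrierE simp: A.f_hom(3,4)[symmetric] A.f_hom(2)[symmetric] A.R \<phi> B.f_hom)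
  moreover have "bij_betw \<phi> (carrier A) (carrier B)"
  proof (rule bij_betw_imageI)
    show "inj_on \<phi> (carrier A)"
      by (auto simp: inj_on_def \<phi> eq elim!: A.carrierE)
    show "\<phi> ` carrier A = carrier B"
      unfolding A.f_carrier[symmetric] B.f_carrier[symmetric] using \<phi> by (auto simp: image_iff)
  qed
  ultimately have "\<phi> \<in> ring_iso A B" by (simp add: ring_iso_def)
  moreover have "\<phi> (c \<odot>\<^bsub>A\<^esub> x) = c \<odot>\<^bsub>B\<^esub> \<phi> x" if "x \<in> carrier A" for c x
    using that by (auto elim!: A.carrierE simp: A.f_hom(5)[symmetric] A.R \<phi> B.f_hom)
  ultimately show thesis using that \<phi> by blast
qed

section \<open>Word length and homogeneous components\<close>

lemma single_Nil [simp]: "mon [] = (1 :: 'a list \<Rightarrow>\<^sub>0 complex)"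
  using single_one[where 'a = "'a list" and 'b = complex] by (simp add: zero_list_def)

definition hcomp :: "nat \<Rightarrow> ('v list \<Rightarrow>\<^sub>0 complex) \<Rightarrow> ('v list \<Rightarrow>\<^sub>0 complex)"
  where "hcomp n = lin_ext (\<lambda>w. if length w = n then mon w else 0)"

text \<open>The strict bound makes \<open>deg_lt 0\<close> the zero space, which matches the
  convention that the filtration step of index -1 is zero.\<close>

definition deg_lt :: "nat \<Rightarrow> ('v list \<Rightarrow>\<^sub>0 complex) set"
  where "deg_lt n = {p. \<forall>w\<in>keys p. length w < n}"

lemma hcomp_add: "hcomp n (p + q) = hcomp n p + hcomp n q"
  and hcomp_diff: "hcomp n (p - q) = hcomp n p - hcomp n q"
  and hcomp_smul: "hcomp n (smul a p) = smul a (hcomp n p)"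
  and hcomp_sum: "hcomp n (\<Sum>i\<in>I. h i) = (\<Sum>i\<in>I. hcomp n (h i))"
  and hcomp_zero [simp]: "hcomp n 0 = 0"
  by (simp_all add: hcomp_def lin_ext_add lin_ext_diff lin_ext_smul lin_ext_sum)

lemma hcomp_single: "hcomp n (single w a) = (if length w = n then single w a else 0)"
  by (simp add: hcomp_def)

lemma subspace_hcomp: "pm.subspace W \<Longrightarrow> pm.subspace {p. hcomp n p \<in> W}"
  unfolding hcomp_def by (rule subspace_lin_ext)

lemma lookup_hcomp: "lookup (hcomp n p) w = (if length w = n then lookup p w else 0)"
proof (induction p rule: poly_mapping_linear_induct)
  case subspace
  then show ?case by (auto simp: pm.subspace_def hcomp_add hcomp_smul lookup_add)
qed (auto simp: hcomp_single lookup_single when_def)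

lemma hcomp_hcomp: "hcomp m (hcomp n p) = (if m = n then hcomp n p else 0)"
  by (rule poly_mapping_eqI) (auto simp: lookup_hcomp)

lemma hcomp_one: "hcomp n 1 = (if n = 0 then 1 else 0)"
  unfolding single_Nil[symmetric] by (auto simp: hcomp_single simp del: single_Nil)

lemma keys_hcomp: "keys (hcomp n p) = {w \<in> keys p. length w = n}"
  by (auto simp: in_keys_iff lookup_hcomp split: if_splits)

lemma subspace_deg_lt: "pm.subspace (deg_lt n)"
  using pm.subspace_span[of "mon ` {w. length w < n}"]
  unfolding span_singles by (simp add: deg_lt_def subset_iff Ball_def)

lemma deg_lt_mono: "m \<le> n \<Longrightarrow> p \<in> deg_lt m \<Longrightarrow> p \<in> deg_lt n"
  unfolding deg_lt_def by fastforce

lemma deg_lt_0 [simp]: "deg_lt 0 = {0}"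
  by (auto simp: deg_lt_def)

lemma ex_deg_lt: "\<exists>n. p \<in> deg_lt n"
proof -
  have "length w < Suc (Max (length ` keys p))" if "w \<in> keys p" for w
    using that by (simp add: less_Suc_eq_le)
  then show ?thesis unfolding deg_lt_def by blast
qed

lemma hcomp_deg_lt: "hcomp n p \<in> deg_lt (Suc n)"
  by (auto simp: deg_lt_def keys_hcomp)

lemma deg_lt_iff_hcomp: "p \<in> deg_lt n \<longleftrightarrow> (\<forall>i\<ge>n. hcomp i p = 0)"
proof
  assume "p \<in> deg_lt n"
  then have "lookup p w = 0" if "length w \<ge> n" for w
    using that by (force simp: deg_lt_def in_keys_iff not_le)
  then show "\<forall>i\<ge>n. hcomp i p = 0"
    by (auto intro!: poly_mapping_eqI simp: lookup_hcomp)
next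
  assume *: "\<forall>i\<ge>n. hcomp i p = 0"
  have False if "w \<in> keys p" "length w \<ge> n" for w
    using * that lookup_hcomp[of "length w" p w] by (simp add: in_keys_iff)
  then show "p \<in> deg_lt n" by (force simp: deg_lt_def)
qed

lemma deg_lt_diff_hcomp:
  assumes "p \<in> deg_lt (Suc n)"
  shows "p - hcomp n p \<in> deg_lt n"
proof -
  have "hcomp i p = 0" if "n < i" for i using assms that by (simp add: deg_lt_iff_hcomp)
  then show ?thesis by (auto simp: deg_lt_iff_hcomp hcomp_diff hcomp_hcomp)
qed

lemma sum_hcomp:
  assumes "p \<in> deg_lt n"
  shows "p = (\<Sum>i<n. hcomp i p)"
proof (rule poly_mapping_eqI)
  fix w
  show "lookup p w = lookup (\<Sum>i<n. hcomp i p) w"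
    using assms by (auto simp: lookup_sum lookup_hcomp deg_lt_def in_keys_iff cong: if_cong)
qed

lemma hcomp_mult: "hcomp n (p * q) = (\<Sum>i\<le>n. hcomp i p * hcomp (n - i) q)"
proof (induction p rule: poly_mapping_linear_induct)
  case subspace
  then show ?case
    by (auto simp: pm.subspace_def hcomp_add hcomp_smul ring_distribs sum.distrib pm.scale_sum_right)
next
  case (single u)
  show ?case
  proof (induction q rule: poly_mapping_linear_induct)
    case subspace
    then show ?case
      by (auto simp: pm.subspace_def hcomp_add hcomp_smul ring_distribs sum.distrib pm.scale_sum_right)
  next
    case (single v)
    have "(\<Sum>i\<le>n. hcomp i (mon u) * hcomp (n - i) (mon v)) =
        (\<Sum>i\<le>n. if i = length u then mon u * hcomp (n - i) (mon v :: 'a list \<Rightarrow>\<^sub>0 complex) else 0)"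
      by (rule sum.cong) (auto simp: hcomp_single)
    then show ?case by (auto simp: hcomp_single mult_single plus_list_def)
  qed
qed

text \<open>Degree at most m times degree below n: one factor has full size, the other is an error
  term. The primed variant exchanges the roles.\<close>

lemma deg_lt_mult:
  assumes "p \<in> deg_lt (Suc m)" "q \<in> deg_lt n"
  shows "p * q \<in> deg_lt (m + n)"
  unfolding deg_lt_iff_hcomp hcomp_mult
proof (intro allI impI sum.neutral ballI)
  fix i j assume "m + n \<le> i" "j \<in> {..i}"
  then have "hcomp j p = 0 \<or> hcomp (i - j) q = 0"
    using assms unfolding deg_lt_iff_hcomp by (cases "j \<le> m") auto
  then show "hcomp j p * hcomp (i - j) q = 0" by auto
qed

lemma deg_lt_mult':
  assumes "p \<in> deg_lt m" "q \<in> deg_lt (Suc n)"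
  shows "p * q \<in> deg_lt (m + n)"
  unfolding deg_lt_iff_hcomp hcomp_mult
proof (intro allI impI sum.neutral ballI)
  fix i j assume "m + n \<le> i" "j \<in> {..i}"
  then have "hcomp j p = 0 \<or> hcomp (i - j) q = 0"
    using assms unfolding deg_lt_iff_hcomp by (cases "j < m") auto
  then show "hcomp j p * hcomp (i - j) q = 0" by auto
qed

lemma hcomp_alg_gen:
  assumes "\<And>y. y \<in> Y \<Longrightarrow> \<exists>n. hcomp n y = y"
  shows "p \<in> alg_gen Y \<Longrightarrow> hcomp n p \<in> alg_gen Y"
proof (induction p arbitrary: n rule: alg_gen.induct)
  case one then show ?case by (simp add: hcomp_one alg_gen.one alg_gen_zero)
next
  case (base y)
  then show ?case using assms[OF base] by (metis alg_gen.base alg_gen_zero hcomp_hcomp)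
next
  case (mult p q)
  then show ?case unfolding hcomp_mult
    by (intro pm.subspace_sum subalgD[OF subalg_alg_gen]) (auto intro: alg_gen.mult)
qed (auto simp: hcomp_add hcomp_smul intro: alg_gen.intros)

section \<open>The associated graded algebra of a presented algebra\<close>

text \<open>
  \<open>K\<close> consists of the leading forms of the relations: a form of degree \<open>n\<close> lies in \<open>K\<close> iff its image
  is also the image of an element of smaller degree.
\<close>

locale filtered_presentation = presentation R f A
  for R :: "('v list \<Rightarrow>\<^sub>0 complex) set" and f :: "('v list \<Rightarrow>\<^sub>0 complex) \<Rightarrow> 'a" and A :: "'a calg" (structure) +
  fixes K :: "('v list \<Rightarrow>\<^sub>0 complex) set"
  assumes hcomp_R: "p \<in> R \<Longrightarrow> hcomp n p \<in> R"
    and subspace_K: "pm.subspace K"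
    and hcomp_K: "p \<in> K \<Longrightarrow> hcomp n p \<in> K"
    and leading: "p \<in> R \<Longrightarrow> hcomp n p = p \<Longrightarrow> f p \<in> f ` (R \<inter> deg_lt n) \<longleftrightarrow> p \<in> K"
begin

definition G where "G n = f ` (R \<inter> deg_lt (Suc n))"

text \<open>Since \<open>R\<close> is already graded, it maps to the associated graded algebra
  directly: each homogeneous part goes to its own class.\<close>

definition gr_map where "gr_map p n = prev A G n +> f (hcomp n p)"

lemma prev_G: "prev A G n = f ` (R \<inter> deg_lt n)"
  using R by (cases n) (auto simp: prev_def G_def f_hom)

lemma subspace_R_deg_lt: "pm.subspace (R \<inter> deg_lt n)"
  using R(1) subspace_deg_lt by (rule pm.subspace_inter)

lemma coset_zero: "prev A G n +> f 0 = prev A G n"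
  using coset_eq_image[OF subspace_R_deg_lt[of n] _ R(2)] by (simp add: prev_G Int_def)

lemma coset_G:
  assumes "x \<in> R" "y \<in> R" "x - y \<in> deg_lt n"
  shows "prev A G n +> f x = prev A G n +> f y"
  unfolding prev_G using assms subspace_R_deg_lt by (intro coset_eqI) (auto simp: R)

lemma filtration_G: "filtration A G"
  unfolding filtration_def
proof (intro conjI allI ballI)
  show "submodule (G i) complex_ring A" for i
    unfolding G_def using subspace_R_deg_lt by (intro submodule_image) auto
  show "G i \<subseteq> G (Suc i)" for i unfolding G_def using deg_lt_mono[of "Suc i" "Suc (Suc i)"] by auto
  have "1 \<in> deg_lt (Suc 0)" by (auto simp: deg_lt_def zero_list_def)
  then show "\<one> \<in> G 0" unfolding G_def using R(3) by (auto simp: f_hom(2)[symmetric])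
  show "x \<otimes> y \<in> G (i + j)" if "x \<in> G i" "y \<in> G j" for i j x y
    using that deg_lt_mult[of _ i _ "Suc j"] unfolding G_def
    by (auto simp: f_hom(4)[symmetric] R intro!: imageI)
  show "carrier A = (\<Union>i. G i)"
  proof
    show "carrier A \<subseteq> (\<Union>i. G i)"
    proof
      fix u assume "u \<in> carrier A"
      then obtain p where p: "p \<in> R" "u = f p" by (rule carrierE)
      obtain n where "p \<in> deg_lt n" using ex_deg_lt by blast
      then have "p \<in> deg_lt (Suc n)" by (rule deg_lt_mono[rotated]) simp
      then show "u \<in> (\<Union>i. G i)" using p by (auto simp: G_def)
    qed
  qed (auto simp: G_def)
qed

lemma mem_gr_map:
  assumes "p \<in> R"
  shows "u \<in> gr_map p n \<longleftrightarrow> (\<exists>q\<in>R. u = f q \<and> q - hcomp n p \<in> deg_lt n)"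
proof -
  have "u \<in> gr_map p n \<longleftrightarrow> u \<in> f ` {w + hcomp n p | w. w \<in> R \<inter> deg_lt n}"
    unfolding gr_map_def prev_G using assms hcomp_R subspace_R_deg_lt coset_eq_image by auto
  also have "\<dots> \<longleftrightarrow> (\<exists>q\<in>R. u = f q \<and> q - hcomp n p \<in> deg_lt n)"
  proof
    assume "\<exists>q\<in>R. u = f q \<and> q - hcomp n p \<in> deg_lt n"
    then obtain q where "q \<in> R" "u = f q" "q - hcomp n p \<in> deg_lt n" by blast
    then have "u = f ((q - hcomp n p) + hcomp n p)" "q - hcomp n p \<in> R \<inter> deg_lt n"
      using assms hcomp_R R by auto
    then show "u \<in> f ` {w + hcomp n p | w. w \<in> R \<inter> deg_lt n}" by blast
  next
    assume "u \<in> f ` {w + hcomp n p | w. w \<in> R \<inter> deg_lt n}"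
    then obtain w where "w \<in> R" "w \<in> deg_lt n" "u = f (w + hcomp n p)" by blast
    then show "\<exists>q\<in>R. u = f q \<and> q - hcomp n p \<in> deg_lt n"
      using hcomp_R[OF assms] R(4) by (intro bexI[of _ "w + hcomp n p"]) simp_all
  qed
  finally show ?thesis .
qed

lemma gr_map_mult:
  assumes "p \<in> R" "q \<in> R"
  shows "gr_map (p * q) = gr_map p \<otimes>\<^bsub>gr A G\<^esub> gr_map q"
proof
  fix n
  \<comment> \<open>The product in \<open>gr\<close> is a union over all choices of representatives,
    so every choice must give the same coset.\<close>
  have eq: "prev A G n +> (\<Oplus>i\<in>{..n}. a i \<otimes> b (n - i)) = gr_map (p * q) n"
    if "\<And>i. a i \<in> gr_map p i" "\<And>i. b i \<in> gr_map q i" for a b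
  proof -
    from that(1) have "\<forall>i. \<exists>r. r \<in> R \<and> a i = f r \<and> r - hcomp i p \<in> deg_lt i"
      using assms(1) mem_gr_map by blast
    then obtain a' where a: "\<And>i. a' i \<in> R" "\<And>i. a i = f (a' i)" "\<And>i. a' i - hcomp i p \<in> deg_lt i"
      by (auto dest!: choice)
    from that(2) have "\<forall>i. \<exists>r. r \<in> R \<and> b i = f r \<and> r - hcomp i q \<in> deg_lt i"
      using assms(2) mem_gr_map by blast
    then obtain b' where b: "\<And>i. b' i \<in> R" "\<And>i. b i = f (b' i)" "\<And>i. b' i - hcomp i q \<in> deg_lt i"
      by (auto dest!: choice)
    note ab = a b
    have "(\<Oplus>i\<in>{..n}. a i \<otimes> b (n - i)) = f (\<Sum>i\<le>n. a' i * b' (n - i))"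
      using ab by (subst f_finsum) (auto simp: R f_hom intro!: A.finsum_cong)
    moreover have "(\<Sum>i\<le>n. a' i * b' (n - i)) - hcomp n (p * q) \<in> deg_lt n"
      unfolding hcomp_mult sum_subtractf[symmetric]
    proof (rule pm.subspace_sum[OF subspace_deg_lt])
      \<comment> \<open>Telescoping a b - p q = (a - p) b + p (b - q) puts one error term, of too
        small degree, into each product.\<close>
      fix i assume i: "i \<in> {..n}"
      have "b' (n - i) \<in> deg_lt (Suc (n - i))"
        using pm.subspace_add[OF subspace_deg_lt deg_lt_mono[OF le_SucI[OF order_refl] ab(6)[of "n - i"]] hcomp_deg_lt[of "n - i" q]]
        by simp
      then have "(a' i - hcomp i p) * b' (n - i) \<in> deg_lt n"
        using deg_lt_mult'[OF ab(3)[of i], of _ "n - i"] i by simp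
      moreover have "hcomp i p * (b' (n - i) - hcomp (n - i) q) \<in> deg_lt n"
        using deg_lt_mult[OF hcomp_deg_lt ab(6)[of "n - i"], of i p] i by simp
      ultimately show "a' i * b' (n - i) - hcomp i p * hcomp (n - i) q \<in> deg_lt n"
        using pm.subspace_add[OF subspace_deg_lt] by (fastforce simp: algebra_simps)
    qed
    moreover have "(\<Sum>i\<le>n. a' i * b' (n - i)) \<in> R"
      using ab R by (intro pm.subspace_sum) auto
    ultimately show ?thesis
      unfolding gr_map_def using coset_G[OF _ hcomp_R[OF R(6)[OF assms]]] by simp
  qed
  \<comment> \<open>At least one choice of representatives exists, so the union is not
    empty.\<close>
  have "f (hcomp i p) \<in> gr_map p i" "f (hcomp i q) \<in> gr_map q i" for i
    using assms hcomp_R pm.subspace_0[OF subspace_deg_lt, of i] by (auto simp: mem_gr_map intro!: bexI)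
  then have "\<exists>a b. (\<forall>i. a i \<in> gr_map p i) \<and> (\<forall>i. b i \<in> gr_map q i)"
    by (intro exI[of _ "\<lambda>i. f (hcomp i p)"] exI[of _ "\<lambda>i. f (hcomp i q)"]) simp
  then show "gr_map (p * q) n = (gr_map p \<otimes>\<^bsub>gr A G\<^esub> gr_map q) n"
    unfolding gr_def monoid.simps using eq by (auto 0 4)
qed

lemma gr_map_surj:
  assumes "x \<in> carrier (gr A G)"
  shows "\<exists>p\<in>R. x = gr_map p"
proof -
  from assms have "\<forall>i. \<exists>a\<in>G i. x i = prev A G i +> a" and fin: "finite {i. x i \<noteq> prev A G i}"
    by (auto simp: gr_def)
  then have "\<forall>i. \<exists>r. r \<in> R \<inter> deg_lt (Suc i) \<and> x i = prev A G i +> f r"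
    unfolding G_def by blast
  then obtain p where p: "\<And>i. p i \<in> R \<inter> deg_lt (Suc i)" "\<And>i. x i = prev A G i +> f (p i)"
    by (auto dest!: choice)
  \<comment> \<open>Finite support makes this a finite sum. Only the degree-i part of the i-th lift
    counts, since its lower terms vanish in the coset.\<close>
  define q where "q = (\<Sum>i\<in>{i. x i \<noteq> prev A G i}. hcomp i (p i))"
  have "x n = gr_map q n" for n
  proof (cases "x n = prev A G n")
    case True
    then have "hcomp n q = 0" unfolding q_def hcomp_sum hcomp_hcomp by (intro sum.neutral ballI) auto
    then show ?thesis using True by (simp add: gr_map_def coset_zero)
  next
    case False
    have "hcomp n q = (\<Sum>i\<in>{i. x i \<noteq> prev A G i}. if i = n then hcomp n (p n) else 0)"
      unfolding q_def hcomp_sum hcomp_hcomp by (rule sum.cong) auto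
    then have "hcomp n q = hcomp n (p n)" using False fin by (simp add: sum.delta)
    moreover have "prev A G n +> f (p n) = prev A G n +> f (hcomp n (p n))"
      using p(1)[of n] deg_lt_diff_hcomp[of "p n" n] hcomp_R by (intro coset_G) auto
    ultimately show ?thesis using p by (simp add: gr_map_def)
  qed
  moreover have "q \<in> R" unfolding q_def using p hcomp_R by (intro pm.subspace_sum R) auto
  ultimately show ?thesis by blast
qed

lemma gr_map_closed:
  assumes "p \<in> R"
  shows "gr_map p \<in> carrier (gr A G)"
proof -
  obtain m where m: "p \<in> deg_lt m" using ex_deg_lt by blast
  have "gr_map p n = prev A G n" if "n \<ge> m" for n
    using m that by (simp add: gr_map_def coset_zero deg_lt_iff_hcomp)
  then have "{n. gr_map p n \<noteq> prev A G n} \<subseteq> {..<m}" by (auto simp: not_le[symmetric])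
  then have "finite {n. gr_map p n \<noteq> prev A G n}" by (rule finite_subset) simp
  moreover have "f (hcomp n p) \<in> G n" for n
    unfolding G_def using assms hcomp_R hcomp_deg_lt by (auto intro!: imageI)
  ultimately show ?thesis unfolding gr_def gr_map_def by auto
qed

lemma presents_gr: "presents R gr_map (gr A G)"
  unfolding presents_def
proof (intro conjI ballI allI)
  show "subalg R" by (rule subalg_R)
  show "gr_map ` R = carrier (gr A G)" using gr_map_surj gr_map_closed by blast
  show "gr_map 0 = \<zero>\<^bsub>gr A G\<^esub>" unfolding gr_map_def by (simp add: coset_zero gr_def)
  show "gr_map 1 = \<one>\<^bsub>gr A G\<^esub>" unfolding gr_map_def gr_def by (rule ext) (simp add: coset_zero hcomp_one f_hom(2))
  fix p assume p: "p \<in> R"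
  show "gr_map (smul a p) = a \<odot>\<^bsub>gr A G\<^esub> gr_map p" for a
    using p hcomp_R coset_smult[OF subspace_R_deg_lt]
    by (auto simp: gr_def gr_map_def prev_G hcomp_smul)
  fix q assume q: "q \<in> R"
  show "gr_map (p * q) = gr_map p \<otimes>\<^bsub>gr A G\<^esub> gr_map q" using p q by (rule gr_map_mult)
  show "gr_map (p + q) = gr_map p \<oplus>\<^bsub>gr A G\<^esub> gr_map q"
    using p q hcomp_R coset_add[OF subspace_R_deg_lt]
    by (auto simp: gr_def gr_map_def prev_G hcomp_add)
qed

text \<open>An element dies iff each of its homogeneous parts can be represented in smaller degree,
  which by \<open>leading\<close> means that the part lies in \<open>K\<close>; as \<open>K\<close>
  is graded, the parts can be reassembled.\<close>

lemma gr_map_eq_zero: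
  assumes "p \<in> R"
  shows "gr_map p = \<zero>\<^bsub>gr A G\<^esub> \<longleftrightarrow> p \<in> K"
proof -
  have "gr_map p = \<zero>\<^bsub>gr A G\<^esub> \<longleftrightarrow> (\<forall>n. prev A G n +> f (hcomp n p) = prev A G n +> f 0)"
    by (simp add: gr_def gr_map_def coset_zero fun_eq_iff)
  also have "\<dots> \<longleftrightarrow> (\<forall>n. f (hcomp n p) \<in> f ` (R \<inter> deg_lt n))"
    unfolding prev_G using assms hcomp_R subspace_R_deg_lt R(2) by (subst coset_eq_iff) auto
  also have "\<dots> \<longleftrightarrow> (\<forall>n. hcomp n p \<in> K)"
    using leading hcomp_R[OF assms] by (simp add: hcomp_hcomp)
  also have "\<dots> \<longleftrightarrow> p \<in> K"
  proof
    assume *: "\<forall>n. hcomp n p \<in> K"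
    obtain n where n: "p \<in> deg_lt n" using ex_deg_lt by blast
    show "p \<in> K" by (subst sum_hcomp[OF n]) (use * in \<open>auto intro: pm.subspace_sum[OF subspace_K]\<close>)
  qed (auto intro: hcomp_K)
  finally show ?thesis .
qed

lemma gr_component_eq: "gr_component A G n = gr_map ` {p \<in> R. hcomp n p = p}"
proof -
  have z: "gr_map p i = prev A G i" if "hcomp i p = 0" for p i
    using that by (simp add: gr_map_def coset_zero)
  have "gr_map p i = prev A G i" if "hcomp n p = p" "i \<noteq> n" for p i
    using that hcomp_hcomp[of i n p] by (intro z) simp
  moreover have "x \<in> gr_map ` {p \<in> R. hcomp n p = p}" if "x \<in> gr_component A G n" for x
  proof -
    from that have x: "x \<in> carrier (gr A G)" "\<And>i. i \<noteq> n \<Longrightarrow> x i = prev A G i"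
      by (auto simp: gr_component_def)
    then obtain p where p: "p \<in> R" "x = gr_map p" "\<And>i. i \<noteq> n \<Longrightarrow> x i = prev A G i"
      using gr_map_surj by metis
    have "gr_map p i = gr_map (hcomp n p) i" for i
    proof (cases "i = n")
      case False
      then show ?thesis using p(2,3) z[of i "hcomp n p"] by (simp add: hcomp_hcomp)
    qed (simp add: gr_map_def hcomp_hcomp)
    then have "x = gr_map (hcomp n p)" using p by auto
    then show ?thesis using p hcomp_R by (auto simp: hcomp_hcomp)
  qed
  ultimately show ?thesis using gr_map_closed by (auto simp: gr_component_def)
qed

text \<open>Match the form of top degree by a generated one; the error then has an equivalent of
  smaller degree, and induction finishes.\<close>

lemma generators_lift:
  assumes "Y \<subseteq> R" and "\<And>y. y \<in> Y \<Longrightarrow> \<exists>n. hcomp n y = y"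
    and gen: "\<And>p. p \<in> R \<Longrightarrow> \<exists>q\<in>alg_gen Y. p - q \<in> K"
    and p: "p \<in> R"
  shows "\<exists>q\<in>alg_gen Y. f p = f q"
proof -
  have sub: "alg_gen Y \<subseteq> R" using alg_gen_minimal[OF subalg_R assms(1)] .
  have "\<exists>q\<in>alg_gen Y. f p = f q" if "p \<in> R" "p \<in> deg_lt n" for n p
    using that
  proof (induction n arbitrary: p)
    case 0
    then show ?case using alg_gen_zero by auto
  next
    case (Suc n)
    obtain q where q: "q \<in> alg_gen Y" "hcomp n p - q \<in> K" using gen hcomp_R Suc.prems by blast
    \<comment> \<open>Passing to the degree-n part keeps \<open>q\<close> generated, because the
      generators are homogeneous, and gives \<open>leading\<close> the homogeneous element it
      needs.\<close>
    define s where "s = hcomp n q"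
    have s: "s \<in> alg_gen Y" unfolding s_def using hcomp_alg_gen[OF assms(2) q(1)] .
    have "hcomp n p - s \<in> K" using hcomp_K[OF q(2), of n] by (simp add: s_def hcomp_diff hcomp_hcomp)
    then have "f (hcomp n p - s) \<in> f ` (R \<inter> deg_lt n)"
      using s sub Suc.prems hcomp_R R by (subst leading) (auto simp: hcomp_diff hcomp_hcomp s_def)
    then obtain r where r: "r \<in> R" "r \<in> deg_lt n" "f (hcomp n p - s) = f r" by auto
    define p' where "p' = (p - hcomp n p) + r"
    have "p' \<in> R" unfolding p'_def using r Suc.prems hcomp_R R by auto
    moreover have "p' \<in> deg_lt n" unfolding p'_def
      using r deg_lt_diff_hcomp[OF Suc.prems(2)] pm.subspace_add[OF subspace_deg_lt] by blast
    ultimately obtain q' where q': "q' \<in> alg_gen Y" "f p' = f q'" using Suc.IH by blast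
    have sR: "s \<in> R" "q' \<in> R" "p - hcomp n p \<in> R" "hcomp n p - s \<in> R"
      using s q' sub Suc.prems hcomp_R R by auto
    have "f p = f ((p - hcomp n p) + (hcomp n p - s) + s)" by simp
    also have "\<dots> = f ((p - hcomp n p) + r + s)"
      using sR r R by (simp only: f_hom R)
    also have "\<dots> = f (q' + s)" using q' sR \<open>p' \<in> R\<close> by (simp only: p'_def[symmetric] f_hom)
    finally show ?case using s q' alg_gen.add by blast
  qed
  moreover obtain n where "p \<in> deg_lt n" using ex_deg_lt by blast
  ultimately show ?thesis using p by blast
qed

end

section \<open>Potentials on words\<close>

text \<open>
  A function \<open>K u x y v\<close> prescribes the change \<open>D (u x y v) - D (u y x v)\<close> of an unknown function \<open>D\<close>
  under adjacent transpositions. Its compatibility with the commutation and braid relations of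
  transpositions suffices for \<open>D\<close> to exist: sort a word by removing descents and sum the changes.
\<close>

fun inversions :: "('a \<Rightarrow> nat) \<Rightarrow> 'a list \<Rightarrow> nat" where
  "inversions k [] = 0"
| "inversions k (x # w) = length (filter (\<lambda>y. k y < k x) w) + inversions k w"

lemma inversions_swap:
  "k y < k x \<Longrightarrow> inversions k (u @ x # y # v) = Suc (inversions k (u @ y # x # v))"
  by (induction u) auto

text \<open>\<open>N\<close> is the subgroup modulo which all identities are read.
  \<open>square\<close> says that disjoint transpositions may be done in either order;
  \<open>hexagon\<close> compares the two ways of reversing three adjacent letters.\<close>

locale potential =
  fixes key :: "'a \<Rightarrow> nat" and B :: "'a set" and n :: nat
    and K :: "'a list \<Rightarrow> 'a \<Rightarrow> 'a \<Rightarrow> 'a list \<Rightarrow> 'b::ab_group_add" and N :: "'b set"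
  assumes key: "inj_on key B"
    and N0: "0 \<in> N" and Nadd: "\<And>x y. x \<in> N \<Longrightarrow> y \<in> N \<Longrightarrow> x + y \<in> N" and Nneg: "\<And>x. x \<in> N \<Longrightarrow> - x \<in> N"
    and antisym: "\<And>u x y v. set (u @ x # y # v) \<subseteq> B \<Longrightarrow> length (u @ x # y # v) = n \<Longrightarrow> K u x y v + K u y x v \<in> N"
    and diag: "\<And>u x v. set (u @ x # x # v) \<subseteq> B \<Longrightarrow> length (u @ x # x # v) = n \<Longrightarrow> K u x x v \<in> N"
    and square: "\<And>u x y v z t w. set (u @ x # y # v @ z # t # w) \<subseteq> B \<Longrightarrow> length (u @ x # y # v @ z # t # w) = n \<Longrightarrow>
      K u x y (v @ z # t # w) + K (u @ y # x # v) z t w - (K (u @ x # y # v) z t w + K u x y (v @ t # z # w)) \<in> N"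
    and hexagon: "\<And>u x y z w. set (u @ x # y # z # w) \<subseteq> B \<Longrightarrow> length (u @ x # y # z # w) = n \<Longrightarrow>
      K u x y (z # w) + K (u @ [y]) x z w + K u y z (x # w)
      - (K (u @ [x]) y z w + K u x z (y # w) + K (u @ [z]) x y w) \<in> N"
begin

definition descent :: "'a list \<Rightarrow> 'a list \<times> 'a \<times> 'a \<times> 'a list \<Rightarrow> bool"
  where "descent w d \<longleftrightarrow> (case d of (u, x, y, v) \<Rightarrow> w = u @ x # y # v \<and> key y < key x)"

text \<open>Some descent, picked by choice, is removed until the word is sorted. Independence of the
  choice is proved afterwards, and only modulo \<open>N\<close>.\<close>

function D :: "'a list \<Rightarrow> 'b" where
  "D w = (if \<exists>d. descent w d then (case SOME d. descent w d of (u, x, y, v) \<Rightarrow> K u x y v + D (u @ y # x # v)) else 0)"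
  by auto
termination
proof (relation "Wellfounded.measure (inversions key)", simp)
  fix w d u p x q y v
  assume *: "\<exists>d. descent w d" "(u, p) = (SOME d. descent w d)" "(x, q) = p" "(y, v) = q"
  have "descent w (SOME d. descent w d)" using *(1) by (rule someI_ex)
  then show "(u @ y # x # v, w) \<in> Wellfounded.measure (inversions key)"
    using *(2-4)[symmetric] by (auto simp: descent_def inversions_swap)
qed

declare D.simps [simp del]

lemma D_descent:
  assumes "descent w d"
  obtains u x y v where "descent w (u, x, y, v)" "D w = K u x y v + D (u @ y # x # v)"
proof -
  obtain u x y v where s: "(SOME d. descent w d) = (u, x, y, v)" by (metis prod.exhaust)
  then have "descent w (u, x, y, v)" using assms by (metis someI_ex)
  moreover have "\<exists>d. descent w d" using assms by blast
  then have "D w = K u x y v + D (u @ y # x # v)" by (subst D.simps) (simp only: s if_True prod.case)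
  ultimately show thesis using that by blast
qed

definition eqv :: "'b \<Rightarrow> 'b \<Rightarrow> bool" (infix "\<approx>" 50) where "a \<approx> b \<longleftrightarrow> a - b \<in> N"

lemma eqv_refl: "a \<approx> a" by (simp add: eqv_def N0)
lemma eqv_sym: "a \<approx> b \<Longrightarrow> b \<approx> a" using Nneg[of "a - b"] by (simp add: eqv_def)
lemma eqv_trans [trans]: "a \<approx> b \<Longrightarrow> b \<approx> c \<Longrightarrow> a \<approx> c" using Nadd[of "a - b" "b - c"] by (simp add: eqv_def)
lemma eqv_add_left: "c \<approx> d \<Longrightarrow> a + c \<approx> a + d" by (simp add: eqv_def)
lemma eqv_add_right: "c \<approx> d \<Longrightarrow> c + a \<approx> d + a" by (simp add: eqv_def)

text \<open>Two different descents overlap in one letter or are disjoint. The two rewritings are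
  joined at a common word by \<open>hexagon\<close> or by \<open>square\<close>; all intermediate
  words have fewer inversions, so \<open>IH\<close> applies to them.\<close>

lemma confluence:
  assumes IH: "\<And>u' x' y' v'. set (u' @ x' # y' # v') \<subseteq> B \<Longrightarrow> length (u' @ x' # y' # v') = n \<Longrightarrow> key y' < key x' \<Longrightarrow>
      inversions key (u' @ x' # y' # v') < m \<Longrightarrow> D (u' @ x' # y' # v') \<approx> K u' x' y' v' + D (u' @ y' # x' # v')"
    and w: "set w \<subseteq> B" "length w = n" "inversions key w = m"
    and eq: "w = u @ x # y # v" "w = u' @ x' # y' # v'"
    and desc: "key y < key x" "key y' < key x'"
    and len: "length u < length u'"
  shows "K u x y v + D (u @ y # x # v) \<approx> K u' x' y' v' + D (u' @ y' # x' # v')"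
proof -
  from eq len obtain t where t: "u' = u @ t" "x # y # v = t @ x' # y' # v'"
    by (auto simp: append_eq_append_conv2)
  show ?thesis
  proof (cases "length t = 1")
    \<comment> \<open>The descents share a letter: x, y, z has strictly decreasing keys, and both
      sides are carried to z, y, x.\<close>
    case True
    define z where "z = y'"
    from t True have "u' = u @ [x]" "x' = y" "v = z # v'"
      by (auto simp: length_Suc_conv z_def)
    note e = this z_def[symmetric]
    have wz: "w = u @ x # y # z # v'" using eq e by simp
    have key3: "key z < key y" "key z < key x" using desc e by auto
    have "inversions key w = Suc (inversions key (u @ y # x # z # v'))"
      using wz inversions_swap[of key y x u "z # v'"] desc by simp
    moreover have "inversions key (u @ y # x # z # v') = Suc (inversions key (u @ y # z # x # v'))"
      using inversions_swap[of key z x "u @ [y]" v'] key3 by simp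
    moreover have "inversions key w = Suc (inversions key (u @ x # z # y # v'))"
      using wz inversions_swap[of key z y "u @ [x]" v'] key3 by simp
    moreover have "inversions key (u @ x # z # y # v') = Suc (inversions key (u @ z # x # y # v'))"
      using inversions_swap[of key z x u "y # v'"] key3 by simp
    ultimately have inv: "inversions key (u @ y # x # z # v') < m" "inversions key (u @ y # z # x # v') < m"
      "inversions key (u @ x # z # y # v') < m" "inversions key (u @ z # x # y # v') < m" using w by auto
    have "K u x y (z # v') + D (u @ y # x # z # v') \<approx> K u x y (z # v') + (K (u @ [y]) x z v' + D (u @ y # z # x # v'))"
      using IH[of "u @ [y]" x z v'] w wz key3 inv by (intro eqv_add_left) auto
    also have "\<dots> \<approx> K u x y (z # v') + (K (u @ [y]) x z v' + (K u y z (x # v') + D (u @ z # y # x # v')))"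
      using IH[of u y z "x # v'"] w wz key3 inv by (intro eqv_add_left) auto
    also have "\<dots> = (K u x y (z # v') + K (u @ [y]) x z v' + K u y z (x # v')) + D (u @ z # y # x # v')"
      by (simp add: add.assoc)
    also have "\<dots> \<approx> (K (u @ [x]) y z v' + K u x z (y # v') + K (u @ [z]) x y v') + D (u @ z # y # x # v')"
      using hexagon[of u x y z v'] w wz by (intro eqv_add_right) (auto simp: eqv_def)
    also have "\<dots> = K (u @ [x]) y z v' + (K u x z (y # v') + (K (u @ [z]) x y v' + D (u @ z # y # x # v')))"
      by (simp add: add.assoc)
    also have "\<dots> \<approx> K (u @ [x]) y z v' + (K u x z (y # v') + D (u @ z # x # y # v'))"
      using eqv_sym[OF IH[of "u @ [z]" x y v']] w wz desc inv by (intro eqv_add_left) auto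
    also have "\<dots> \<approx> K (u @ [x]) y z v' + D (u @ x # z # y # v')"
      using eqv_sym[OF IH[of u x z "y # v'"]] w wz key3 inv by (intro eqv_add_left) auto
    finally show ?thesis using e by simp
  next
    case False
    \<comment> \<open>\<open>t\<close> is nonempty because \<open>u\<close> is strictly shorter than
      \<open>u'\<close>, so the two pairs are disjoint.\<close>
    then have "length t > 1" using t len by (cases t) auto
    then obtain s where u': "u' = u @ x # y # s"
      using t by (auto simp: Cons_eq_append_conv)
    have v: "v = s @ x' # y' # v'" using eq u' by simp
    have wz: "w = u @ x # y # s @ x' # y' # v'" using eq v by simp
    have "inversions key w = Suc (inversions key (u @ y # x # s @ x' # y' # v'))"
      using wz inversions_swap[of key y x u "s @ x' # y' # v'"] desc by simp
    moreover have "inversions key w = Suc (inversions key (u @ x # y # s @ y' # x' # v'))"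
      using wz inversions_swap[of key y' x' "u @ x # y # s" v'] desc by simp
    ultimately have inv: "inversions key (u @ y # x # s @ x' # y' # v') < m"
      "inversions key (u @ x # y # s @ y' # x' # v') < m" using w by auto
    have "K u x y v + D (u @ y # x # v) \<approx> K u x y v + (K (u @ y # x # s) x' y' v' + D (u @ y # x # s @ y' # x' # v'))"
      using IH[of "u @ y # x # s" x' y' v'] w wz desc inv v by (intro eqv_add_left) auto
    also have "\<dots> = (K u x y v + K (u @ y # x # s) x' y' v') + D (u @ y # x # s @ y' # x' # v')"
      by (simp add: add.assoc)
    also have "\<dots> \<approx> (K u' x' y' v' + K u x y (s @ y' # x' # v')) + D (u @ y # x # s @ y' # x' # v')"
      using square[of u x y s x' y' v'] w wz v u' by (intro eqv_add_right) (auto simp: eqv_def)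
    also have "\<dots> = K u' x' y' v' + (K u x y (s @ y' # x' # v') + D (u @ y # x # s @ y' # x' # v'))"
      by (simp add: add.assoc)
    also have "\<dots> \<approx> K u' x' y' v' + D (u' @ y' # x' # v')"
      using eqv_sym[OF IH[of u x y "s @ y' # x' # v'"]] w wz desc inv u' by (intro eqv_add_left) auto
    finally show ?thesis .
  qed
qed

text \<open>\<open>D\<close> follows the descent it chose; \<open>confluence\<close> compares that
  descent with the given one, by induction on inversions.\<close>

lemma D_swap_descent:
  assumes "set (u @ x # y # v) \<subseteq> B" "length (u @ x # y # v) = n" "key y < key x"
  shows "D (u @ x # y # v) \<approx> K u x y v + D (u @ y # x # v)"
  using assms
proof (induction "inversions key (u @ x # y # v)" arbitrary: u x y v rule: less_induct)
  case less
  define w where "w = u @ x # y # v"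
  have "descent w (u, x, y, v)" using less.prems by (simp add: descent_def w_def)
  then obtain u' x' y' v' where d: "descent w (u', x', y', v')" "D w = K u' x' y' v' + D (u' @ y' # x' # v')"
    by (rule D_descent)
  then have w': "w = u' @ x' # y' # v'" "key y' < key x'" by (auto simp: descent_def)
  have IH: "D (a @ b # c # e) \<approx> K a b c e + D (a @ c # b # e)"
    if "set (a @ b # c # e) \<subseteq> B" "length (a @ b # c # e) = n" "key c < key b"
      "inversions key (a @ b # c # e) < inversions key w" for a b c e
    using less.hyps[of a b c e] that by (simp add: w_def)
  have w: "set w \<subseteq> B" "length w = n" using less.prems by (simp_all add: w_def)
  consider "length u < length u'" | "length u' < length u" | "length u = length u'" by linarith
  then show ?case
  proof cases
    case 1
    then show ?thesis
      using confluence[OF IH w refl w_def w'(1) less.prems(3) w'(2)] d eqv_sym by (simp add: w_def)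
  next
    case 2
    then show ?thesis
      using confluence[OF IH w refl w'(1) w_def w'(2) less.prems(3)] d by (simp add: w_def)
  next
    case 3
    then have "u = u'" "x = x'" "y = y'" "v = v'" using w' w_def by auto
    then show ?thesis using d eqv_refl by (simp add: w_def)
  qed
qed

text \<open>As the key is injective on \<open>B\<close>, a pair of neighbours is a descent, an
  ascent or a repetition; \<open>antisym\<close> and \<open>diag\<close> settle the last
  two.\<close>

lemma D_swap:
  assumes "set (u @ x # y # v) \<subseteq> B" "length (u @ x # y # v) = n"
  shows "D (u @ x # y # v) - D (u @ y # x # v) - K u x y v \<in> N"
proof -
  consider "key y < key x" | "key x < key y" | "x = y"
    using key assms by (auto simp: inj_on_def) (metis nat_neq_iff)
  then show ?thesis
  proof cases
    case 1
    then show ?thesis using D_swap_descent[OF assms] by (simp add: eqv_def algebra_simps)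
  next
    case 2
    have "D (u @ y # x # v) \<approx> K u y x v + D (u @ x # y # v)"
      using assms 2 by (intro D_swap_descent) auto
    then have "- (D (u @ y # x # v) - (K u y x v + D (u @ x # y # v))) - (K u x y v + K u y x v) \<in> N"
      unfolding eqv_def using Nneg Nadd antisym[OF assms] by (metis (no_types, lifting) uminus_add_conv_diff add.commute)
    then show ?thesis by (simp add: algebra_simps)
  next
    case 3
    then show ?thesis using Nneg[OF diag[of u x v]] assms by simp
  qed
qed

end

section \<open>Symplectic reflections\<close>

locale sra_data = finite_dimensional_vector_space scale Bas
  for scale :: "complex \<Rightarrow> 'v::ab_group_add \<Rightarrow> 'v" and Bas :: "'v set" +
  fixes \<omega> :: "'v \<Rightarrow> 'v \<Rightarrow> complex" and \<Gamma> :: "('v \<Rightarrow> 'v) set" and c :: "('v \<Rightarrow> 'v) \<Rightarrow> complex"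
  assumes skew: "skew_form scale \<omega>" and radical: "radical \<omega> = {0}"
    and \<Gamma>: "subgroup \<Gamma> (Sp scale \<omega>)" and fin_\<Gamma>: "finite \<Gamma>" and conj: "conj_invariant scale \<Gamma> c"
begin

abbreviation TA where "TA \<equiv> tensor_alg scale"
abbreviation SA where "SA \<equiv> skew_alg scale \<Gamma>"
abbreviation J where "J \<equiv> sra_ideal scale \<omega> \<Gamma> c"
abbreviation H where "H \<equiv> sra scale \<omega> \<Gamma> c"
abbreviation U where "U \<equiv> spherical scale \<omega> \<Gamma> c"
abbreviation UF where "UF \<equiv> spherical_filtration scale \<omega> \<Gamma> c"

lemma skew_form_swap:
  assumes "skew_form scale \<eta>"
  shows "\<eta> x y = - \<eta> y x"
  using assms unfolding skew_form_def by blast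

lemma skew_formD:
  assumes "skew_form scale \<eta>"
  shows "\<eta> (x + x') y = \<eta> x y + \<eta> x' y" "\<eta> x (y + y') = \<eta> x y + \<eta> x y'"
    "\<eta> (scale a x) y = a * \<eta> x y" "\<eta> x (scale a y) = a * \<eta> x y"
    "\<eta> 0 y = 0" "\<eta> x 0 = 0" "\<eta> (x - x') y = \<eta> x y - \<eta> x' y" "\<eta> x (y - y') = \<eta> x y - \<eta> x y'"
    "\<eta> x x = 0"
proof -
  have "bilinear_form scale \<eta>" using assms unfolding skew_form_def by (rule conjunct1)
  then have "Vector_Spaces.linear scale (*) (\<lambda>y. \<eta> x y)" "Vector_Spaces.linear scale (*) (\<lambda>x. \<eta> x y)" for x y
    unfolding bilinear_form_def by blast+
  note l = this[THEN Vector_Spaces.linear.axioms(3)]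
  show "\<eta> (x + x') y = \<eta> x y + \<eta> x' y" by (rule module_hom.add[OF l(2)])
  show "\<eta> x (y + y') = \<eta> x y + \<eta> x y'" by (rule module_hom.add[OF l(1)])
  show "\<eta> (scale a x) y = a * \<eta> x y" by (rule module_hom.scale[OF l(2)])
  show "\<eta> x (scale a y) = a * \<eta> x y" by (rule module_hom.scale[OF l(1)])
  show "\<eta> 0 y = 0" by (rule module_hom.zero[OF l(2)])
  show "\<eta> x 0 = 0" by (rule module_hom.zero[OF l(1)])
  show "\<eta> (x - x') y = \<eta> x y - \<eta> x' y" by (rule module_hom.diff[OF l(2)])
  show "\<eta> x (y - y') = \<eta> x y - \<eta> x y'" by (rule module_hom.diff[OF l(1)])
  show "\<eta> x x = 0" using skew_form_swap[OF assms, of x x] by simp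
qed

lemma skew_formI:
  assumes "\<And>x x' y. \<eta> (x + x') y = \<eta> x y + \<eta> x' y" "\<And>a x y. \<eta> (scale a x) y = a * \<eta> x y" "\<And>x y. \<eta> x y = - \<eta> y x"
  shows "skew_form scale \<eta>"
proof -
  have "vector_space ((*) :: complex \<Rightarrow> complex \<Rightarrow> complex)"
    by unfold_locales (simp_all add: algebra_simps)
  then have 1: "Vector_Spaces.linear scale (*) (\<lambda>x. h x)"
    if "\<And>x x'. h (x + x') = h x + h x'" "\<And>a x. h (scale a x) = a * h x" for h
    using that vector_space_axioms
    by (simp add: Vector_Spaces.linear_def module_hom_def module_hom_axioms_def module_iff_vector_space)
  have "\<eta> x (y + y') = \<eta> x y + \<eta> x y'" "\<eta> x (scale a y) = a * \<eta> x y" for x y y' a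
    using assms(1)[of y y' x] assms(2)[of a y x] assms(3)[of x] by simp_all
  then have "Vector_Spaces.linear scale (*) (\<lambda>y. \<eta> x y)" "Vector_Spaces.linear scale (*) (\<lambda>x. \<eta> x y)" for x y
    using 1[of "\<lambda>y. \<eta> x y"] 1[of "\<lambda>x. \<eta> x y"] assms(1,2) by blast+
  then show ?thesis using assms(3) unfolding skew_form_def bilinear_form_def by blast
qed

lemmas \<omega> = skew_formD[OF skew] and \<omega>_swap = skew_form_swap[OF skew]

lemma \<Gamma>D:
  assumes "g \<in> \<Gamma>"
  shows "g (x + y) = g x + g y" "g (scale a x) = scale a (g x)" "g 0 = 0" "g (x - y) = g x - g y"
    "bij g" "\<omega> (g x) (g y) = \<omega> x y" "Vector_Spaces.linear scale scale g"
proof -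
  have "g \<in> carrier (Sp scale \<omega>)" using assms subgroup.subset[OF \<Gamma>] by blast
  then show "Vector_Spaces.linear scale scale g" and "bij g" "\<omega> (g x) (g y) = \<omega> x y"
    by (auto simp: Sp_def)
  then have l: "module_hom scale scale g" by (simp add: Vector_Spaces.linear_def)
  show "g (x + y) = g x + g y" "g (scale a x) = scale a (g x)" "g 0 = 0" "g (x - y) = g x - g y"
    using module_hom.add[OF l] module_hom.scale[OF l] module_hom.zero[OF l] module_hom.diff[OF l] by auto
qed

lemma \<Gamma>_id [simp, intro]: "id \<in> \<Gamma>"
  using subgroup.one_closed[OF \<Gamma>] by (simp add: Sp_def)

lemma \<Gamma>_comp [intro]: "g \<in> \<Gamma> \<Longrightarrow> h \<in> \<Gamma> \<Longrightarrow> g \<circ> h \<in> \<Gamma>"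
  using subgroup.m_closed[OF \<Gamma>, of g h] by (simp add: Sp_def)

lemma \<Gamma>_funpow: "g \<in> \<Gamma> \<Longrightarrow> g ^^ n \<in> \<Gamma>"
  by (induction n) (auto simp: id_def[symmetric])

lemma finite_order:
  assumes "g \<in> \<Gamma>"
  obtains m where "m > 0" "g ^^ m = id"
proof -
  have "\<not> inj (\<lambda>n::nat. g ^^ n)"
    using finite_imageD[of "\<lambda>n::nat. g ^^ n" UNIV] finite_subset[OF _ fin_\<Gamma>, of "range (\<lambda>n::nat. g ^^ n)"] \<Gamma>_funpow[OF assms]
    by auto
  then obtain i j where ij: "g ^^ i = g ^^ j" "i \<noteq> j" by (auto simp: inj_def)
  have *: "\<exists>m>0. g ^^ m = id" if "g ^^ i = g ^^ j" "i < j" for i j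
  proof -
    have "(g ^^ i) \<circ> (g ^^ (j - i)) = g ^^ i"
      using that by (metis funpow_add le_add_diff_inverse less_imp_le)
    moreover have "inj (g ^^ i)" using \<Gamma>D(5)[OF \<Gamma>_funpow[OF assms]] by (simp add: bij_is_inj)
    ultimately have "g ^^ (j - i) = id" by (auto simp: fun_eq_iff dest: injD)
    then show ?thesis using that by (intro exI[of _ "j - i"]) simp
  qed
  show thesis using *[OF ij(1)] *[OF ij(1)[symmetric]] ij(2) that by (metis nat_neq_iff)
qed

text \<open>The inverse map is a power of g, so closure under composition suffices and no inverse
  inside \<open>Sp\<close> has to be computed.\<close>

lemma \<Gamma>_inv [intro]: "g \<in> \<Gamma> \<Longrightarrow> inv_into UNIV g \<in> \<Gamma>"
proof -
  assume g: "g \<in> \<Gamma>"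
  obtain m where m: "m > 0" "g ^^ m = id" using finite_order[OF g] .
  then have "g (( g ^^ (m - 1)) x) = x" for x by (metis Suc_diff_1 comp_apply funpow.simps(2) id_apply)
  then have "inv_into UNIV g = g ^^ (m - 1)"
    using \<Gamma>D(5)[OF g] by (metis bij_is_inj ext inv_f_f)
  then show ?thesis using \<Gamma>_funpow[OF g] by simp
qed

lemma inv_comp: "g \<in> \<Gamma> \<Longrightarrow> inv_into UNIV g \<circ> g = id" "g \<in> \<Gamma> \<Longrightarrow> g \<circ> inv_into UNIV g = id"
  using \<Gamma>D(5)[of g] by (auto simp: fun_eq_iff bij_is_inj bij_is_surj surj_f_inv_f)

lemma inv_apply [simp]: "g \<in> \<Gamma> \<Longrightarrow> inv_into UNIV g (g x) = x" "g \<in> \<Gamma> \<Longrightarrow> g (inv_into UNIV g x) = x"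
  using inv_comp[of g] by (auto simp: fun_eq_iff)

abbreviation im where "im s \<equiv> range (\<lambda>v. v - s v)"
abbreviation refls where "refls \<equiv> sympl_reflections scale \<Gamma>"

lemma reflsD: "s \<in> refls \<Longrightarrow> s \<in> \<Gamma>" by (simp add: sympl_reflections_def)

lemma finite_refls: "finite refls"
  using fin_\<Gamma> by (simp add: sympl_reflections_def)

lemma subspace_im: "s \<in> \<Gamma> \<Longrightarrow> subspace (im s)"
  unfolding subspace_def
proof (intro conjI ballI allI)
  assume s: "s \<in> \<Gamma>"
  show "0 \<in> im s" using \<Gamma>D(3)[OF s] by (intro image_eqI[of _ _ 0]) auto
  show "x + y \<in> im s" if "x \<in> im s" "y \<in> im s" for x y
  proof -
    from that obtain u v where "x = u - s u" "y = v - s v" by auto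
    then have "x + y = (u + v) - s (u + v)" using \<Gamma>D[OF s] by simp
    then show ?thesis by blast
  qed
  show "scale a x \<in> im s" if "x \<in> im s" for a x
  proof -
    from that obtain u where "x = u - s u" by auto
    then have "scale a x = scale a u - s (scale a u)" using \<Gamma>D[OF s] by (simp add: scale_right_diff_distrib)
    then show ?thesis by blast
  qed
qed

text \<open>
  Averaging over the powers of \<open>s\<close> splits \<open>V\<close> into the kernel and the image of \<open>1 - s\<close>.
\<close>

definition is_projection where "is_projection s q \<longleftrightarrow> (\<forall>x y. q (x + y) = q x + q y) \<and>
  (\<forall>a x. q (scale a x) = scale a (q x)) \<and> (\<forall>v. q v \<in> im s \<and> s (v - q v) = v - q v) \<and>
  (\<forall>v\<in>im s. q v = v) \<and> (\<forall>v. s v = v \<longrightarrow> q v = 0)"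

lemma projection_exists:
  assumes "s \<in> \<Gamma>"
  obtains q where "is_projection s q"
proof -
  obtain m where m: "m > 0" "s ^^ m = id" using finite_order[OF assms] .
  define p where "p v = scale (1 / of_nat m) (\<Sum>i<m. (s ^^ i) v)" for v
  have lin: "(s ^^ i) (x + y) = (s ^^ i) x + (s ^^ i) y" "(s ^^ i) (scale a x) = scale a ((s ^^ i) x)"
    "(s ^^ i) (x - y) = (s ^^ i) x - (s ^^ i) y" for i x y a
    using \<Gamma>D[OF \<Gamma>_funpow[OF assms]] by auto
  have p_lin: "p (x + y) = p x + p y" "p (scale a x) = scale a (p x)" for x y a
    by (simp_all add: p_def lin sum.distrib scale_right_distrib scale_sum_right mult.commute)
  have s_sum: "s (\<Sum>i\<in>I. h i) = (\<Sum>i\<in>I. s (h i))" for I :: "nat set" and h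
    by (induction I rule: infinite_finite_induct) (auto simp: \<Gamma>D[OF assms])
  have shift: "(\<Sum>i<m. (s ^^ i) (s v)) = (\<Sum>i<m. (s ^^ i) v)" for v
  proof -
    have "(\<Sum>i<m. (s ^^ i) (s v)) = (\<Sum>i<m. (s ^^ Suc i) v)" by (simp add: funpow_swap1)
    also have "\<dots> = (\<Sum>i<m. (s ^^ i) v) + (s ^^ m) v - (s ^^ 0) v"
      using sum.lessThan_Suc_shift[of "\<lambda>i. (s ^^ i) v" m] by (simp add: algebra_simps)
    finally show ?thesis using m by simp
  qed
  have ps: "p (s v) = p v" for v by (simp add: p_def shift)
  have sp: "s (p v) = p v" for v
    using shift[of v] by (simp add: p_def \<Gamma>D[OF assms] s_sum funpow_swap1)
  have pfix: "p v = v" if "s v = v" for v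
  proof -
    have "(s ^^ i) v = v" for i by (induction i) (auto simp: that)
    then show ?thesis using m by (simp add: p_def sum_constant_scale)
  qed
  \<comment> \<open>Telescopes into terms w - s w, where w runs through the images of v under powers
    of s.\<close>
  have *: "v - (s ^^ i) v \<in> im s" for i v
  proof (induction i)
    case 0 then show ?case using subspace_0[OF subspace_im[OF assms]] by simp
  next
    case (Suc i)
    have "v - (s ^^ Suc i) v = (v - (s ^^ i) v) + ((s ^^ i) v - s ((s ^^ i) v))" by simp
    then show ?case using Suc subspace_add[OF subspace_im[OF assms]] by (metis rangeI)
  qed
  have "v - p v = scale (1 / of_nat m) (\<Sum>i<m. v - (s ^^ i) v)" for v
    using m by (simp add: p_def sum_subtractf scale_right_diff_distrib sum_constant_scale)
  then have im: "v - p v \<in> im s" for v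
    using * subspace_im[OF assms] by (simp add: subspace_scale subspace_sum)
  show thesis
  proof (rule that[of "\<lambda>v. v - p v"])
    have "v - p v = v" if "v \<in> im s" for v
    proof -
      from that obtain u where u: "v = u - s u" by auto
      have "p u = p (v + s u)" using u by simp
      then show ?thesis using ps p_lin(1) by simp
    qed
    then show "is_projection s (\<lambda>v. v - p v)"
      unfolding is_projection_def using im sp pfix by (simp add: p_lin scale_right_diff_distrib)
  qed
qed

definition is_reflection_form where "is_reflection_form s \<eta> \<longleftrightarrow> skew_form scale \<eta> \<and>
    (\<forall>x\<in>im s. \<forall>y\<in>im s. \<eta> x y = \<omega> x y) \<and> radical \<eta> = {v. v - s v = 0}"

text \<open>Image of 1 - s and fixed space of s are \<omega>-orthogonal and span V, which forces the
  form to be \<omega> composed with the projection. Nondegeneracy of \<omega> makes its radical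
  exactly the fixed space.\<close>

lemma reflection_form_via_projection:
  assumes s: "s \<in> \<Gamma>" and "is_projection s q"
  shows "is_reflection_form s (\<lambda>x y. \<omega> (q x) (q y))"
    and "is_reflection_form s \<eta> \<Longrightarrow> \<eta> x y = \<omega> (q x) (q y)"
proof -
  have ql: "q (x + y) = q x + q y" "q (scale a x) = scale a (q x)" and q: "q v \<in> im s" "s (v - q v) = v - q v"
    "v \<in> im s \<Longrightarrow> q v = v" "s v = v \<Longrightarrow> q v = 0" for x y a v
    using assms(2) by (auto simp: is_projection_def)
  \<comment> \<open>For fixed k, invariance gives \<omega> (s v) k = \<omega> (s v) (s k) = \<omega>
    v k.\<close>
  have orth: "\<omega> (v - s v) k = 0" if "s k = k" for v k
    using \<Gamma>D(6)[OF s, of v k] that by (simp add: \<omega>)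
  show "is_reflection_form s (\<lambda>x y. \<omega> (q x) (q y))"
    unfolding is_reflection_form_def
  proof (intro conjI ballI)
    show "skew_form scale (\<lambda>x y. \<omega> (q x) (q y))"
      by (rule skew_formI) (simp_all only: ql \<omega>(1,3), rule \<omega>_swap)
    show "\<omega> (q x) (q y) = \<omega> x y" if "x \<in> im s" "y \<in> im s" for x y using that q(3) by simp
    show "radical (\<lambda>x y. \<omega> (q x) (q y)) = {v. v - s v = 0}"
    proof (rule equalityI; rule subsetI)
      fix v assume "v \<in> radical (\<lambda>x y. \<omega> (q x) (q y))"
      then have *: "\<omega> (q v) (q y) = 0" for y by (simp add: radical_def)
      have "\<omega> (q v) y = 0" for y
      proof -
        obtain u where "q v = u - s u" using q(1)[of v] by auto
        then have "\<omega> (q v) (y - q y) = 0" using orth[of "y - q y"] q(2) by simp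
        then show ?thesis using * by (simp add: \<omega>)
      qed
      then have "q v \<in> radical \<omega>" by (simp add: radical_def)
      then show "v \<in> {v. v - s v = 0}" using q(2)[of v] radical by simp
    next
      fix v assume "v \<in> {v. v - s v = 0}"
      then show "v \<in> radical (\<lambda>x y. \<omega> (q x) (q y))" using q(4)[of v] by (simp add: radical_def \<omega>)
    qed
  qed
  assume \<eta>: "is_reflection_form s \<eta>"
  then have sk: "skew_form scale \<eta>" by (simp add: is_reflection_form_def)
  have ker: "\<eta> (v - q v) y = 0" for v y
  proof -
    have "v - q v \<in> radical \<eta>" using \<eta> q(2)[of v] by (simp add: is_reflection_form_def)
    then show ?thesis by (simp add: radical_def)
  qed
  have "\<eta> x y = \<eta> (q x) y" using ker[of x y] by (simp add: skew_formD[OF sk])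
  also have "\<dots> = \<eta> (q x) (q y)" using ker[of y "q x"] skew_form_swap[OF sk, of "q x"] by (simp add: skew_formD(7)[OF sk])
  also have "\<dots> = \<omega> (q x) (q y)" using \<eta> q(1) unfolding is_reflection_form_def by blast
  finally show "\<eta> x y = \<omega> (q x) (q y)" .
qed

lemma reflection_form_unique:
  assumes "s \<in> \<Gamma>"
  shows "\<exists>!\<eta>. is_reflection_form s \<eta>"
proof -
  obtain q where q: "is_projection s q" using projection_exists[OF assms] .
  show ?thesis
  proof (rule ex1I)
    show "is_reflection_form s (\<lambda>x y. \<omega> (q x) (q y))"
      by (rule reflection_form_via_projection(1)[OF assms q])
    show "\<eta> = (\<lambda>x y. \<omega> (q x) (q y))" if "is_reflection_form s \<eta>" for \<eta>
      by (intro ext reflection_form_via_projection(2)[OF assms q that])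
  qed
qed

abbreviation rf where "rf \<equiv> reflection_form scale \<omega>"

lemma is_reflection_form_rf: "s \<in> \<Gamma> \<Longrightarrow> is_reflection_form s (rf s)"
proof -
  assume s: "s \<in> \<Gamma>"
  have "rf s = (THE \<eta>. is_reflection_form s \<eta>)"
    unfolding reflection_form_def is_reflection_form_def ..
  then show ?thesis using theI'[OF reflection_form_unique[OF s]] by simp
qed

lemma rf_eqI: "s \<in> \<Gamma> \<Longrightarrow> is_reflection_form s \<eta> \<Longrightarrow> rf s = \<eta>"
  using reflection_form_unique is_reflection_form_rf by blast

lemma rf_skew: "s \<in> \<Gamma> \<Longrightarrow> skew_form scale (rf s)"
  using is_reflection_form_rf by (simp add: is_reflection_form_def)

section \<open>Reflections and their forms under conjugation\<close>

definition cj where "cj g s = g \<circ> s \<circ> inv_into UNIV g"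

lemma cj_\<Gamma>: "g \<in> \<Gamma> \<Longrightarrow> s \<in> \<Gamma> \<Longrightarrow> cj g s \<in> \<Gamma>"
  unfolding cj_def by blast

lemma im_cj: "g \<in> \<Gamma> \<Longrightarrow> im (cj g s) = g ` im s"
proof -
  assume g: "g \<in> \<Gamma>"
  have "v - cj g s v = g (inv_into UNIV g v - s (inv_into UNIV g v))" for v
    using g by (simp add: cj_def \<Gamma>D[OF g])
  moreover have "g (v - s v) = g v - cj g s (g v)" for v
    using g by (simp add: cj_def \<Gamma>D[OF g])
  ultimately show ?thesis by (auto simp: image_iff) metis+
qed

lemma cj_refls: "g \<in> \<Gamma> \<Longrightarrow> s \<in> refls \<Longrightarrow> cj g s \<in> refls"
proof -
  assume g: "g \<in> \<Gamma>" and s: "s \<in> refls"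
  interpret vp: finite_dimensional_vector_space_pair_1 scale Bas scale ..
  have "dim (g ` im s) = dim (im s)"
    using \<Gamma>D(7,5)[OF g] by (intro vp.dim_image_eq) (auto intro: inj_on_subset[OF bij_is_inj])
  then show ?thesis using s cj_\<Gamma>[OF g] im_cj[OF g] by (simp add: sympl_reflections_def)
qed

lemma bij_cj: "g \<in> \<Gamma> \<Longrightarrow> bij_betw (cj g) refls refls"
proof (rule bij_betw_byWitness[where f' = "cj (inv_into UNIV g)"])
  assume g: "g \<in> \<Gamma>"
  show "\<forall>s\<in>refls. cj (inv_into UNIV g) (cj g s) = s" "\<forall>s\<in>refls. cj g (cj (inv_into UNIV g) s) = s"
    using g \<Gamma>D(5)[OF g] by (auto simp: cj_def fun_eq_iff inv_inv_eq)
qed (auto intro: cj_refls)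

text \<open>The form of s transported by g has the properties that characterize the form of the
  conjugate, so uniqueness identifies the two.\<close>

lemma rf_cj:
  assumes g: "g \<in> \<Gamma>" and s: "s \<in> \<Gamma>"
  shows "rf (cj g s) (g x) (g y) = rf s x y"
proof -
  let ?i = "inv_into UNIV g"
  note i = \<Gamma>D[OF \<Gamma>_inv[OF g]]
  note rf = is_reflection_form_rf[OF s, unfolded is_reflection_form_def]
  have sk: "skew_form scale (rf s)" using rf by blast
  have "is_reflection_form (cj g s) (\<lambda>x y. rf s (?i x) (?i y))"
    unfolding is_reflection_form_def
  proof (intro conjI ballI)
    show "skew_form scale (\<lambda>x y. rf s (?i x) (?i y))"
      by (rule skew_formI) (simp_all only: i(1,2) skew_formD(1,3)[OF sk], rule skew_form_swap[OF sk])
    show "rf s (?i x) (?i y) = \<omega> x y" if "x \<in> im (cj g s)" "y \<in> im (cj g s)" for x y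
    proof -
      from that obtain u v where "x = g u" "u \<in> im s" "y = g v" "v \<in> im s" unfolding im_cj[OF g] by blast
      then show ?thesis using rf g by (auto simp: \<Gamma>D[OF g])
    qed
    have "rf s (?i v) y = rf s (?i v) (?i (g y))" for v y using g by simp
    then have "v \<in> radical (\<lambda>x y. rf s (?i x) (?i y)) \<longleftrightarrow> ?i v \<in> radical (rf s)" for v
      unfolding radical_def by (auto, metis)
    moreover have "?i v \<in> radical (rf s) \<longleftrightarrow> ?i v - s (?i v) = 0" for v using rf by auto
    moreover have "?i v - s (?i v) = 0 \<longleftrightarrow> v - cj g s v = 0" for v
      using g bij_is_inj[OF \<Gamma>D(5)[OF g]] by (auto simp: cj_def) (metis inv_apply)
    ultimately show "radical (\<lambda>x y. rf s (?i x) (?i y)) = {v. v - cj g s v = 0}" by blast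
  qed
  from rf_eqI[OF cj_\<Gamma>[OF g s] this] show ?thesis using g by simp
qed

text \<open>Both \<open>rf s\<close> and s - 1 factor through the projection onto the plane im (1 -
  s). The cyclic sum is thus alternating in three vectors of a plane, hence zero; rank 2 is
  essential here.\<close>

lemma rf_three_term:
  assumes "s \<in> refls"
  shows "scale (rf s x y) (s z - z) + scale (rf s y z) (s x - x) + scale (rf s z x) (s y - y) = 0"
proof -
  have s: "s \<in> \<Gamma>" "dim (im s) = 2" using assms by (auto simp: sympl_reflections_def)
  obtain q where q: "is_projection s q" using projection_exists[OF s(1)] .
  have rf: "rf s u v = \<omega> (q u) (q v)" for u v
    using reflection_form_via_projection(2)[OF s(1) q is_reflection_form_rf[OF s(1)]] .
  have sv: "s v - v = s (q v) - q v" for v using q by (simp add: is_projection_def \<Gamma>D[OF s(1)] algebra_simps)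
  obtain E where E: "E \<subseteq> im s" "independent E" "im s \<subseteq> span E" "card E = 2"
    using basis_exists[of "im s"] s(2) by metis
  then obtain e f where ef: "E = {e, f}" by (meson card_2_iff)
  have "\<exists>k l. q v = scale k e + scale l f" for v
  proof -
    have "q v \<in> span {e, f}" using q E ef by (auto simp: is_projection_def)
    then obtain k where "q v - scale k e \<in> span {f}" by (auto simp: span_breakdown_eq)
    then obtain l where "q v - scale k e = scale l f" by (auto simp: span_singleton)
    then show ?thesis by (metis diff_eq_eq add.commute)
  qed
  then obtain k l where kl: "\<And>v. q v = scale (k v) e + scale (l v) f" by metis
  have om: "\<omega> (q u) (q v) = (k u * l v - l u * k v) * \<omega> e f" for u v
    unfolding kl using \<omega>_swap[of f e] by (simp add: \<omega> algebra_simps)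
  define P Q where "P = s e - e" and "Q = s f - f"
  have "s (q v) - q v = scale (k v) P + scale (l v) Q" for v
    by (simp add: kl P_def Q_def \<Gamma>D[OF s(1)] scale_right_diff_distrib algebra_simps)
  then have D: "s v - v = scale (k v) P + scale (l v) Q" for v using sv by simp
  \<comment> \<open>Collects the coordinates along P and Q. Each resulting scalar is, up to the
    factor \<omega> e f, a 3 by 3 determinant with a repeated row.\<close>
  have "scale a (scale a1 P + scale a2 Q) + scale b (scale b1 P + scale b2 Q) + scale d (scale d1 P + scale d2 Q)
      = scale (a * a1 + b * b1 + d * d1) P + scale (a * a2 + b * b2 + d * d2) Q" for a b d a1 a2 b1 b2 d1 d2
    by (simp add: scale_right_distrib scale_left_distrib algebra_simps)
  then show ?thesis
    by (simp add: rf om D algebra_simps)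
qed

end

section \<open>The Poincare--Birkhoff--Witt property\<close>

text \<open>
  \<open>SW u g\<close> stands for the word \<open>u\<close> followed by the map \<open>g\<close>; all maps on \<open>V\<close> together with the words
  form a semidirect product monoid, whose monoid algebra contains the free algebra on the set \<open>V\<close>
  smashed with \<open>\<Gamma>\<close>.
\<close>

datatype 'v sw = SW (sw_word: "'v list") (sw_map: "'v \<Rightarrow> 'v")

instantiation sw :: (type) monoid_add
begin

definition zero_sw :: "'a sw" where "zero_sw = SW [] id"

definition plus_sw :: "'a sw \<Rightarrow> 'a sw \<Rightarrow> 'a sw"
  where "plus_sw a b = SW (sw_word a @ map (sw_map a) (sw_word b)) (sw_map a \<circ> sw_map b)"

instance by standard (simp_all add: zero_sw_def plus_sw_def comp_assoc)

end

definition wd :: "'v list \<Rightarrow> ('v \<Rightarrow> 'v) \<Rightarrow> ('v sw \<Rightarrow>\<^sub>0 complex)"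
  where "wd u g = mon (SW u g)"

lemma wd_mult [simp]: "wd u g * wd w h = wd (u @ map g w) (g \<circ> h)"
  by (simp add: wd_def mult_single plus_sw_def)

lemma wd_mult_assoc [simp]: "x * wd u g * wd w h = x * wd (u @ map g w) (g \<circ> h)"
  by (simp add: mult.assoc)

lemma wd_Nil_id [simp]: "wd [] id = 1"
  by (simp add: wd_def zero_sw_def[symmetric])

text \<open>With monomial multipliers, statements about an ideal reduce to a single relation placed
  between two words, where degrees can be read off.\<close>

lemma ideal_span_singles:
  assumes "R = {x. keys x \<subseteq> M}"
  shows "ideal_span R X = pm.span {mon k * x * mon l | k x l. k \<in> M \<and> x \<in> X \<and> l \<in> M}"
    (is "_ = pm.span ?G")
proof
  have R: "R = pm.span (mon ` M)" using assms by (simp add: span_singles)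
  show "ideal_span R X \<subseteq> pm.span ?G"
  proof (rule ideal_span_minimal)
    fix a x b assume a: "a \<in> R" and x: "x \<in> X" and b: "b \<in> R"
    have 1: "mon k * x * b \<in> pm.span ?G" if "k \<in> M" for k
      using b unfolding R
    proof (induction rule: pm.span_induct)
      case (step l) then show ?case using x that by (auto intro!: pm.span_base)
    qed (rule subspace_mult_left, simp)
    show "a * x * b \<in> pm.span ?G"
      using a unfolding R
    proof (induction rule: pm.span_induct)
      case (step l)
      then show ?case using 1 by auto
    next
      show "pm.subspace {a. a * x * b \<in> pm.span ?G}"
        unfolding mult.assoc by (rule subspace_mult_right) simp
    qed
  qed simp
  have "mon k \<in> R" if "k \<in> M" for k
    using that by (simp add: assms)
  then show "pm.span ?G \<subseteq> ideal_span R X"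
    unfolding ideal_span_def by (intro pm.span_mono) blast
qed

context sra_data
begin

text \<open>The commutator that the defining relation of H prescribes for x and y, as an element of
  the group algebra.\<close>

definition kap :: "'v \<Rightarrow> 'v \<Rightarrow> ('v sw \<Rightarrow>\<^sub>0 complex)"
  where "kap x y = smul (\<omega> x y) 1 + (\<Sum>s\<in>refls. smul (c s * rf s x y) (wd [] s))"

lemma rf: "s \<in> refls \<Longrightarrow> rf s (x + x') y = rf s x y + rf s x' y" "s \<in> refls \<Longrightarrow> rf s x (y + y') = rf s x y + rf s x y'"
    "s \<in> refls \<Longrightarrow> rf s (scale a x) y = a * rf s x y" "s \<in> refls \<Longrightarrow> rf s x (scale a y) = a * rf s x y"
    "s \<in> refls \<Longrightarrow> rf s x x = 0"
  using skew_formD(1-4,9)[OF rf_skew] reflsD by auto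

lemma kap_add_left: "kap (x + x') y = kap x y + kap x' y"
  and kap_add_right: "kap x (y + y') = kap x y + kap x y'"
  and kap_scale_left: "kap (scale a x) y = smul a (kap x y)"
  and kap_scale_right: "kap x (scale a y) = smul a (kap x y)"
  and kap_diag: "kap x x = 0"
  by (simp_all add: kap_def rf \<omega> ring_distribs pm.scale_left_distrib sum.distrib pm.scale_right_distrib
      pm.scale_sum_right mult.left_commute cong: sum.cong)

lemma kap_swap: "kap x y + kap y x = 0"
proof -
  have "kap x x + kap y x + (kap x y + kap y y) = 0"
    using kap_diag[of "x + y"] by (simp only: kap_add_left kap_add_right)
  then show ?thesis by (simp add: kap_diag add.commute)
qed

text \<open>Invariance of c and of the forms allows the sum to be reindexed by conjugation with g.
  It lets group elements pass through the relations.\<close>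

lemma kap_equivariant:
  assumes g: "g \<in> \<Gamma>"
  shows "wd u g * kap x y = wd u id * kap (g x) (g y) * wd [] g"
proof -
  have "(\<Sum>s\<in>refls. smul (c s * rf s (g x) (g y)) (wd u (s \<circ> g)))
      = (\<Sum>s\<in>refls. smul (c (cj g s) * rf (cj g s) (g x) (g y)) (wd u (cj g s \<circ> g)))"
    by (rule sum.reindex_bij_betw[symmetric, OF bij_cj[OF g]])
  also have "\<dots> = (\<Sum>s\<in>refls. smul (c s * rf s x y) (wd u (g \<circ> s)))"
  proof (rule sum.cong)
    fix s assume s: "s \<in> refls"
    have "c (cj g s) = c s" using conj g s by (simp add: conj_invariant_def cj_def)
    moreover have "cj g s \<circ> g = g \<circ> s" using inv_comp(1)[OF g] by (simp add: cj_def comp_assoc)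
    ultimately show "smul (c (cj g s) * rf (cj g s) (g x) (g y)) (wd u (cj g s \<circ> g)) = smul (c s * rf s x y) (wd u (g \<circ> s))"
      using rf_cj[OF g reflsD[OF s]] by simp
  qed simp
  finally show ?thesis
    by (simp add: kap_def ring_distribs sum_distrib_left sum_distrib_right \<Gamma>D(6)[OF g])
qed

text \<open>The \<omega> part is scalar and cancels; a reflection s moved past the letter z turns it
  into s z.\<close>

lemma kap_commutator:
  "kap x y * wd [z] id - wd [z] id * kap x y = (\<Sum>s\<in>refls. smul (c s * rf s x y) ((wd [s z] id - wd [z] id) * wd [] s))"
  by (simp add: kap_def ring_distribs sum_distrib_left sum_distrib_right sum_subtractf[symmetric] pm.scale_right_diff_distrib left_diff_distrib)

definition QG :: "('v sw \<Rightarrow>\<^sub>0 complex) set"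
  where "QG = {x. keys x \<subseteq> {SW u g | u g. g \<in> \<Gamma>}}"

text \<open>The bound is strict, as in \<open>deg_lt\<close>: it is \<open>FQ (Suc n)\<close> that
  lifts the n-th filtration step of H.\<close>

definition FQ :: "nat \<Rightarrow> ('v sw \<Rightarrow>\<^sub>0 complex) set"
  where "FQ n = {x. keys x \<subseteq> {SW u g | u g. g \<in> \<Gamma> \<and> length u < n}}"

lemma FQ_span: "FQ n = pm.span {wd u g | u g. g \<in> \<Gamma> \<and> length u < n}"
  unfolding FQ_def span_singles[symmetric] wd_def by (rule arg_cong[where f = pm.span]) auto

lemma QG_span: "QG = pm.span {wd u g | u g. g \<in> \<Gamma>}"
  unfolding QG_def span_singles[symmetric] wd_def by (rule arg_cong[where f = pm.span]) auto

lemma subspace_FQ [simp, intro]: "pm.subspace (FQ n)" unfolding FQ_span by simp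
lemma subspace_QG [simp, intro]: "pm.subspace QG" unfolding QG_span by simp

lemma wd_FQ [intro]: "g \<in> \<Gamma> \<Longrightarrow> length u < n \<Longrightarrow> wd u g \<in> FQ n"
  unfolding FQ_span by (rule pm.span_base) auto

lemma wd_QG [intro]: "g \<in> \<Gamma> \<Longrightarrow> wd u g \<in> QG"
  unfolding QG_span by (rule pm.span_base) auto

lemma FQ_mono: "m \<le> n \<Longrightarrow> FQ m \<subseteq> FQ n"
  unfolding FQ_def by fastforce

lemma FQ_QG: "FQ n \<subseteq> QG"
  unfolding FQ_def QG_def by auto

lemma FQ_mult:
  assumes "x \<in> FQ (Suc m)" "y \<in> FQ n"
  shows "x * y \<in> FQ (m + n)"
proof -
  have 1: "wd u g * y \<in> FQ (m + n)" if "g \<in> \<Gamma>" "length u < Suc m" for u g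
    using assms(2) unfolding FQ_span[of n]
  proof (induction rule: pm.span_induct)
    case (step z) then show ?case using that by (auto intro!: wd_FQ)
  qed (rule subspace_mult_left, simp)
  show ?thesis using assms(1) unfolding FQ_span[of "Suc m"]
  proof (induction rule: pm.span_induct)
    case (step z) then show ?case using 1 by auto
  qed (rule subspace_mult_right, simp)
qed

lemma kap_FQ: "kap x y \<in> FQ (Suc 0)"
proof -
  have "1 \<in> FQ (Suc 0)" using wd_FQ[of id "[]" "Suc 0"] by simp
  then show ?thesis unfolding kap_def
    by (intro pm.subspace_add pm.subspace_sum pm.subspace_scale subspace_FQ wd_FQ) (auto dest: reflsD)
qed

section \<open>Consequences of the relations in bounded degree\<close>

definition lin_rels where "lin_rels = {wd [x + y] id - wd [x] id - wd [y] id | x y. True} \<union>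
   {wd [scale a x] id - smul a (wd [x] id) | a x. True}"

definition relB where "relB x y = wd [x, y] id - wd [y, x] id - kap x y"

text \<open>The left word carries no group element, since one can be pushed through a relation to
  the right. The length conditions bound the whole product, relation included, by n:
  \<open>I n\<close> holds the consequences derivable without exceeding degree n.\<close>

definition I_gens where "I_gens n = {wd u id * r * wd w h | u r w h. r \<in> lin_rels \<and> h \<in> \<Gamma> \<and> length u + length w + 1 \<le> n} \<union>
   {wd u id * relB x y * wd w h | u x y w h. h \<in> \<Gamma> \<and> length u + length w + 2 \<le> n}"

definition I where "I n = pm.span (I_gens n)"

lemma subspace_I [simp, intro]: "pm.subspace (I n)" by (simp add: I_def)

lemma I_mono: "m \<le> n \<Longrightarrow> I m \<subseteq> I n"
  unfolding I_def by (rule pm.span_mono) (fastforce simp: I_gens_def)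

lemma lin_relsE:
  assumes "r \<in> lin_rels"
  obtains (add) x y where "r = wd [x + y] id - wd [x] id - wd [y] id"
    | (scale) a x where "r = wd [scale a x] id - smul a (wd [x] id)"
  using assms unfolding lin_rels_def by blast

lemma I_lin:
  assumes "r \<in> lin_rels" "g \<in> \<Gamma>" "h \<in> \<Gamma>" "length u + length w + 1 \<le> n"
  shows "wd u g * r * wd w h \<in> I n"
proof -
  have "\<exists>r'\<in>lin_rels. wd u g * r = wd u id * r' * wd [] g"
  proof -
    from assms(1) show ?thesis
    proof (cases rule: lin_relsE)
      case (add x y)
      then have "wd u g * r = wd u id * (wd [g x + g y] id - wd [g x] id - wd [g y] id) * wd [] g"
        by (simp add: left_diff_distrib right_diff_distrib \<Gamma>D(1)[OF assms(2)])
      then show ?thesis unfolding lin_rels_def by blast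
    next
      case (scale a x)
      then have "wd u g * r = wd u id * (wd [scale a (g x)] id - smul a (wd [g x] id)) * wd [] g"
        by (simp add: left_diff_distrib right_diff_distrib \<Gamma>D(2)[OF assms(2)])
      then show ?thesis unfolding lin_rels_def by blast
    qed
  qed
  then obtain r' where r': "r' \<in> lin_rels" "wd u g * r = wd u id * r' * wd [] g" by blast
  then have "wd u g * r * wd w h = wd u id * r' * wd (map g w) (g \<circ> h)" by simp
  moreover have "\<dots> \<in> I n"
    unfolding I_def I_gens_def using r'(1) assms \<Gamma>_comp by (intro pm.span_base) fastforce
  ultimately show ?thesis by simp
qed

lemma I_com:
  assumes "g \<in> \<Gamma>" "h \<in> \<Gamma>" "length u + length w + 2 \<le> n"
  shows "wd u g * relB x y * wd w h \<in> I n"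
proof -
  have "wd u g * relB x y = wd u id * relB (g x) (g y) * wd [] g"
    by (simp add: relB_def left_diff_distrib right_diff_distrib kap_equivariant[OF assms(1)])
  then have "wd u g * relB x y * wd w h = wd u id * relB (g x) (g y) * wd (map g w) (g \<circ> h)" by simp
  moreover have "\<dots> \<in> I n"
    unfolding I_def I_gens_def using assms \<Gamma>_comp by (intro pm.span_base) fastforce
  ultimately show ?thesis by simp
qed

lemma I_wd_right:
  assumes "x \<in> I n" "g \<in> \<Gamma>"
  shows "x * wd v g \<in> I (n + length v)"
  using assms(1) unfolding I_def[of n]
proof (induction rule: pm.span_induct)
  case (step x)
  then show ?case unfolding I_gens_def using assms(2) by (auto intro!: I_lin I_com)
qed (rule subspace_mult_right, simp)

lemma I_wd_left:
  assumes "x \<in> I n" "g \<in> \<Gamma>"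
  shows "wd v g * x \<in> I (length v + n)"
  using assms(1) unfolding I_def[of n]
proof (induction rule: pm.span_induct)
  case (step x)
  then show ?case unfolding I_gens_def using assms(2)
    by (auto intro!: I_lin I_com simp: mult.assoc[symmetric])
qed (rule subspace_mult_left, simp)

lemma I_mult_right:
  assumes "x \<in> I n" "y \<in> FQ (Suc m)"
  shows "x * y \<in> I (n + m)"
  using assms(2) unfolding FQ_span
proof (induction rule: pm.span_induct)
  case (step y)
  then obtain u g where "y = wd u g" "g \<in> \<Gamma>" "length u \<le> m" by auto
  then show ?case using I_wd_right[OF assms(1), of g u] I_mono[of "n + length u" "n + m"] by auto
qed (rule subspace_mult_left, simp)

lemma I_mult_left:
  assumes "x \<in> I n" "y \<in> FQ (Suc m)"
  shows "y * x \<in> I (m + n)"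
  using assms(2) unfolding FQ_span
proof (induction rule: pm.span_induct)
  case (step y)
  then obtain u g where "y = wd u g" "g \<in> \<Gamma>" "length u \<le> m" by auto
  then show ?case using I_wd_left[OF assms(1), of g u] I_mono[of "length u + n" "m + n"] by auto
qed (rule subspace_mult_right, simp)

lemma lin_rel_add: "wd [x + y] id - wd [x] id - wd [y] id \<in> lin_rels"
  and lin_rel_scale: "wd [scale a x] id - smul a (wd [x] id) \<in> lin_rels"
  unfolding lin_rels_def by auto

lemma lin_rels_I: "r \<in> lin_rels \<Longrightarrow> r \<in> I 1"
  using I_lin[of r id id "[]" "[]" 1] by simp

lemma relB_I: "relB x y \<in> I 2"
  using I_com[of id id "[]" "[]" 2 x y] by simp

lemma letters_diff: "wd [x - y] id - (wd [x] id - wd [y] id) \<in> I 1"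
  using pm.subspace_neg[OF subspace_I lin_rels_I[OF lin_rel_add[of "x - y" y]]] by (simp add: algebra_simps)

lemma letters_zero: "wd [0] id \<in> I 1"
  using letters_diff[of 0 0] by simp

text \<open>\<open>rf_three_term\<close> is an identity between vectors; it passes to letters only
  modulo the linearity relations of degree 1.\<close>

lemma jacobi:
  assumes "s \<in> refls"
  shows "smul (rf s x y) (wd [s z] id - wd [z] id) + smul (rf s y z) (wd [s x] id - wd [x] id)
    + smul (rf s z x) (wd [s y] id - wd [y] id) \<in> I 1"
proof -
  have *: "smul a (wd [s v] id - wd [v] id) - wd [scale a (s v - v)] id \<in> I 1" for a v
  proof -
    have "smul a (wd [s v - v] id - (wd [s v] id - wd [v] id)) \<in> I 1"
      using letters_diff by (rule pm.subspace_scale[OF subspace_I])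
    then have "- smul a (wd [s v - v] id - (wd [s v] id - wd [v] id)) - (wd [scale a (s v - v)] id - smul a (wd [s v - v] id)) \<in> I 1"
      using lin_rels_I[OF lin_rel_scale] by (rule pm.subspace_diff[OF subspace_I pm.subspace_neg[OF subspace_I]])
    then show ?thesis by (simp add: pm.scale_right_diff_distrib)
  qed
  have 3: "wd [u] id + wd [v] id + wd [w] id \<in> I 1" if "u + v + w = 0" for u v w
  proof -
    have "wd [u + v + w] id - (wd [u + v + w] id - wd [u + v] id - wd [w] id) - (wd [u + v] id - wd [u] id - wd [v] id) \<in> I 1"
      using that letters_zero by (intro pm.subspace_diff[OF subspace_I pm.subspace_diff[OF subspace_I]] lin_rels_I[OF lin_rel_add]) simp
    then show ?thesis by (simp add: algebra_simps)
  qed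
  show ?thesis
    using pm.subspace_add[OF subspace_I pm.subspace_add[OF subspace_I pm.subspace_add[OF subspace_I
      *[of "rf s x y" z] *[of "rf s y z" x]] *[of "rf s z x" y]] 3[OF rf_three_term[OF assms, of x y z]]]
    by (simp add: algebra_simps)
qed

section \<open>The prescribed commutators as changes of a potential\<close>

definition Kp where "Kp u x y v = wd u id * kap x y * wd v id"

lemma kap_wd_FQ: "kap x y * wd v id \<in> FQ (Suc (length v))" "wd v id * kap x y \<in> FQ (Suc (length v))"
  using FQ_mult[OF kap_FQ[of x y] wd_FQ[of id v "Suc (length v)"]] FQ_mult[OF wd_FQ[of id v "Suc (length v)"] kap_FQ[of x y]]
  by auto

text \<open>The defect is a difference of two products in which one pair contributes
  \<open>kap\<close> and the other a relation \<open>relB\<close>. As \<open>kap\<close> has degree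
  0, these lie even in degree m - 1.\<close>

lemma Kp_square:
  assumes "length (u @ x # y # v @ z # t # w) = Suc m"
  shows "Kp u x y (v @ z # t # w) + Kp (u @ y # x # v) z t w - (Kp (u @ x # y # v) z t w + Kp u x y (v @ t # z # w)) \<in> I m"
    (is "?K \<in> _")
proof -
  have e: "wd (a @ b) id = wd a id * wd b id" for a b :: "'v list" by simp
  have e1: "wd (u @ x # y # v) id = wd u id * wd [x, y] id * wd v id" for u x y and v :: "'v list" by simp
  have "?K = (wd u id * kap x y * wd v id) * (relB z t * wd w id) - (wd u id * relB x y) * (wd v id * kap z t * wd w id)"
    unfolding Kp_def e1 relB_def by (simp add: ring_distribs left_diff_distrib right_diff_distrib mult.assoc del: wd_mult_assoc wd_mult)
  moreover have "wd u id * kap x y * wd v id \<in> FQ (Suc (length u + length v))"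
    using FQ_mult[OF kap_wd_FQ(2)[of u x y] wd_FQ[of id v "Suc (length v)"]] by auto
  then have "(wd u id * kap x y * wd v id) * (relB z t * wd w id) \<in> I (length u + length v + (2 + length w))"
    by (intro I_mult_left I_wd_right relB_I \<Gamma>_id)
  moreover have "wd v id * kap z t * wd w id \<in> FQ (Suc (length v + length w))"
    using FQ_mult[OF kap_wd_FQ(2)[of v z t] wd_FQ[of id w "Suc (length w)"]] by auto
  then have "(wd u id * relB x y) * (wd v id * kap z t * wd w id) \<in> I (length u + 2 + (length v + length w))"
    by (intro I_mult_right I_wd_left relB_I \<Gamma>_id)
  ultimately show ?thesis
    using assms I_mono[of "length u + length v + (2 + length w)" m] I_mono[of "length u + 2 + (length v + length w)" m]
    by (auto intro!: pm.subspace_diff[OF subspace_I])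
qed

text \<open>The defect is the cyclic sum of the commutators of \<open>kap x y\<close> with z, placed
  between u and w. By \<open>jacobi\<close> it reduces to linearity relations.\<close>

lemma Kp_hexagon:
  assumes "length (u @ x # y # z # w) = Suc m"
  shows "Kp u x y (z # w) + Kp (u @ [y]) x z w + Kp u y z (x # w)
      - (Kp (u @ [x]) y z w + Kp u x z (y # w) + Kp (u @ [z]) x y w) \<in> I m" (is "?K \<in> _")
proof -
  define C where "C x y z = kap x y * wd [z] id - wd [z] id * kap x y" for x y z
  have e: "wd (a @ [b]) id = wd a id * wd [b] id" "wd (b # a) id = wd [b] id * wd a id" for a :: "'v list" and b by simp_all
  have k: "kap x z = - kap z x" using kap_swap[of x z] by (simp add: eq_neg_iff_add_eq_0)
  have "?K = wd u id * (C x y z + C y z x + C z x y) * wd w id"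
    unfolding Kp_def C_def k e(1)[of u] e(2)[of _ w]
    by (simp add: ring_distribs left_diff_distrib right_diff_distrib mult.assoc del: wd_mult_assoc wd_mult)
  moreover have "C x y z + C y z x + C z x y = (\<Sum>s\<in>refls. smul (c s) ((smul (rf s x y) (wd [s z] id - wd [z] id)
     + smul (rf s y z) (wd [s x] id - wd [x] id) + smul (rf s z x) (wd [s y] id - wd [y] id)) * wd [] s))"
    unfolding C_def kap_commutator sum.distrib[symmetric]
    by (rule sum.cong) (simp_all add: ring_distribs pm.scale_right_distrib del: wd_mult)
  moreover have "\<dots> \<in> I 1"
    using jacobi I_wd_right[of _ 1 _ "[]"] reflsD by (intro pm.subspace_sum[OF subspace_I] pm.subspace_scale[OF subspace_I]) auto
  ultimately have "?K \<in> I (length u + 1 + length w)"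
    by (auto intro!: I_wd_right I_wd_left simp del: One_nat_def)
  then show ?thesis using I_mono[of "length u + 1 + length w" m] assms by auto
qed

text \<open>An enumeration of the finite basis supplies the order that sorting requires.\<close>

lemma potential_on_basis:
  obtains D where "\<And>u x y v. set (u @ x # y # v) \<subseteq> Bas \<Longrightarrow> length (u @ x # y # v) = Suc m \<Longrightarrow>
    D (u @ x # y # v) - D (u @ y # x # v) - Kp u x y v \<in> I m"
proof -
  obtain key :: "'v \<Rightarrow> nat" where key: "inj_on key Bas"
    using finite_imp_inj_to_nat_seg[OF finite_Basis] by metis
  interpret potential key Bas "Suc m" Kp "I m"
  proof
    show "Kp u x y v + Kp u y x v \<in> I m" for u x y v
    proof -
      have "Kp u x y v + Kp u y x v = wd u id * (kap x y + kap y x) * wd v id"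
        unfolding Kp_def by (simp add: ring_distribs)
      then show ?thesis by (simp add: kap_swap pm.subspace_0)
    qed
    show "Kp u x x v \<in> I m" for u x v by (simp add: Kp_def kap_diag pm.subspace_0)
  qed (use key Kp_square Kp_hexagon in \<open>auto intro: pm.subspace_0 pm.subspace_add pm.subspace_neg\<close>)
  show thesis using D_swap that by blast
qed

section \<open>Extension from basis words to all words\<close>

lemma linear_basis_induct:
  assumes N: "pm.subspace N"
    and add: "\<And>x y. E (x + y) - E x - E y \<in> N" and scale: "\<And>a x. E (scale a x) - smul a (E x) \<in> N"
    and basis: "\<And>b. b \<in> Bas \<Longrightarrow> E b \<in> N"
  shows "E x \<in> N"
proof -
  have "x \<in> span Bas" using span_Basis by simp
  then show ?thesis
  proof (induction rule: span_induct)
    case (step x) then show ?case by (rule basis)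
  next
    show "subspace {x. E x \<in> N}"
      unfolding subspace_def
    proof (intro conjI ballI allI; simp only: mem_Collect_eq)
      show "E 0 \<in> N" using scale[of 0 0] by simp
      show "E (x + y) \<in> N" if "E x \<in> N" "E y \<in> N" for x y
        using pm.subspace_add[OF N pm.subspace_add[OF N add[of x y] that(1)] that(2)] by simp
      show "E (scale a x) \<in> N" if "E x \<in> N" for a x
        using pm.subspace_add[OF N scale[of a x] pm.subspace_scale[OF N that, of a]] by simp
    qed
  qed
qed

lemma multilinear_basis_induct:
  assumes N: "pm.subspace N"
    and add: "\<And>u x y v. length (u @ x # v) = n \<Longrightarrow> E (u @ (x + y) # v) - E (u @ x # v) - E (u @ y # v) \<in> N"
    and scale: "\<And>u a x v. length (u @ x # v) = n \<Longrightarrow> E (u @ scale a x # v) - smul a (E (u @ x # v)) \<in> N"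
    and basis: "\<And>w. set w \<subseteq> Bas \<Longrightarrow> length w = n \<Longrightarrow> E w \<in> N"
    and "length w = n"
  shows "E w \<in> N"
proof -
  \<comment> \<open>The suffix \<open>v\<close> already consists of basis vectors while
    \<open>u\<close> is arbitrary; the last letter of \<open>u\<close> is expanded next.\<close>
  have "E (u @ v) \<in> N" if "length (u @ v) = n" "set v \<subseteq> Bas" for u v
    using that
  proof (induction u arbitrary: v rule: rev_induct)
    case Nil then show ?case using basis by simp
  next
    case (snoc x u)
    have "E (u @ x # v) \<in> N"
      by (rule linear_basis_induct[OF N, of "\<lambda>x. E (u @ x # v)"]) (use snoc add scale in auto)
    then show ?case by simp
  qed
  from this[of w "[]"] assms(5) show ?thesis by simp
qed

text \<open>A vector rewritten in basis letters. The product \<open>crds\<close> of these expansions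
  is exactly multilinear, although words themselves are not.\<close>

definition crd :: "'v \<Rightarrow> ('v list \<Rightarrow>\<^sub>0 complex)"
  where "crd v = (\<Sum>b\<in>Bas. single [b] (representation Bas v b))"

lemma crd_add: "crd (x + y) = crd x + crd y" and crd_scale: "crd (scale a x) = smul a (crd x)"
  using representation_add[OF independent_Basis, of y x] representation_scale[OF independent_Basis, of x a]
  by (simp_all add: crd_def span_Basis single_add sum.distrib pm.scale_sum_right)

lemma crd_basis: "b \<in> Bas \<Longrightarrow> crd b = mon [b]"
proof -
  assume b: "b \<in> Bas"
  have "crd b = (\<Sum>b'\<in>Bas. if b' = b then mon [b] else 0)"
    unfolding crd_def by (rule sum.cong) (auto simp: representation_basis[OF independent_Basis b])
  then show ?thesis using b finite_Basis by simp
qed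

definition crds :: "'v list \<Rightarrow> ('v list \<Rightarrow>\<^sub>0 complex)"
  where "crds w = prod_list (map crd w)"

lemma crds_basis: "set w \<subseteq> Bas \<Longrightarrow> crds w = mon w"
  by (induction w) (auto simp: crds_def crd_basis mult_single plus_list_def)

lemma crds_add: "crds (u @ (x + y) # v) = crds (u @ x # v) + crds (u @ y # v)"
  and crds_scale: "crds (u @ scale a x # v) = smul a (crds (u @ x # v))"
  by (simp_all add: crds_def crd_add crd_scale ring_distribs)

text \<open>Exact multilinearity of \<open>D\<close> is arranged through \<open>crds\<close>, so
  that top-degree linearity relations will be sent to zero. The exchange rule is known on basis
  words and is freed one slot at a time.\<close>

lemma multilinear_potential:
  obtains D where "\<And>u x y v. D (u @ (x + y) # v) = D (u @ x # v) + D (u @ y # v)"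
    "\<And>u a x v. D (u @ scale a x # v) = smul a (D (u @ x # v))"
    "\<And>u x y v. length u + length v + 2 = Suc m \<Longrightarrow> D (u @ x # y # v) - D (u @ y # x # v) - Kp u x y v \<in> I m"
proof -
  obtain D0 where D0: "\<And>u x y v. set (u @ x # y # v) \<subseteq> Bas \<Longrightarrow> length (u @ x # y # v) = Suc m \<Longrightarrow>
    D0 (u @ x # y # v) - D0 (u @ y # x # v) - Kp u x y v \<in> I m" using potential_on_basis by blast
  define D where "D w = lin_ext D0 (crds w)" for w
  have D_add: "D (u @ (x + y) # v) = D (u @ x # v) + D (u @ y # v)"
    and D_scale: "D (u @ scale a x # v) = smul a (D (u @ x # v))" for u x y a v
    by (simp_all add: D_def crds_add crds_scale lin_ext_add lin_ext_smul)
  have D_basis: "D w = D0 w" if "set w \<subseteq> Bas" for w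
    using that by (simp add: D_def crds_basis)
  define E where "E u x y v = D (u @ x # y # v) - D (u @ y # x # v) - Kp u x y v" for u x y v
  have D_add': "D (u @ z # (x + y) # v) = D (u @ z # x # v) + D (u @ z # y # v)"
    and D_scale': "D (u @ z # scale a x # v) = smul a (D (u @ z # x # v))" for u z x y a v
    using D_add[of "u @ [z]"] D_scale[of "u @ [z]"] by simp_all
  have D_add2: "D (u @ (x + y) # v @ w) = D (u @ x # v @ w) + D (u @ y # v @ w)" for u x y v w
    using D_add[of u x y "v @ w"] by simp
  \<comment> \<open>The two exchanged slots come first: \<open>kap\<close> and \<open>D\<close> are
    exactly bilinear in them, so all linearity defects vanish.\<close>
  have 1: "E u x y v \<in> I m" if "set u \<subseteq> Bas" "set v \<subseteq> Bas" "x \<in> Bas" "y \<in> Bas" "length u + length v + 2 = Suc m" for u v x y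
    using D0[of u x y v] that by (simp add: E_def D_basis)
  have 2: "E u x y v \<in> I m" if "set u \<subseteq> Bas" "set v \<subseteq> Bas" "x \<in> Bas" "length u + length v + 2 = Suc m" for u v x y
    by (rule linear_basis_induct[OF subspace_I, of "\<lambda>y. E u x y v"])
      (use that 1 in \<open>auto simp: E_def D_add D_scale D_add' D_scale' Kp_def kap_add_right kap_scale_right
        ring_distribs pm.scale_right_diff_distrib pm.subspace_0\<close>)
  have 3: "E u x y v \<in> I m" if "set u \<subseteq> Bas" "set v \<subseteq> Bas" "length u + length v + 2 = Suc m" for u v x y
    by (rule linear_basis_induct[OF subspace_I, of "\<lambda>x. E u x y v"])
      (use that 2 in \<open>auto simp: E_def D_add D_scale D_add' D_scale' Kp_def kap_add_left kap_scale_left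
        ring_distribs pm.scale_right_diff_distrib pm.subspace_0\<close>)
  \<comment> \<open>In the outer slots letters remain letters, so \<open>Kp\<close> is linear there
    only modulo linearity relations; since \<open>kap\<close> has degree 0, the defects still fit
    into \<open>I m\<close>.\<close>
  have K1: "Kp (a @ (x + y) # b) z t v - Kp (a @ x # b) z t v - Kp (a @ y # b) z t v \<in> I m"
     "Kp (a @ scale s x # b) z t v - smul s (Kp (a @ x # b) z t v) \<in> I m"
     "Kp v z t (a @ (x + y) # b) - Kp v z t (a @ x # b) - Kp v z t (a @ y # b) \<in> I m"
     "Kp v z t (a @ scale s x # b) - smul s (Kp v z t (a @ x # b)) \<in> I m"
    if m: "length a + length b + length v + 3 = Suc m" for a x y b z t v s
  proof -
    have e: "wd (u @ x # w) id = wd u id * wd [x] id * wd w id" for u and x :: 'v and w by simp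
    have sub: "I (length a + length b + 1 + length v) \<subseteq> I m" using m by (intro I_mono) simp
    have f1: "kap z t * wd v id \<in> FQ (Suc (length v))" and f2: "wd v id * kap z t \<in> FQ (Suc (length v))"
      by (rule kap_wd_FQ)+
    have L: "wd a id * r * wd b id * (kap z t * wd v id) \<in> I m" "(wd v id * kap z t) * (wd a id * r * wd b id) \<in> I m"
      if "r \<in> lin_rels" for r
      using I_mult_right[OF I_lin[OF that \<Gamma>_id \<Gamma>_id order_refl] f1, of a b] I_mult_left[OF I_lin[OF that \<Gamma>_id \<Gamma>_id order_refl] f2, of a b] sub
      by (auto simp: add_ac)
    show "Kp (a @ (x + y) # b) z t v - Kp (a @ x # b) z t v - Kp (a @ y # b) z t v \<in> I m"
       "Kp v z t (a @ (x + y) # b) - Kp v z t (a @ x # b) - Kp v z t (a @ y # b) \<in> I m"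
      using L[OF lin_rel_add[of x y]] unfolding Kp_def e
      by (simp_all add: ring_distribs left_diff_distrib right_diff_distrib mult.assoc del: wd_mult wd_mult_assoc)
    show "Kp (a @ scale s x # b) z t v - smul s (Kp (a @ x # b) z t v) \<in> I m"
       "Kp v z t (a @ scale s x # b) - smul s (Kp v z t (a @ x # b)) \<in> I m"
      using L[OF lin_rel_scale[of s x]] unfolding Kp_def e
      by (simp_all add: ring_distribs left_diff_distrib right_diff_distrib mult.assoc del: wd_mult wd_mult_assoc)
  qed
  have 4: "E u x y v \<in> I m" if "set u \<subseteq> Bas" "length u + length v + 2 = Suc m" for u v x y
  proof (rule multilinear_basis_induct[OF subspace_I, where n = "length v" and E = "\<lambda>v. E u x y v"])
    show "E u x y (a @ (z + t) # b) - E u x y (a @ z # b) - E u x y (a @ t # b) \<in> I m" if "length (a @ z # b) = length v" for a z t b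
      using pm.subspace_neg[OF subspace_I K1(3)[of a b u x y z t]] that \<open>length u + length v + 2 = Suc m\<close>
        D_add[of "u @ x # y # a" z t b] D_add[of "u @ y # x # a" z t b] by (simp add: E_def algebra_simps)
    show "E u x y (a @ scale s z # b) - smul s (E u x y (a @ z # b)) \<in> I m" if "length (a @ z # b) = length v" for a z s b
      using pm.subspace_neg[OF subspace_I K1(4)[of a b u x y s z]] that \<open>length u + length v + 2 = Suc m\<close>
        D_scale[of "u @ x # y # a" s z b] D_scale[of "u @ y # x # a" s z b] by (simp add: E_def pm.scale_right_diff_distrib)
  qed (use 3 that in auto)
  have 5: "E u x y v \<in> I m" if "length u + length v + 2 = Suc m" for u v x y
  proof (rule multilinear_basis_induct[OF subspace_I, where n = "length u" and E = "\<lambda>u. E u x y v"])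
    show "E (a @ (z + t) # b) x y v - E (a @ z # b) x y v - E (a @ t # b) x y v \<in> I m" if "length (a @ z # b) = length u" for a z t b
      using pm.subspace_neg[OF subspace_I K1(1)[of a b v z t x y]] that \<open>length u + length v + 2 = Suc m\<close>
        D_add[of a z t "b @ x # y # v"] D_add[of a z t "b @ y # x # v"] by (simp add: E_def algebra_simps)
    show "E (a @ scale s z # b) x y v - smul s (E (a @ z # b) x y v) \<in> I m" if "length (a @ z # b) = length u" for a z s b
      using pm.subspace_neg[OF subspace_I K1(2)[of a b v s z x y]] that \<open>length u + length v + 2 = Suc m\<close>
        D_scale[of a s z "b @ x # y # v"] D_scale[of a s z "b @ y # x # v"] by (simp add: E_def pm.scale_right_diff_distrib)
  qed (use 4 that in auto)
  show thesis using that[of D] D_add D_scale 5 by (simp add: E_def)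
qed

text \<open>
  Replacing the words \<open>w\<close> of length \<open>m + 1\<close> by \<open>D w\<close> is a map that fixes shorter words and lowers the
  filtration degree of relations.
\<close>

lemma PBW_step:
  assumes "x \<in> I (Suc m)" "x \<in> FQ (Suc m)"
  shows "x \<in> I m"
proof -
  obtain D where D: "\<And>u x y v. D (u @ (x + y) # v) = D (u @ x # v) + D (u @ y # v)"
    "\<And>u a x v. D (u @ scale a x # v) = smul a (D (u @ x # v))"
    "\<And>u x y v. length u + length v + 2 = Suc m \<Longrightarrow> D (u @ x # y # v) - D (u @ y # x # v) - Kp u x y v \<in> I m"
    using multilinear_potential by blast
  \<comment> \<open>Words longer than m + 1 are left unchanged; they do not occur in the generators
    of \<open>I (Suc m)\<close>.\<close>
  define \<Phi> where "\<Phi> = lin_ext (\<lambda>k. if length (sw_word k) = Suc m then D (sw_word k) * wd [] (sw_map k) else mon k)"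
  have \<Phi>_wd: "\<Phi> (wd u g) = (if length u = Suc m then D u * wd [] g else wd u g)" for u g
    by (simp add: \<Phi>_def wd_def)
  have \<Phi>: "\<Phi> (p + q) = \<Phi> p + \<Phi> q" "\<Phi> (p - q) = \<Phi> p - \<Phi> q" "\<Phi> (smul a p) = smul a (\<Phi> p)" for p q a
    by (simp_all add: \<Phi>_def lin_ext_add lin_ext_diff lin_ext_smul)
  have \<Phi>_FQ: "\<Phi> p = p" if "p \<in> FQ (Suc m)" for p
    using that unfolding FQ_span
  proof (induction rule: pm.span_induct)
    case (step p) then show ?case by (auto simp: \<Phi>_wd)
  qed (auto simp: pm.subspace_def \<Phi>, simp add: \<Phi>_def)
  have "\<Phi> g \<in> I m" if g: "g \<in> I_gens (Suc m)" for g
  proof -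
    from g consider
        (lin) u r w h where "g = wd u id * r * wd w h" "r \<in> lin_rels" "h \<in> \<Gamma>" "length u + length w + 1 \<le> Suc m"
      | (com) u x y w h where "g = wd u id * relB x y * wd w h" "h \<in> \<Gamma>" "length u + length w + 2 \<le> Suc m"
      unfolding I_gens_def by blast
    then show ?thesis
    proof cases
      case lin
      show ?thesis
      proof (cases "length u + length w + 1 = Suc m")
        case True
        \<comment> \<open>\<open>D\<close> is exactly multilinear, so linearity relations of top
          degree are killed.\<close>
        then have "\<Phi> g = 0"
          using lin unfolding lin_rels_def
          by (auto simp: ring_distribs left_diff_distrib right_diff_distrib \<Phi> \<Phi>_wd D)
        then show ?thesis by (simp add: pm.subspace_0)
      next
        case False
        then have "length u + length w + 1 \<le> m" using lin by simp
        moreover have "\<Phi> g = g"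
          using lin False unfolding lin_rels_def
          by (auto simp: ring_distribs left_diff_distrib right_diff_distrib \<Phi> \<Phi>_wd)
        ultimately show ?thesis using lin I_lin by simp
      qed
    next
      case com
      have g: "g = wd (u @ x # y # w) h - wd (u @ y # x # w) h - Kp u x y w * wd [] h"
        using com by (simp add: relB_def Kp_def left_diff_distrib right_diff_distrib)
      have "wd u id * (kap x y * wd w h) \<in> FQ (length u + (0 + Suc (length w)))"
        using com by (intro FQ_mult kap_FQ wd_FQ) auto
      then have "Kp u x y w * wd [] h \<in> FQ (Suc m)"
        using FQ_mono[of "length u + (0 + Suc (length w))" "Suc m"] com by (auto simp: Kp_def mult.assoc)
      note fix1 = \<Phi>_FQ[OF this]
      show ?thesis
      proof (cases "length u + length w + 2 = Suc m")
        case True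
        \<comment> \<open>In top degree the image is the exchange defect of \<open>D\<close>; the
          group element on the right does not affect degrees.\<close>
        then have "\<Phi> g = (D (u @ x # y # w) - D (u @ y # x # w) - Kp u x y w) * wd [] h"
          unfolding g by (simp add: \<Phi> \<Phi>_wd fix1 left_diff_distrib)
        then show ?thesis using I_wd_right[OF D(3)[OF True] com(2), where v = "[]"] by simp
      next
        case False
        then have "length u + length w + 2 \<le> m" using com by simp
        moreover have "\<Phi> g = g" unfolding g using False by (simp add: \<Phi> \<Phi>_wd fix1)
        ultimately show ?thesis using com I_com by simp
      qed
    qed
  qed
  then have "I (Suc m) \<subseteq> {p. \<Phi> p \<in> I m}"
    unfolding I_def[of "Suc m"] \<Phi>_def by (intro pm.span_minimal subspace_lin_ext) auto
  then show ?thesis using assms \<Phi>_FQ by auto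
qed

text \<open>Cancellation among consequences of high degree yields nothing new in low degree:
  \<open>PBW_step\<close> lowers n to m by one at a time, with x in the required \<open>FQ\<close>
  throughout.\<close>

theorem PBW:
  assumes "x \<in> I n" "x \<in> FQ (Suc m)"
  shows "x \<in> I m"
proof (cases "m \<le> n")
  case True
  then show ?thesis using assms
  proof (induction rule: dec_induct)
    case (step n)
    then have "x \<in> FQ (Suc n)" using FQ_mono[of "Suc m" "Suc n"] by auto
    then show ?case using step PBW_step by blast
  qed
next
  case False
  then show ?thesis using assms I_mono[of n m] by auto
qed

end

section \<open>The symmetric algebra and its invariants\<close>

lemma presents_free_alg: "presents UNIV id (free_alg :: ('v list \<Rightarrow>\<^sub>0 complex) calg)"
  unfolding presents_def subalg_def free_alg_def by (auto simp: smul_def zero_list_def)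

lemma free_act_eq: "free_act g = lin_ext (\<lambda>w. mon (map g w))"
  by (rule ext) (simp add: free_act_def lin_ext_def)

lemma free_act_single [simp]: "free_act g (single w a) = single (map g w) a"
  by (simp add: free_act_eq)

lemma free_act_add: "free_act g (p + q) = free_act g p + free_act g q"
  and free_act_diff: "free_act g (p - q) = free_act g p - free_act g q"
  and free_act_smul: "free_act g (smul a p) = smul a (free_act g p)"
  and free_act_sum: "free_act g (\<Sum>i\<in>X. f i) = (\<Sum>i\<in>X. free_act g (f i))"
  and free_act_zero [simp]: "free_act g 0 = 0"
  by (simp_all add: free_act_eq lin_ext_add lin_ext_diff lin_ext_smul lin_ext_sum)

lemma free_act_mult: "free_act g (p * q) = free_act g p * free_act g q"
  unfolding free_act_eq by (rule lin_ext_mult) (simp add: mult_single plus_list_def)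

lemma free_act_one [simp]: "free_act g 1 = 1"
  unfolding single_Nil[symmetric] by (simp del: single_Nil)

lemma free_act_comp: "free_act g (free_act h p) = free_act (g \<circ> h) p"
proof (induction p rule: poly_mapping_linear_induct)
  case subspace
  then show ?case by (auto simp: pm.subspace_def free_act_add free_act_smul)
qed (simp add: comp_def)

lemma free_act_id: "free_act id p = p"
  by (simp add: free_act_eq lin_ext_id)

lemma hcomp_free_act: "hcomp n (free_act g p) = free_act g (hcomp n p)"
proof (induction p rule: poly_mapping_linear_induct)
  case subspace
  then show ?case by (auto simp: pm.subspace_def free_act_add free_act_smul hcomp_add hcomp_smul)
qed (simp add: hcomp_single)

lemma subspace_free_act: "pm.subspace W \<Longrightarrow> pm.subspace {p. free_act g p \<in> W}"
  unfolding free_act_eq by (rule subspace_lin_ext)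

lemma hcomp_fixed_iff: "hcomp n p = p \<longleftrightarrow> (\<forall>w\<in>keys p. length w = n)"
proof -
  have "hcomp n p = p \<longleftrightarrow> (\<forall>w. lookup (hcomp n p) w = lookup p w)"
    by (simp add: poly_mapping_eq_iff fun_eq_iff)
  then show ?thesis by (auto simp: lookup_hcomp in_keys_iff)
qed

lemma prod_list_zero: "0 \<in> set xs \<Longrightarrow> prod_list xs = (0 :: 'a::ring_1)"
  by (induction xs) auto

lemma subalg_UNIV: "subalg UNIV"
  by (simp add: subalg_def)

context sra_data
begin

definition tens_gens :: "('v list \<Rightarrow>\<^sub>0 complex) set"
  where "tens_gens = {mon [x + y] - mon [x] - mon [y] | x y. True} \<union>
     {mon [scale a x] - single [x] a | a x. True}"

definition com_gens :: "('v list \<Rightarrow>\<^sub>0 complex) set"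
  where "com_gens = {mon [x, y] - mon [y, x] | x y. True}"

lemma tens_gensE:
  assumes "r \<in> tens_gens"
  obtains (add) x y where "r = mon [x + y] - mon [x] - mon [y]"
    | (scale) a x where "r = mon [scale a x] - single [x] a"
  using assms unfolding tens_gens_def by blast

text \<open>\<open>KT\<close> and \<open>KS\<close> turn out to be the kernels of the maps from the
  free algebra on the set V to T(V) and to S(V).\<close>

definition KT where "KT = ideal_span UNIV tens_gens"
definition KS where "KS = ideal_span UNIV (tens_gens \<union> com_gens)"

lemma subspace_KT [simp]: "pm.subspace KT" and subspace_KS [simp]: "pm.subspace KS"
  by (simp_all add: KT_def KS_def)

lemma KS_eq: "KS = pm.span {mon u * r * mon w | u r w. r \<in> tens_gens \<union> com_gens}"
  unfolding KS_def by (subst ideal_span_singles[of _ UNIV]) auto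

lemma KT_eq: "KT = pm.span {mon u * r * mon w | u r w. r \<in> tens_gens}"
  unfolding KT_def by (subst ideal_span_singles[of _ UNIV]) auto

lemma KT_KS: "KT \<subseteq> KS"
  unfolding KT_eq KS_eq by (rule pm.span_mono) blast

lemma KS_mult: "p \<in> KS \<Longrightarrow> p * q \<in> KS" "p \<in> KS \<Longrightarrow> q * p \<in> KS"
  unfolding KS_def by (auto intro: ideal_span_mult_left ideal_span_mult_right subalg_UNIV)

lemma KS_gens: "r \<in> tens_gens \<union> com_gens \<Longrightarrow> r \<in> KS"
  unfolding KS_def by (rule ideal_span_base[OF subalg_UNIV])

text \<open>Commutators of letters are relations. The Leibniz rule extends this to words, one
  argument after the other, and linearity to all elements.\<close>

lemma KS_commute: "p * q - q * p \<in> KS"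
proof -
  define S where "S u v = (mon u * mon v - mon v * mon u :: 'v list \<Rightarrow>\<^sub>0 complex)" for u v
  have letters: "S [x] [y] \<in> KS" for x y
    unfolding S_def by (rule KS_gens) (auto simp: com_gens_def mult_single plus_list_def)
  have cons: "mon (x # v) = mon [x] * (mon v :: 'v list \<Rightarrow>\<^sub>0 complex)" for x v
    by (simp add: mult_single plus_list_def)
  have 1: "S [x] v \<in> KS" for x v
  proof (induction v)
    case Nil then show ?case by (simp add: S_def pm.subspace_0)
  next
    case (Cons y v)
    have "S [x] (y # v) = S [x] [y] * mon v + mon [y] * S [x] v"
      unfolding S_def cons[of y v] by (simp add: ring_distribs left_diff_distrib right_diff_distrib mult.assoc)
    then show ?case using letters Cons KS_mult by (auto intro!: pm.subspace_add)
  qed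
  have 2: "S u v \<in> KS" for u v
  proof (induction u)
    case Nil then show ?case by (simp add: S_def pm.subspace_0)
  next
    case (Cons x u)
    have "S (x # u) v = mon [x] * S u v + S [x] v * mon u"
      unfolding S_def cons[of x u] by (simp add: ring_distribs left_diff_distrib right_diff_distrib mult.assoc)
    then show ?case using 1 Cons KS_mult by (auto intro!: pm.subspace_add)
  qed
  have lin: "pm.subspace {p. p * q - q * p \<in> KS}" for q
    unfolding pm.subspace_def
  proof (intro conjI ballI allI; simp only: mem_Collect_eq)
    show "0 * q - q * 0 \<in> KS" by (simp add: pm.subspace_0)
    show "(x + y) * q - q * (x + y) \<in> KS" if "x * q - q * x \<in> KS" "y * q - q * y \<in> KS" for x y
      using pm.subspace_add[OF subspace_KS that] by (simp add: algebra_simps)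
    show "smul a x * q - q * smul a x \<in> KS" if "x * q - q * x \<in> KS" for a x
      using pm.subspace_scale[OF subspace_KS that, of a] by (simp add: pm.scale_right_diff_distrib)
  qed
  show ?thesis
  proof (induction p rule: poly_mapping_linear_induct)
    case (single u)
    have "q * mon u - mon u * q \<in> KS"
    proof (induction q rule: poly_mapping_linear_induct)
      case (single v) then show ?case using 2[of v u] by (simp add: S_def)
    qed (rule lin)
    from pm.subspace_neg[OF subspace_KS this] show ?case by simp
  qed (rule lin)
qed

lemma hcomp_KS: "p \<in> KS \<Longrightarrow> hcomp n p \<in> KS"
proof -
  assume p: "p \<in> KS"
  have *: "hcomp n (mon u * r * mon w) \<in> {0, mon u * r * mon w}"
    if "r \<in> tens_gens \<union> com_gens" for u w r
    using that by (auto simp: tens_gens_def com_gens_def left_diff_distrib right_diff_distrib mult_single plus_list_def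
        hcomp_diff hcomp_single)
  then have "hcomp n (mon u * r * mon w) \<in> KS" if "r \<in> tens_gens \<union> com_gens" for u w r
  proof -
    have "mon u * r * mon w \<in> KS" by (intro KS_mult KS_gens that)
    then show ?thesis using *[OF that, of u w] pm.subspace_0[OF subspace_KS] by auto
  qed
  then have "pm.span {mon u * r * mon w | u r w. r \<in> tens_gens \<union> com_gens} \<subseteq> {p. hcomp n p \<in> KS}"
    by (intro pm.span_minimal subspace_hcomp subspace_KS) blast
  then show ?thesis using p KS_eq by blast
qed

lemma free_act_gens:
  assumes "g \<in> \<Gamma>"
  shows "r \<in> tens_gens \<Longrightarrow> free_act g r \<in> tens_gens" "r \<in> com_gens \<Longrightarrow> free_act g r \<in> com_gens"
proof -
  show "free_act g r \<in> tens_gens" if "r \<in> tens_gens"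
  proof -
    from that show ?thesis
    proof (cases rule: tens_gensE)
      case (add x y)
      then have "free_act g r = mon [g x + g y] - mon [g x] - mon [g y]"
        by (simp add: free_act_diff \<Gamma>D(1)[OF assms])
      then show ?thesis unfolding tens_gens_def by blast
    next
      case (scale a x)
      then have "free_act g r = mon [scale a (g x)] - single [g x] a"
        by (simp add: free_act_diff \<Gamma>D(2)[OF assms])
      then show ?thesis unfolding tens_gens_def by blast
    qed
  qed
  show "free_act g r \<in> com_gens" if "r \<in> com_gens"
  proof -
    from that obtain x y where "r = mon [x, y] - mon [y, x]"
      unfolding com_gens_def by blast
    then have "free_act g r = mon [g x, g y] - mon [g y, g x]"
      by (simp add: free_act_diff)
    then show ?thesis unfolding com_gens_def by blast
  qed
qed

lemma free_act_ideal_span: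
  assumes "\<And>r. r \<in> X \<Longrightarrow> free_act g r \<in> X" "p \<in> ideal_span UNIV X"
  shows "free_act g p \<in> ideal_span UNIV X"
proof -
  have "ideal_span UNIV X \<subseteq> {p. free_act g p \<in> ideal_span UNIV X}"
    by (rule ideal_span_minimal)
      (auto intro!: subspace_free_act simp: free_act_mult intro: ideal_span_mult_left ideal_span_mult_right ideal_span_base subalg_UNIV assms(1))
  then show ?thesis using assms(2) by auto
qed

lemma free_act_KT: "g \<in> \<Gamma> \<Longrightarrow> p \<in> KT \<Longrightarrow> free_act g p \<in> KT"
  unfolding KT_def by (rule free_act_ideal_span) (auto intro: free_act_gens)

lemma free_act_KS: "g \<in> \<Gamma> \<Longrightarrow> p \<in> KS \<Longrightarrow> free_act g p \<in> KS"
  unfolding KS_def by (rule free_act_ideal_span) (auto dest: free_act_gens)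

lemma free_act_inv: "g \<in> \<Gamma> \<Longrightarrow> free_act g (free_act (inv_into UNIV g) p) = p"
  by (simp add: free_act_comp inv_comp free_act_id)

lemma tensor_ideal_eq: "tensor_ideal scale = KT"
proof -
  interpret F: presentation UNIV id free_alg by (rule presentation.intro, rule presents_free_alg)
  show ?thesis
    using F.Idl_image[of tens_gens] by (simp only: tensor_ideal_def tens_gens_def[symmetric] KT_def image_id id_apply subset_UNIV)
qed

definition tens :: "('v list \<Rightarrow>\<^sub>0 complex) \<Rightarrow> ('v list \<Rightarrow>\<^sub>0 complex) set"
  where "tens p = KT +>\<^bsub>free_alg\<^esub> p"

lemma presents_tensor_alg: "presents UNIV tens (TA)"
  and tens_zero_iff: "tens p = \<zero>\<^bsub>TA\<^esub> \<longleftrightarrow> p \<in> KT"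
  and tens_image: "tens p = {k + p | k. k \<in> KT}"
proof -
  interpret F: presentation UNIV id free_alg by (rule presentation.intro, rule presents_free_alg)
  have J: "Idl\<^bsub>free_alg\<^esub> (id ` tens_gens) = KT" using F.Idl_image[of tens_gens] by (simp add: KT_def)
  show "presents UNIV tens (TA)"
    using F.quot_presents(1)[of tens_gens] unfolding J by (simp add: tens_def[abs_def] tensor_alg_def tensor_ideal_eq)
  show "tens p = \<zero>\<^bsub>TA\<^esub> \<longleftrightarrow> p \<in> KT"
    using F.quot_presents(2)[of tens_gens p] unfolding J
    by (simp add: tens_def tensor_alg_def tensor_ideal_eq KT_def[symmetric]) (simp add: free_alg_def)
  show "tens p = {k + p | k. k \<in> KT}"
    using F.coset_eq_image[of KT p] by (simp add: tens_def)
qed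

sublocale T: presentation UNIV tens "TA"
  by (rule presentation.intro, rule presents_tensor_alg)

lemma tens_eq_iff: "tens p = tens q \<longleftrightarrow> p - q \<in> KT"
  using T.f_eq_iff[of p q] tens_zero_iff by simp

text \<open>The action on a coset is a set image. It is a full coset because g maps
  \<open>KT\<close> onto itself, the inverse of g giving surjectivity.\<close>

lemma tensor_act_tens:
  assumes "g \<in> \<Gamma>"
  shows "tensor_act g (tens p) = tens (free_act g p)"
proof -
  have "k \<in> free_act g ` KT" if "k \<in> KT" for k
    using free_act_KT[OF \<Gamma>_inv[OF assms] that] free_act_inv[OF assms, of k] by (metis imageI)
  then have KT: "free_act g ` KT = KT" using free_act_KT[OF assms] by auto
  have "tensor_act g (tens p) = {k + free_act g p | k. k \<in> free_act g ` KT}"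
    unfolding tensor_act_def tens_image Setcompr_eq_image image_image by (simp add: free_act_add)
  then show ?thesis unfolding KT tens_image .
qed

definition sig :: "('v list \<Rightarrow>\<^sub>0 complex) \<Rightarrow> ('v list \<Rightarrow>\<^sub>0 complex) set set"
  where "sig p = sym_ideal scale +>\<^bsub>TA\<^esub> tens p"

lemma sym_ideal_eq: "sym_ideal scale = Idl\<^bsub>TA\<^esub> (tens ` com_gens)"
proof -
  have v: "tensor_vec scale x = tens (mon [x])" for x
    by (simp add: tensor_vec_def tens_def tensor_ideal_eq)
  have "tens (mon [x]) \<otimes>\<^bsub>TA\<^esub> tens (mon [y]) \<ominus>\<^bsub>TA\<^esub>
     tens (mon [y]) \<otimes>\<^bsub>TA\<^esub> tens (mon [x]) =
     tens (mon [x, y] - mon [y, x])" for x y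
    by (simp add: T.f_diff T.f_hom(4)[symmetric] mult_single plus_list_def)
  then show ?thesis
    unfolding sym_ideal_def Let_def v com_gens_def by (auto intro!: arg_cong[where f = "genideal (TA)"])
qed

text \<open>S(V) is reached by two successive quotients, but its kernel upstairs is one ideal; the
  two descriptions are matched here.\<close>

lemma KS_decompose: "p \<in> KS \<longleftrightarrow> (\<exists>z\<in>ideal_span UNIV com_gens. p - z \<in> KT)"
proof
  assume "\<exists>z\<in>ideal_span UNIV com_gens. p - z \<in> KT"
  then obtain z where z: "z \<in> ideal_span UNIV com_gens" "p - z \<in> KT" by blast
  have "ideal_span UNIV com_gens \<subseteq> KS" unfolding KS_def ideal_span_def by (rule pm.span_mono) auto
  then have "(p - z) + z \<in> KS" using z KT_KS by (intro pm.subspace_add) auto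
  then show "p \<in> KS" by simp
next
  have "{a * x * b | a x b. a \<in> UNIV \<and> x \<in> tens_gens \<union> com_gens \<and> b \<in> (UNIV :: ('v list \<Rightarrow>\<^sub>0 complex) set)} =
    {a * x * b | a x b. a \<in> UNIV \<and> x \<in> com_gens \<and> b \<in> UNIV} \<union> {a * x * b | a x b. a \<in> UNIV \<and> x \<in> tens_gens \<and> b \<in> UNIV}"
    by blast
  then have KS: "KS = {z + k | z k. z \<in> ideal_span UNIV com_gens \<and> k \<in> KT}"
    unfolding KS_def KT_def ideal_span_def by (simp only: pm.span_Un)
  assume "p \<in> KS"
  then obtain z k where "p = z + k" "z \<in> ideal_span UNIV com_gens" "k \<in> KT" unfolding KS by blast
  then show "\<exists>z\<in>ideal_span UNIV com_gens. p - z \<in> KT" by (intro bexI[of _ z]) auto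
qed

lemma presents_sym_alg: "presents UNIV sig (sym_alg scale)"
  and sig_zero_iff: "sig p = \<zero>\<^bsub>sym_alg scale\<^esub> \<longleftrightarrow> p \<in> KS"
  and sig_image: "sig p = tens ` {k + p | k. k \<in> KS}"
proof -
  show "presents UNIV sig (sym_alg scale)"
    using T.quot_presents(1)[of com_gens] by (simp add: sig_def[abs_def] sym_alg_def sym_ideal_eq)
  show "sig p = \<zero>\<^bsub>sym_alg scale\<^esub> \<longleftrightarrow> p \<in> KS"
    using T.quot_presents(2)[of com_gens p] by (simp add: sig_def sym_alg_def sym_ideal_eq tens_zero_iff KS_decompose)
  have "tens ` KS = tens ` ideal_span UNIV com_gens"
  proof (intro equalityI subsetI)
    fix t assume "t \<in> tens ` KS"
    then show "t \<in> tens ` ideal_span UNIV com_gens"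
      using KS_decompose by (auto simp: tens_eq_iff image_iff)
  next
    fix t assume "t \<in> tens ` ideal_span UNIV com_gens"
    then obtain z where z: "z \<in> ideal_span UNIV com_gens" "t = tens z" by blast
    then have "z \<in> KS" unfolding KS_decompose using pm.subspace_0[OF subspace_KT] by (intro bexI[of _ z]) auto
    then show "t \<in> tens ` KS" using z by blast
  qed
  then have "sym_ideal scale = tens ` KS"
    using T.Idl_image[of com_gens] by (simp add: sym_ideal_eq)
  then show "sig p = tens ` {k + p | k. k \<in> KS}"
    using T.coset_eq_image[of KS p] by (simp add: sig_def)
qed

sublocale S: presentation UNIV sig "sym_alg scale"
  by (rule presentation.intro, rule presents_sym_alg)

lemma sig_eq_iff: "sig p = sig q \<longleftrightarrow> p - q \<in> KS"
  using S.f_eq_iff[of p q] sig_zero_iff by simp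

lemma sym_act_sig:
  assumes "g \<in> \<Gamma>"
  shows "sym_act g (sig p) = sig (free_act g p)"
proof -
  have "k \<in> free_act g ` KS" if "k \<in> KS" for k
    using free_act_KS[OF \<Gamma>_inv[OF assms] that] free_act_inv[OF assms, of k] by (metis imageI)
  then have KS: "free_act g ` KS = KS" using free_act_KS[OF assms] by auto
  have "sym_act g (sig p) = tens ` {k + free_act g p | k. k \<in> free_act g ` KS}"
    unfolding sym_act_def sig_image Setcompr_eq_image image_image by (simp add: free_act_add tensor_act_tens[OF assms])
  then show ?thesis unfolding KS sig_image .
qed

section \<open>Invariants and averaging\<close>

definition PG where "PG = {p. \<forall>g\<in>\<Gamma>. free_act g p = p}"

definition avg :: "('v list \<Rightarrow>\<^sub>0 complex) \<Rightarrow> ('v list \<Rightarrow>\<^sub>0 complex)"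
  where "avg p = smul (1 / of_nat (card \<Gamma>)) (\<Sum>g\<in>\<Gamma>. free_act g p)"

lemma card_\<Gamma>: "card \<Gamma> > 0"
  using fin_\<Gamma> \<Gamma>_id by (metis card_gt_0_iff empty_iff)

lemma subalg_PG: "subalg PG"
  unfolding subalg_def pm.subspace_def PG_def by (auto simp: free_act_add free_act_smul free_act_mult)

lemma bij_comp_left: "g \<in> \<Gamma> \<Longrightarrow> bij_betw ((\<circ>) g) \<Gamma> \<Gamma>"
  by (rule bij_betw_byWitness[where f' = "(\<circ>) (inv_into UNIV g)"])
    (auto simp: comp_assoc[symmetric] inv_comp)

lemma avg_PG: "avg p \<in> PG"
proof -
  have "free_act h (avg p) = avg p" if "h \<in> \<Gamma>" for h
    unfolding avg_def free_act_smul free_act_sum free_act_comp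
    using sum.reindex_bij_betw[OF bij_comp_left[OF that], of "\<lambda>g. free_act g p"] by simp
  then show ?thesis by (simp add: PG_def)
qed

lemma avg_of_PG: "p \<in> PG \<Longrightarrow> avg p = p"
  using card_\<Gamma> by (simp add: avg_def PG_def pm.sum_constant_scale del: sum_constant)

lemma avg_add: "avg (p + q) = avg p + avg q"
  and avg_diff: "avg (p - q) = avg p - avg q"
  and avg_smul: "avg (smul a p) = smul a (avg p)"
  by (simp_all add: avg_def free_act_add free_act_diff free_act_smul sum.distrib sum_subtractf pm.scale_right_distrib
      pm.scale_right_diff_distrib pm.scale_sum_right mult.commute)

lemma avg_mult_PG: "p \<in> PG \<Longrightarrow> avg (p * q) = p * avg q"
  by (simp add: avg_def free_act_mult PG_def sum_distrib_left)

lemma avg_KS: "p \<in> KS \<Longrightarrow> avg p \<in> KS"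
  unfolding avg_def by (intro pm.subspace_scale pm.subspace_sum) (auto intro: free_act_KS)

lemma hcomp_avg: "hcomp n (avg p) = avg (hcomp n p)"
  by (simp add: avg_def hcomp_smul hcomp_sum hcomp_free_act)

lemma hcomp_PG: "p \<in> PG \<Longrightarrow> hcomp n p \<in> PG"
  by (simp add: PG_def hcomp_free_act[symmetric])

lemma subspace_avg: "pm.subspace W \<Longrightarrow> pm.subspace {p. avg p \<in> W}"
  by (auto simp: pm.subspace_def avg_add avg_smul) (metis avg_smul pm.scale_zero_left)

text \<open>For an invariant class each difference of p and its translates lies in
  \<open>KS\<close>, so averaging p keeps the class. Invariants of S(V) therefore lift to invariants
  of the free algebra.\<close>

lemma sig_avg:
  assumes "\<And>g. g \<in> \<Gamma> \<Longrightarrow> sym_act g (sig p) = sig p"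
  shows "sig (avg p) = sig p"
proof -
  have "p = smul (1 / of_nat (card \<Gamma>)) (\<Sum>g\<in>\<Gamma>. p)"
    using card_\<Gamma> by (simp add: pm.sum_constant_scale del: sum_constant)
  then have "avg p - p = smul (1 / of_nat (card \<Gamma>)) (\<Sum>g\<in>\<Gamma>. free_act g p) - smul (1 / of_nat (card \<Gamma>)) (\<Sum>g\<in>\<Gamma>. p)"
    by (simp add: avg_def)
  also have "\<dots> = smul (1 / of_nat (card \<Gamma>)) (\<Sum>g\<in>\<Gamma>. free_act g p - p)"
    by (simp add: sum_subtractf pm.scale_right_diff_distrib)
  also have "\<dots> \<in> KS"
    using assms by (intro pm.subspace_scale pm.subspace_sum) (auto simp: sym_act_sig sig_eq_iff)
  finally show ?thesis by (simp add: sig_eq_iff)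
qed

lemma presents_sym_invariants: "presents PG sig (sym_invariants scale \<Gamma>)"
proof -
  have "sig ` PG = {P \<in> carrier (sym_alg scale). \<forall>g\<in>\<Gamma>. sym_act g P = P}"
  proof (intro equalityI subsetI)
    fix P assume "P \<in> sig ` PG"
    then show "P \<in> {P \<in> carrier (sym_alg scale). \<forall>g\<in>\<Gamma>. sym_act g P = P}"
      by (auto simp: sym_act_sig PG_def)
  next
    fix P assume P: "P \<in> {P \<in> carrier (sym_alg scale). \<forall>g\<in>\<Gamma>. sym_act g P = P}"
    then obtain p where p: "P = sig p" by (auto elim: S.carrierE)
    then have "P = sig (avg p)" using sig_avg P by auto
    then show "P \<in> sig ` PG" using avg_PG by auto
  qed
  then show ?thesis
    unfolding presents_def sym_invariants_def using subalg_PG S.f_hom by simp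
qed

lemma sym_invariants_component_eq: "sym_invariants_component scale \<Gamma> n = sig ` {p \<in> PG. hcomp n p = p}"
proof -
  have pow: "sym_power scale n = sig ` {p. hcomp n p = p}"
    by (auto simp: sym_power_def tensor_power_def sig_def tens_def tensor_ideal_eq hcomp_fixed_iff)
  have car: "carrier (sym_invariants scale \<Gamma>) = {P \<in> carrier (sym_alg scale). \<forall>g\<in>\<Gamma>. sym_act g P = P}"
    by (simp add: sym_invariants_def)
  show ?thesis
    unfolding sym_invariants_component_def pow
  proof (intro equalityI subsetI)
    fix P assume P: "P \<in> carrier (sym_invariants scale \<Gamma>) \<inter> sig ` {p. hcomp n p = p}"
    then obtain p where p: "P = sig p" "hcomp n p = p" by auto
    then have "P = sig (avg p)" using sig_avg P car by auto
    moreover have "hcomp n (avg p) = avg p" using p by (simp add: hcomp_avg)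
    ultimately show "P \<in> sig ` {p \<in> PG. hcomp n p = p}" using avg_PG by auto
  next
    fix P assume "P \<in> sig ` {p \<in> PG. hcomp n p = p}"
    then show "P \<in> carrier (sym_invariants scale \<Gamma>) \<inter> sig ` {p. hcomp n p = p}"
      using presents_sym_invariants by (auto simp: presents_def)
  qed
qed

section \<open>Noether's bound\<close>

definition orbit_sum where "orbit_sum w = (\<Sum>h\<in>\<Gamma>. mon (map h w))"

lemma orbit_sum_eq: "orbit_sum w = smul (of_nat (card \<Gamma>)) (avg (mon w))"
  using card_\<Gamma> by (simp add: orbit_sum_def avg_def)

text \<open>Modulo \<open>KS\<close>, this is the degree-d part of the ideal generated by orbit sums
  of nonempty words of length at most |\<Gamma>|. Nonemptiness makes the cofactor shorter, which
  drives the later induction.\<close>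

definition bounded_part where "bounded_part d = pm.span (KS \<union>
   {orbit_sum w * mon r | w r. w \<noteq> [] \<and> length w \<le> card \<Gamma> \<and> length w + length r = d})"

lemma subspace_bounded_part [simp]: "pm.subspace (bounded_part d)" by (simp add: bounded_part_def)

lemma KS_bounded_part: "p \<in> KS \<Longrightarrow> p \<in> bounded_part d"
  unfolding bounded_part_def by (rule pm.span_base) simp

text \<open>
  Benson's argument: for every \<open>h\<close> one of the factors \<open>h (g a\<^sub>g) - a\<^sub>g\<close>, \<open>g \<in> \<Gamma>\<close>, vanishes. Summing
  the expanded product over \<open>h\<close> expresses the product of all \<open>a\<^sub>g\<close> through orbit sums of nonempty words.
\<close>

definition benson :: "(('v \<Rightarrow> 'v) \<times> 'v) list \<Rightarrow> 'v list \<Rightarrow> 'v list \<Rightarrow> ('v list \<Rightarrow>\<^sub>0 complex)"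
  where "benson l w r = (\<Sum>h\<in>\<Gamma>. prod_list (map (\<lambda>(g, a). mon [h (g a)] - mon [a]) l)
    * mon (map h w) * mon r)"

text \<open>Expanding the first factor appends g a to the word moved by h, or puts a in front of the
  fixed word; reordering the letters costs only elements of \<open>KS\<close>.\<close>

lemma benson_Cons: "benson ((g, a) # l) w r - (benson l (w @ [g a]) r - benson l w (a # r)) \<in> KS"
proof -
  define Q where "Q h = prod_list (map (\<lambda>(g, a). mon [h (g a)] - mon [a]) l)
    * mon (map h w)" for h :: "'v \<Rightarrow> 'v"
  define X where "X v = mon [v]" for v :: 'v
  define R where "R = mon r"
  have 1: "benson ((g, a) # l) w r = (\<Sum>h\<in>\<Gamma>. (X (h (g a)) - X a) * Q h * R)"
    unfolding benson_def Q_def X_def R_def by (simp add: mult.assoc)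
  have "mon (map h (w @ [g a])) = mon (map h w) * X (h (g a))" for h
    by (simp add: X_def mult_single plus_list_def)
  then have 2: "benson l (w @ [g a]) r = (\<Sum>h\<in>\<Gamma>. Q h * X (h (g a)) * R)"
    unfolding benson_def Q_def R_def by (simp add: mult.assoc)
  have "mon (a # r) = X a * R" by (simp add: X_def R_def mult_single plus_list_def)
  then have 3: "benson l w (a # r) = (\<Sum>h\<in>\<Gamma>. Q h * X a * R)"
    unfolding benson_def Q_def by (simp add: mult.assoc)
  have "benson ((g, a) # l) w r - (benson l (w @ [g a]) r - benson l w (a # r)) =
     (\<Sum>h\<in>\<Gamma>. (X (h (g a)) * Q h - Q h * X (h (g a))) * R - (X a * Q h - Q h * X a) * R)"
    unfolding 1 2 3 by (simp add: sum_subtractf left_diff_distrib)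
  also have "\<dots> \<in> KS"
    by (intro pm.subspace_sum pm.subspace_diff subspace_KS KS_mult(1) KS_commute)
  finally show ?thesis .
qed

text \<open>Once the moved word is nonempty, it stays so, and every term of the full expansion is an
  orbit sum times a word.\<close>

lemma benson_bounded:
  assumes "w \<noteq> []" "length w + length l \<le> card \<Gamma>" "length l + length w + length r = d"
  shows "benson l w r \<in> bounded_part d"
  using assms
proof (induction l arbitrary: w r)
  case Nil
  have "benson [] w r = orbit_sum w * mon r"
    by (simp add: benson_def orbit_sum_def sum_distrib_right)
  then show ?case unfolding bounded_part_def using Nil by (intro pm.span_base) auto
next
  case (Cons ga l)
  obtain g a where ga: "ga = (g, a)" by (metis prod.exhaust)
  have "benson l (w @ [g a]) r - benson l w (a # r) \<in> bounded_part d"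
    using Cons by (intro pm.subspace_diff Cons.IH) auto
  from pm.subspace_add[OF subspace_bounded_part KS_bounded_part[OF benson_Cons[of g a l w r]] this]
  show ?case by (simp add: ga)
qed

text \<open>Only the term taking -a from every factor leaves the moved word empty. Up to sign it is
  |\<Gamma>| times the word of all letters, and |\<Gamma>| is invertible. The reversal arises as
  letters are pushed onto the front of \<open>r\<close>.\<close>

lemma benson_iff:
  assumes "length l \<le> card \<Gamma>" "length l + length r = d"
  shows "benson l [] r \<in> bounded_part d \<longleftrightarrow> mon (rev (map snd l) @ r) \<in> bounded_part d"
  using assms
proof (induction l arbitrary: r)
  case Nil
  have "benson [] [] r = (\<Sum>h\<in>\<Gamma>. mon [] * mon r)"
    by (simp add: benson_def)
  also have "\<dots> = smul (of_nat (card \<Gamma>)) (mon r)"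
    by (simp add: mult_single plus_list_def pm.sum_constant_scale del: smul_single sum_constant)
  finally have 1: "benson [] [] r = smul (of_nat (card \<Gamma>)) (mon r)" .
  have 2: "mon r = smul (1 / of_nat (card \<Gamma>)) (benson [] [] r)"
    unfolding 1 using card_\<Gamma> by simp
  show ?case using pm.subspace_scale[OF subspace_bounded_part] 1 2 by (metis append_Nil list.simps(8) rev.simps(1))
next
  case (Cons ga l)
  obtain g a where ga: "ga = (g, a)" by (metis prod.exhaust)
  have 1: "benson l [g a] r \<in> bounded_part d"
    using Cons.prems by (intro benson_bounded) auto
  have 2: "benson (ga # l) [] r - (benson l [g a] r - benson l [] (a # r)) \<in> bounded_part d"
    using KS_bounded_part[OF benson_Cons[of g a l "[]" r]] by (simp add: ga)
  have "benson (ga # l) [] r \<in> bounded_part d \<longleftrightarrow> benson l [] (a # r) \<in> bounded_part d"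
  proof
    assume "benson (ga # l) [] r \<in> bounded_part d"
    then have "(benson (ga # l) [] r - (benson l [g a] r - benson l [] (a # r))) - benson (ga # l) [] r + benson l [g a] r \<in> bounded_part d"
      using 1 2 pm.subspace_add[OF subspace_bounded_part] pm.subspace_diff[OF subspace_bounded_part] by blast
    then show "benson l [] (a # r) \<in> bounded_part d" by simp
  next
    assume "benson l [] (a # r) \<in> bounded_part d"
    then have "(benson (ga # l) [] r - (benson l [g a] r - benson l [] (a # r))) + (benson l [g a] r - benson l [] (a # r)) \<in> bounded_part d"
      using 1 2 pm.subspace_add[OF subspace_bounded_part] pm.subspace_diff[OF subspace_bounded_part] by blast
    then show "benson (ga # l) [] r \<in> bounded_part d" by simp
  qed
  also have "\<dots> \<longleftrightarrow> mon (rev (map snd l) @ a # r) \<in> bounded_part d"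
    using Cons.prems by (intro Cons.IH) auto
  finally show ?case by (simp add: ga)
qed

lemma long_word_bounded:
  assumes "length w \<ge> card \<Gamma>"
  shows "mon w \<in> bounded_part (length w)"
proof -
  obtain gs where gs: "set gs = \<Gamma>" "distinct gs" using finite_distinct_list[OF fin_\<Gamma>] by blast
  then have len: "length gs = card \<Gamma>" by (metis distinct_card)
  \<comment> \<open>Reversed in advance, because \<open>benson_iff\<close> reverses the
    letters.\<close>
  define l where "l = zip gs (rev (take (card \<Gamma>) w))"
  define r where "r = drop (card \<Gamma>) w"
  have l: "length l = card \<Gamma>" "map snd l = rev (take (card \<Gamma>) w)" "map fst l = gs" using assms len by (auto simp: l_def)
  \<comment> \<open>The factor labelled by the inverse of h is a - a.\<close>
  have "prod_list (map (\<lambda>(g, a). mon [h (g a)] - mon [a]) l) = 0" if "h \<in> \<Gamma>" for h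
  proof (rule prod_list_zero)
    have "inv_into UNIV h \<in> set (map fst l)" unfolding l(3) gs(1) using that by (rule \<Gamma>_inv)
    then obtain a where "(inv_into UNIV h, a) \<in> set l" by auto
    then show "0 \<in> set (map (\<lambda>(g, a). mon [h (g a)] - mon [a]) l)"
      using that by (force simp: image_iff)
  qed
  then have "benson l [] r = 0" unfolding benson_def by simp
  then have "benson l [] r \<in> bounded_part (length w)" by (simp add: pm.subspace_0)
  then show ?thesis
    using benson_iff[of l r "length w"] l assms by (simp add: r_def)
qed

definition inv_gens where "inv_gens = (\<lambda>w. avg (mon w)) ` {w. set w \<subseteq> Bas \<and> length w \<le> card \<Gamma>}"

definition generated where "generated = {p. \<exists>q\<in>alg_gen inv_gens. p - q \<in> KS}"

lemma finite_inv_gens: "finite inv_gens"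
  unfolding inv_gens_def by (intro finite_imageI finite_lists_length_le finite_Basis)

lemma inv_gens_PG: "inv_gens \<subseteq> PG"
  unfolding inv_gens_def using avg_PG by auto

lemma inv_gens_hcomp: "y \<in> inv_gens \<Longrightarrow> \<exists>n. hcomp n y = y"
  unfolding inv_gens_def by (auto simp: hcomp_avg hcomp_single)

lemma subalg_generated: "subalg generated"
  unfolding subalg_def pm.subspace_def
proof (intro conjI ballI allI)
  note A = subalgD[OF subalg_alg_gen[of inv_gens]]
  show "0 \<in> generated" "1 \<in> generated"
    using A(2,3) pm.subspace_0[OF subspace_KS] by (auto simp: generated_def intro: bexI[of _ 0] bexI[of _ 1])
  fix p p' assume "p \<in> generated" "p' \<in> generated"
  then obtain q q' where q: "q \<in> alg_gen inv_gens" "p - q \<in> KS" "q' \<in> alg_gen inv_gens" "p' - q' \<in> KS"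
    by (auto simp: generated_def)
  have "(p - q) + (p' - q') \<in> KS" using q by (intro pm.subspace_add) auto
  then show "p + p' \<in> generated" using A(4) q by (auto simp: generated_def algebra_simps intro!: bexI[of _ "q + q'"])
  have "(p - q) * p' + q * (p' - q') \<in> KS" using q KS_mult by (intro pm.subspace_add) auto
  then show "p * p' \<in> generated" using A(6) q by (auto simp: generated_def algebra_simps intro!: bexI[of _ "q * q'"])
next
  note A = subalgD[OF subalg_alg_gen[of inv_gens]]
  fix a p assume "p \<in> generated"
  then obtain q where q: "q \<in> alg_gen inv_gens" "p - q \<in> KS" by (auto simp: generated_def)
  have "smul a (p - q) \<in> KS" using q by (intro pm.subspace_scale) auto
  then show "smul a p \<in> generated" using A(7) q by (auto simp: generated_def pm.scale_right_diff_distrib intro!: bexI[of _ "smul a q"])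
qed

lemma KS_generated: "p \<in> KS \<Longrightarrow> p \<in> generated"
  using alg_gen_zero by (auto simp: generated_def intro!: bexI[of _ 0])

lemma tens_gens_word:
  "mon (u @ (x + y) # v) - mon (u @ x # v) - mon (u @ y # v) \<in> KT"
  "mon (u @ scale a x # v) - smul a (mon (u @ x # v)) \<in> KT"
proof -
  have "mon u * r * mon v \<in> KT" if "r \<in> tens_gens" for r
    unfolding KT_def using that by (intro ideal_span_mult_left ideal_span_mult_right ideal_span_base subalg_UNIV) auto
  from this[of "mon [x + y] - mon [x] - mon [y]"]
    this[of "mon [scale a x] - single [x] a"]
  show "mon (u @ (x + y) # v) - mon (u @ x # v) - mon (u @ y # v) \<in> KT"
  "mon (u @ scale a x # v) - smul a (mon (u @ x # v)) \<in> KT"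
    by (auto simp: tens_gens_def left_diff_distrib right_diff_distrib mult_single plus_list_def)
qed

text \<open>Short words reduce multilinearly to the finitely many basis words. A long word becomes a
  combination of orbit sums times words; averaging is linear over invariants, so averages of shorter
  words remain.\<close>

lemma avg_word_generated: "avg (mon w) \<in> generated"
proof (induction "length w" arbitrary: w rule: less_induct)
  case less
  note G = subalgD[OF subalg_generated]
  show ?case
  proof (cases "length w \<le> card \<Gamma>")
    case True
    show ?thesis
    proof (rule multilinear_basis_induct[where E = "\<lambda>w. avg (mon w)" and n = "length w"])
      show "avg (mon (u @ (x + y) # v)) - avg (mon (u @ x # v)) - avg (mon (u @ y # v)) \<in> generated" for u x y v
        unfolding avg_diff[symmetric] by (intro KS_generated avg_KS KT_KS[THEN subsetD] tens_gens_word)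
      show "avg (mon (u @ scale a x # v)) - smul a (avg (mon (u @ x # v))) \<in> generated" for u a x v
        unfolding avg_diff[symmetric] avg_smul[symmetric] by (intro KS_generated avg_KS KT_KS[THEN subsetD] tens_gens_word)
      show "avg (mon v) \<in> generated" if "set v \<subseteq> Bas" "length v = length w" for v
      proof -
        have "avg (mon v) \<in> alg_gen inv_gens"
          using that True by (intro alg_gen.base) (auto simp: inv_gens_def)
        then show ?thesis using pm.subspace_0[OF subspace_KS] by (auto simp: generated_def intro!: bexI)
      qed
    qed (use G in auto)
  next
    case False
    have "bounded_part (length w) \<subseteq> {p. avg p \<in> generated}"
      unfolding bounded_part_def
    proof (rule pm.span_minimal[OF _ subspace_avg[OF G(1)]], safe)
      fix p assume "p \<in> KS" then show "avg p \<in> generated" by (intro KS_generated avg_KS)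
    next
      fix v r :: "'v list" assume v: "v \<noteq> []" "length v \<le> card \<Gamma>" "length v + length r = length w"
      have 1: "orbit_sum v \<in> PG" unfolding orbit_sum_eq using avg_PG subalgD[OF subalg_PG] by auto
      have "0 < length v" using v(1) by simp
      \<comment> \<open>The first drop comes from |v| being at most |\<Gamma>|, which is less than
        |w|; the second from v being nonempty.\<close>
      then have "length v < length w" "length r < length w" using v False by linarith+
      then have "avg (mon v) \<in> generated" "avg (mon r) \<in> generated"
        using less by blast+
      then show "avg (orbit_sum v * mon r) \<in> generated"
        unfolding avg_mult_PG[OF 1] unfolding orbit_sum_eq by (intro G(6,7))
    qed
    then show ?thesis using long_word_bounded[of w] False by auto
  qed
qed

lemma PG_generated:
  assumes "p \<in> PG"
  shows "\<exists>q\<in>alg_gen inv_gens. p - q \<in> KS"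
proof -
  have "avg p \<in> generated"
  proof (induction p rule: poly_mapping_linear_induct)
    case subspace then show ?case by (rule subspace_avg[OF subalgD(1)[OF subalg_generated]])
  qed (rule avg_word_generated)
  then show ?thesis using avg_of_PG[OF assms] by (simp add: generated_def)
qed

end

section \<open>The symplectic reflection algebra and its spherical subalgebra\<close>

definition coef :: "('v \<Rightarrow> 'v) \<Rightarrow> ('v sw \<Rightarrow>\<^sub>0 complex) \<Rightarrow> ('v list \<Rightarrow>\<^sub>0 complex)"
  where "coef g = lin_ext (\<lambda>k. if sw_map k = g then mon (sw_word k) else 0)"

definition emb :: "('v list \<Rightarrow>\<^sub>0 complex) \<Rightarrow> ('v sw \<Rightarrow>\<^sub>0 complex)"
  where "emb = lin_ext (\<lambda>w. wd w id)"

lemma coef_add: "coef g (x + y) = coef g x + coef g y"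
  and coef_diff: "coef g (x - y) = coef g x - coef g y"
  and coef_smul: "coef g (smul a x) = smul a (coef g x)"
  and coef_sum: "coef g (\<Sum>i\<in>X. f i) = (\<Sum>i\<in>X. coef g (f i))"
  and coef_zero [simp]: "coef g 0 = 0"
  by (simp_all add: coef_def lin_ext_add lin_ext_diff lin_ext_smul lin_ext_sum)

lemma coef_wd: "coef g (wd u h) = (if h = g then mon u else 0)"
  by (simp add: coef_def wd_def)

lemma emb_add: "emb (x + y) = emb x + emb y"
  and emb_diff: "emb (x - y) = emb x - emb y"
  and emb_smul: "emb (smul a x) = smul a (emb x)"
  and emb_sum: "emb (\<Sum>i\<in>X. f i) = (\<Sum>i\<in>X. emb (f i))"
  and emb_zero [simp]: "emb 0 = 0"
  by (simp_all add: emb_def lin_ext_add lin_ext_diff lin_ext_smul lin_ext_sum)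

lemma emb_single: "emb (single w a) = smul a (wd w id)"
  by (simp add: emb_def)

lemma emb_mult: "emb (p * q) = emb p * emb q"
  unfolding emb_def by (rule lin_ext_mult) (simp add: plus_list_def)

lemma emb_one [simp]: "emb 1 = 1"
  using emb_single[of "[]" 1] by simp

lemma coef_emb_wd: "coef h (emb p * wd [] g) = (if g = h then p else 0)"
proof (induction p rule: poly_mapping_linear_induct)
  case subspace
  then show ?case by (auto simp: pm.subspace_def emb_add emb_smul coef_add coef_smul ring_distribs)
qed (simp add: emb_single coef_wd)

lemma subspace_emb: "pm.subspace W \<Longrightarrow> pm.subspace {p. emb p \<in> W}"
  unfolding emb_def by (rule subspace_lin_ext)

lemma subspace_coef: "pm.subspace W \<Longrightarrow> pm.subspace {p. coef g p \<in> W}"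
  unfolding coef_def by (rule subspace_lin_ext)

lemma coef_in_deg_lt:
  assumes "keys x \<subseteq> {k. length (sw_word k) < n}"
  shows "coef g x \<in> deg_lt n"
  using poly_mapping_in_span[OF assms]
proof (induction rule: pm.span_induct)
  case (step x)
  then show ?case by (auto simp: coef_def deg_lt_def split: if_splits)
qed (rule subspace_coef[OF subspace_deg_lt])

context sra_data
begin

lemma coef_FQ: "x \<in> FQ n \<Longrightarrow> coef g x \<in> deg_lt n"
  by (rule coef_in_deg_lt) (auto simp: FQ_def)

lemma emb_deg_lt:
  assumes "p \<in> deg_lt n"
  shows "emb p \<in> FQ n"
proof -
  have "p \<in> pm.span (mon ` {w. length w < n})"
    using assms by (intro poly_mapping_in_span) (auto simp: deg_lt_def)
  then show ?thesis
  proof (induction rule: pm.span_induct)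
    case (step p) then show ?case by (auto simp: emb_single intro!: wd_FQ)
  qed (rule subspace_emb, simp)
qed

lemma emb_QG: "emb p \<in> QG"
  using emb_deg_lt ex_deg_lt[of p] FQ_QG by blast

lemma subalg_QG: "subalg QG"
  unfolding subalg_def
proof (intro conjI ballI)
  show "1 \<in> QG" using wd_QG[of id "[]"] by simp
  fix x y assume x: "x \<in> QG" and y: "y \<in> QG"
  have 1: "wd u g * y \<in> QG" if "g \<in> \<Gamma>" for u g
    using y unfolding QG_span
  proof (induction rule: pm.span_induct)
    case (step z) then show ?case unfolding QG_span[symmetric] using that by (auto intro!: wd_QG \<Gamma>_comp)
  qed (rule subspace_mult_left, simp)
  show "x * y \<in> QG" using x unfolding QG_span
  proof (induction rule: pm.span_induct)
    case (step z) then show ?case unfolding QG_span[symmetric] using 1 by auto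
  qed (rule subspace_mult_right, simp)
qed simp

lemmas QG = subalgD[OF subalg_QG]

text \<open>This is the formula by which \<open>skew_alg\<close> multiplies coefficient functions,
  so \<open>skA\<close> becomes multiplicative.\<close>

lemma coef_mult:
  assumes "x \<in> QG"
  shows "coef g (x * y) = (\<Sum>k\<in>\<Gamma>. coef k x * free_act k (coef (inv_into UNIV k \<circ> g) y))"
  using assms unfolding QG_span
proof (induction rule: pm.span_induct)
  case base
  then show ?case
    by (auto simp: pm.subspace_def coef_add coef_smul ring_distribs sum.distrib pm.scale_sum_right)
next
  case (step x)
  then obtain u h where x: "x = wd u h" "h \<in> \<Gamma>" by auto
  show ?case
  proof (induction y rule: poly_mapping_linear_induct)
    case subspace
    then show ?case
      by (auto simp: pm.subspace_def coef_add coef_smul free_act_add free_act_smul ring_distribs sum.distrib pm.scale_sum_right)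
  next
    case (single k)
    obtain w l where k: "k = SW w l" by (metis sw.exhaust)
    have iff: "h \<circ> l = g \<longleftrightarrow> l = inv_into UNIV h \<circ> g"
      using inv_comp[OF x(2)] by (auto simp: comp_assoc[symmetric])
    have "(\<Sum>k\<in>\<Gamma>. coef k x * free_act k (coef (inv_into UNIV k \<circ> g) (wd w l)))
      = (\<Sum>k\<in>\<Gamma>. if k = h then mon u * free_act h (coef (inv_into UNIV h \<circ> g) (wd w l)) else 0)"
      by (rule sum.cong) (auto simp: x coef_wd)
    also have "\<dots> = mon u * free_act h (coef (inv_into UNIV h \<circ> g) (wd w l))"
      using x(2) fin_\<Gamma> by simp
    also have "\<dots> = coef g (x * wd w l)"
      using iff by (auto simp: x(1) coef_wd mult_single plus_list_def)
    finally have e: "(\<Sum>k\<in>\<Gamma>. coef k x * free_act k (coef (inv_into UNIV k \<circ> g) (wd w l))) = coef g (x * wd w l)" .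
    show ?case unfolding k using e[symmetric] unfolding wd_def .
  qed
qed

lemma coef_outside: "x \<in> QG \<Longrightarrow> g \<notin> \<Gamma> \<Longrightarrow> coef g x = 0"
  unfolding QG_span
proof (induction rule: pm.span_induct)
  case base
  then show ?case by (auto simp: pm.subspace_def coef_add coef_smul)
qed (auto simp: coef_wd)

lemma QG_decompose: "x \<in> QG \<Longrightarrow> x = (\<Sum>g\<in>\<Gamma>. emb (coef g x) * wd [] g)"
  unfolding QG_span
proof (induction rule: pm.span_induct)
  case base
  then show ?case
    by (auto simp: pm.subspace_def coef_add coef_smul emb_add emb_smul ring_distribs sum.distrib pm.scale_sum_right[symmetric])
next
  case (step x)
  then obtain u h where x: "x = wd u h" "h \<in> \<Gamma>" by auto
  have "(\<Sum>g\<in>\<Gamma>. emb (coef g x) * wd [] g) = (\<Sum>g\<in>\<Gamma>. if g = h then x else 0)"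
    by (rule sum.cong) (auto simp: x coef_wd emb_single)
  then show ?case using x fin_\<Gamma> by simp
qed

definition skA :: "('v sw \<Rightarrow>\<^sub>0 complex) \<Rightarrow> 'v skew" where "skA x = (\<lambda>g. tens (coef g x))"

lemma presents_skew_alg: "presents QG skA (SA)"
  unfolding presents_def
proof (intro conjI ballI allI)
  show "subalg QG" by (rule subalg_QG)
  show "skA 0 = \<zero>\<^bsub>SA\<^esub>" by (simp add: skA_def skew_alg_def Let_def T.f_hom)
  show "skA 1 = \<one>\<^bsub>SA\<^esub>"
    unfolding wd_Nil_id[symmetric] skA_def coef_wd
    by (auto simp: skew_alg_def Let_def zero_list_def fun_eq_iff T.f_hom)
  show "skA ` QG = carrier (SA)"
  proof (intro equalityI subsetI)
    fix f assume "f \<in> skA ` QG"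
    then show "f \<in> carrier (SA)"
      by (auto simp: skew_alg_def Let_def skA_def coef_outside T.f_hom)
  next
    fix f assume f: "f \<in> carrier (SA)"
    then have f1: "\<And>g. g \<in> \<Gamma> \<Longrightarrow> f g \<in> carrier (TA)" and f2: "\<And>g. g \<notin> \<Gamma> \<Longrightarrow> f g = \<zero>\<^bsub>TA\<^esub>"
      by (auto simp: skew_alg_def Let_def)
    have "\<forall>g. \<exists>p. g \<in> \<Gamma> \<longrightarrow> f g = tens p" using f1 T.carrierE by metis
    then obtain p where p: "\<And>g. g \<in> \<Gamma> \<Longrightarrow> f g = tens (p g)" by metis
    define x where "x = (\<Sum>g\<in>\<Gamma>. emb (p g) * wd [] g)"
    have x: "x \<in> QG" unfolding x_def by (intro pm.subspace_sum subspace_QG QG(6) emb_QG wd_QG)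
    have "coef h x = p h" if "h \<in> \<Gamma>" for h
      using that fin_\<Gamma> by (simp add: x_def coef_sum coef_emb_wd)
    then have "skA x g = f g" for g
      using p f2 coef_outside[OF x, of g] by (cases "g \<in> \<Gamma>") (simp_all add: skA_def T.f_hom)
    then have "skA x = f" by (rule ext)
    then show "f \<in> skA ` QG" using x by blast
  qed
  fix x assume x: "x \<in> QG"
  show "skA (smul a x) = a \<odot>\<^bsub>SA\<^esub> skA x" for a
    by (simp add: skA_def skew_alg_def Let_def coef_smul T.f_hom)
  fix y assume y: "y \<in> QG"
  show "skA (x + y) = skA x \<oplus>\<^bsub>SA\<^esub> skA y"
    by (simp add: skA_def skew_alg_def Let_def coef_add T.f_hom)
  show "skA (x * y) = skA x \<otimes>\<^bsub>SA\<^esub> skA y"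
  proof
    fix g
    have "(skA x \<otimes>\<^bsub>SA\<^esub> skA y) g = (\<Oplus>\<^bsub>TA\<^esub>k\<in>\<Gamma>. tens (coef k x * free_act k (coef (inv_into UNIV k \<circ> g) y)))"
      by (simp add: skew_alg_def Let_def skA_def T.f_hom) (rule T.A.finsum_cong'; simp add: tensor_act_tens)
    then show "skA (x * y) g = (skA x \<otimes>\<^bsub>SA\<^esub> skA y) g"
      by (simp add: skA_def coef_mult[OF x] T.f_finsum[OF fin_\<Gamma>])
  qed
qed

sublocale A: presentation QG skA "SA"
  by (rule presentation.intro, rule presents_skew_alg)

section \<open>Kernel and filtration of the symplectic reflection algebra\<close>

definition com_rels where "com_rels = {relB x y | x y. True}"

lemma lin_rels_QG: "lin_rels \<subseteq> QG"
  unfolding lin_rels_def by (auto intro!: QG(5,7) wd_QG)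

lemma kap_QG: "kap x y \<in> QG"
  using kap_FQ FQ_QG by blast

lemma com_rels_QG: "com_rels \<subseteq> QG"
  unfolding com_rels_def relB_def by (auto intro!: QG(5) wd_QG kap_QG)

definition IQ where "IQ = ideal_span QG (lin_rels \<union> com_rels)"

lemma subspace_IQ [simp]: "pm.subspace IQ" by (simp add: IQ_def)

lemma IQ_mult: "x \<in> IQ \<Longrightarrow> a \<in> QG \<Longrightarrow> a * x \<in> IQ" "x \<in> IQ \<Longrightarrow> a \<in> QG \<Longrightarrow> x * a \<in> IQ"
  unfolding IQ_def by (auto intro: ideal_span_mult_left ideal_span_mult_right subalg_QG)

lemma IQ_gens: "r \<in> lin_rels \<union> com_rels \<Longrightarrow> r \<in> IQ"
  unfolding IQ_def by (rule ideal_span_base[OF subalg_QG])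

lemma IQ_QG: "IQ \<subseteq> QG"
  unfolding IQ_def using ideal_span_subset[OF subalg_QG] lin_rels_QG com_rels_QG by blast

text \<open>Links the full ideal of relations to the degree-bounded spaces of the PBW argument: with
  monomial multipliers every generator has a finite degree.\<close>

lemma IQ_iff: "x \<in> IQ \<longleftrightarrow> (\<exists>n. x \<in> I n)"
proof
  have sub: "pm.subspace {x. \<exists>n. x \<in> I n}"
    unfolding pm.subspace_def
  proof (intro conjI ballI allI; simp only: mem_Collect_eq)
    show "\<exists>n. 0 \<in> I n" using pm.subspace_0[OF subspace_I] by blast
    show "\<exists>n. x + y \<in> I n" if "\<exists>n. x \<in> I n" "\<exists>n. y \<in> I n" for x y
    proof -
      from that obtain m n where "x \<in> I m" "y \<in> I n" by blast
      then have "x \<in> I (max m n)" "y \<in> I (max m n)" using I_mono[of m "max m n"] I_mono[of n "max m n"] by auto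
      then show ?thesis using pm.subspace_add[OF subspace_I] by blast
    qed
    show "\<exists>n. smul a x \<in> I n" if "\<exists>n. x \<in> I n" for a x
      using that pm.subspace_scale[OF subspace_I] by blast
  qed
  have "IQ \<subseteq> {x. \<exists>n. x \<in> I n}"
    unfolding IQ_def ideal_span_singles[OF QG_def]
  proof (rule pm.span_minimal[OF _ sub], safe)
    fix u w :: "'v list" and g h r assume gh: "g \<in> \<Gamma>" "h \<in> \<Gamma>"
    show "\<exists>n. mon (SW u g) * r * mon (SW w h) \<in> I n" if "r \<in> lin_rels"
      using I_lin[OF that gh order_refl] unfolding wd_def by blast
    show "\<exists>n. mon (SW u g) * r * mon (SW w h) \<in> I n" if "r \<in> com_rels"
      using that I_com[OF gh order_refl] unfolding wd_def com_rels_def by blast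
  qed
  then show "x \<in> IQ \<Longrightarrow> \<exists>n. x \<in> I n" by blast
  have "I_gens n \<subseteq> IQ" for n
  proof
    fix x assume "x \<in> I_gens n"
    then obtain u r w h where "x = wd u id * r * wd w h" "r \<in> lin_rels \<union> com_rels" "h \<in> \<Gamma>"
      unfolding I_gens_def com_rels_def by blast
    then show "x \<in> IQ" by (simp only:) (intro IQ_mult IQ_gens wd_QG \<Gamma>_id)
  qed
  then show "\<exists>n. x \<in> I n \<Longrightarrow> x \<in> IQ" unfolding I_def using pm.span_minimal[OF _ subspace_IQ] by blast
qed

lemma emb_KT: "p \<in> KT \<Longrightarrow> emb p \<in> IQ"
proof -
  have "emb r \<in> lin_rels" if "r \<in> tens_gens" for r
  proof -
    from that show ?thesis
    proof (cases rule: tens_gensE)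
      case (add x y)
      then have "emb r = wd [x + y] id - wd [x] id - wd [y] id" by (simp add: emb_diff emb_single)
      then show ?thesis using lin_rel_add by simp
    next
      case (scale a x)
      then have "emb r = wd [scale a x] id - smul a (wd [x] id)" by (simp add: emb_diff emb_single)
      then show ?thesis using lin_rel_scale by simp
    qed
  qed
  then have "emb r \<in> IQ" if "r \<in> tens_gens" for r using that IQ_gens by blast
  then have "emb (a * r * b) \<in> IQ" if "r \<in> tens_gens" for a r b
    unfolding emb_mult using that by (intro IQ_mult(2)[OF IQ_mult(1)] emb_QG) blast
  then have "KT \<subseteq> {p. emb p \<in> IQ}"
    unfolding KT_def by (intro ideal_span_minimal subspace_emb) auto
  then show "p \<in> KT \<Longrightarrow> emb p \<in> IQ" by blast
qed

lemma skA_vec: "skA (wd [v] id) = skew_vec scale v"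
  by (auto simp: skA_def skew_vec_def coef_wd tensor_vec_def tens_def[symmetric] tensor_ideal_eq fun_eq_iff T.f_hom)

lemma skA_grp: "skA (wd [] g) = skew_grp scale g"
  by (auto simp: skA_def skew_grp_def coef_wd fun_eq_iff T.f_hom zero_list_def)

lemma sra_ideal_eq: "J = Idl\<^bsub>SA\<^esub> (skA ` com_rels)"
proof -
  define G where "G x y = skew_vec scale x \<otimes>\<^bsub>SA\<^esub> skew_vec scale y
     \<ominus>\<^bsub>SA\<^esub> skew_vec scale y \<otimes>\<^bsub>SA\<^esub> skew_vec scale x
     \<ominus>\<^bsub>SA\<^esub> \<omega> x y \<odot>\<^bsub>SA\<^esub> \<one>\<^bsub>SA\<^esub> \<ominus>\<^bsub>SA\<^esub>
     (\<Oplus>\<^bsub>SA\<^esub>s\<in>refls. (c s * rf s x y) \<odot>\<^bsub>SA\<^esub> skew_grp scale s)" for x y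
  have "skA (relB x y) = G x y" for x y
  proof -
    have v: "wd [z] id \<in> QG" for z by (rule wd_QG) simp
    have g: "wd [] s \<in> QG" if "s \<in> refls" for s using reflsD[OF that] by (rule wd_QG)
    have sum: "(\<Sum>s\<in>refls. smul (c s * rf s x y) (wd [] s)) \<in> QG"
      by (intro pm.subspace_sum subspace_QG QG(7) g)
    have "skA (\<Sum>s\<in>refls. smul (c s * rf s x y) (wd [] s)) =
       (\<Oplus>\<^bsub>SA\<^esub>s\<in>refls. skA (smul (c s * rf s x y) (wd [] s)))"
      by (rule A.f_finsum[OF finite_refls]) (intro QG(7) g)
    also have "\<dots> = (\<Oplus>\<^bsub>SA\<^esub>s\<in>refls. (c s * rf s x y) \<odot>\<^bsub>SA\<^esub> skew_grp scale s)"
      using g by (intro A.A.finsum_cong') (auto simp: A.f_hom(5)[symmetric] QG(7) skA_grp[symmetric])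
    finally have f: "skA (\<Sum>s\<in>refls. smul (c s * rf s x y) (wd [] s)) = \<dots>" .
    have "relB x y = wd [x] id * wd [y] id - wd [y] id * wd [x] id - smul (\<omega> x y) 1 - (\<Sum>s\<in>refls. smul (c s * rf s x y) (wd [] s))"
      by (simp add: relB_def kap_def)
    then show ?thesis
      unfolding G_def f[symmetric] skA_vec[symmetric] using v sum by (simp only: A.f_diff A.f_hom QG)
  qed
  then have "skA ` com_rels = {G x y | x y. True}"
    unfolding com_rels_def by (auto simp: image_iff) metis
  then show ?thesis unfolding sra_ideal_def Let_def G_def by simp
qed

definition quo where "quo x = J +>\<^bsub>SA\<^esub> skA x"

lemma presents_sra: "presents QG quo H"
  using A.quot_presents(1)[OF com_rels_QG] by (simp add: quo_def[abs_def] sra_def sra_ideal_eq)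

sublocale H: presentation QG quo H
  by (rule presentation.intro, rule presents_sra)

lemma skA_zero_iff: "skA x = \<zero>\<^bsub>SA\<^esub> \<longleftrightarrow> (\<forall>g. coef g x \<in> KT)"
  by (simp add: skA_def skew_alg_def Let_def fun_eq_iff tens_zero_iff)

text \<open>The skew algebra already imposes linearity, coefficient by coefficient, and H then
  imposes the commutators. This two-stage kernel is shown to be the single ideal
  \<open>IQ\<close>.\<close>

lemma quo_zero_iff:
  assumes "x \<in> QG"
  shows "quo x = \<zero>\<^bsub>H\<^esub> \<longleftrightarrow> x \<in> IQ"
proof
  have quo0: "quo x = \<zero>\<^bsub>H\<^esub> \<longleftrightarrow> (\<exists>z\<in>ideal_span QG com_rels. \<forall>g. coef g (x - z) \<in> KT)" if "x \<in> QG" for x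
    using A.quot_presents(2)[OF com_rels_QG that] by (simp add: quo_def sra_def sra_ideal_eq skA_zero_iff)
  have com_IQ: "ideal_span QG com_rels \<subseteq> IQ"
    unfolding IQ_def ideal_span_def by (rule pm.span_mono) auto
  show "x \<in> IQ" if "quo x = \<zero>\<^bsub>H\<^esub>"
  proof -
    have "\<exists>z\<in>ideal_span QG com_rels. \<forall>g. coef g (x - z) \<in> KT"
      using quo0[OF assms] that by blast
    then obtain z where z: "z \<in> ideal_span QG com_rels" and "\<forall>g. coef g (x - z) \<in> KT" by blast
    then have zKT: "coef g (x - z) \<in> KT" for g by blast
    have "z \<in> IQ" "z \<in> QG" using z com_IQ IQ_QG by auto
    \<comment> \<open>Reassembling from the coefficients converts membership in \<open>KT\<close>
      into membership in \<open>IQ\<close>.\<close>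
    then have "x - z = (\<Sum>g\<in>\<Gamma>. emb (coef g (x - z)) * wd [] g)" using assms by (intro QG_decompose QG(5))
    also have "\<dots> \<in> IQ" using zKT by (intro pm.subspace_sum subspace_IQ IQ_mult(2) emb_KT wd_QG)
    finally have "(x - z) + z \<in> IQ" using \<open>z \<in> IQ\<close> by (intro pm.subspace_add subspace_IQ)
    then show ?thesis by simp
  qed
  have lin: "quo r = \<zero>\<^bsub>H\<^esub>" if "r \<in> lin_rels" for r
  proof -
    have "coef g r \<in> tens_gens \<union> {0}" for g
    proof (cases "g = id")
      case True
      from that show ?thesis
      proof (cases rule: lin_relsE)
        case (add x y)
        then have "coef g r = mon [x + y] - mon [x] - mon [y]"
          by (simp add: coef_diff coef_wd True)
        then show ?thesis unfolding tens_gens_def by blast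
      next
        case (scale a x)
        then have "coef g r = mon [scale a x] - single [x] a"
          by (simp add: coef_diff coef_smul coef_wd True)
        then show ?thesis unfolding tens_gens_def by blast
      qed
    qed (use that in \<open>auto simp: lin_rels_def coef_diff coef_smul coef_wd\<close>)
    moreover have "tens_gens \<union> {0} \<subseteq> KT"
      using pm.subspace_0[OF subspace_KT] by (auto simp: KT_def intro: ideal_span_base[OF subalg_UNIV])
    ultimately have "coef g r \<in> KT" for g by blast
    then have "\<exists>z\<in>ideal_span QG com_rels. \<forall>g. coef g (r - z) \<in> KT"
      using pm.subspace_0[OF subspace_ideal_span] by (intro bexI[of _ 0]) simp_all
    then show ?thesis using quo0 that lin_rels_QG by blast
  qed
  have com: "quo r = \<zero>\<^bsub>H\<^esub>" if "r \<in> com_rels" for r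
  proof -
    have "\<exists>z\<in>ideal_span QG com_rels. \<forall>g. coef g (r - z) \<in> KT"
      using ideal_span_base[OF subalg_QG that] pm.subspace_0[OF subspace_KT] by (intro bexI[of _ r]) simp_all
    then show ?thesis using quo0 that com_rels_QG by blast
  qed
  have "IQ \<subseteq> {x \<in> QG. quo x = \<zero>\<^bsub>H\<^esub>}"
    unfolding IQ_def
  proof (rule ideal_span_minimal)
    have "a \<odot>\<^bsub>H\<^esub> \<zero>\<^bsub>H\<^esub> = \<zero>\<^bsub>H\<^esub>" for a
      using H.f_hom(5)[OF QG(2), of a] by (simp add: H.f_hom(1))
    then show "pm.subspace {x \<in> QG. quo x = \<zero>\<^bsub>H\<^esub>}"
      using QG(2,4,7) by (simp add: pm.subspace_def H.f_hom)
    fix a r b assume a: "a \<in> QG" "b \<in> QG" "r \<in> lin_rels \<union> com_rels"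
    then have "r \<in> QG" "quo r = \<zero>\<^bsub>H\<^esub>" using lin com lin_rels_QG com_rels_QG by auto
    then show "a * r * b \<in> {x \<in> QG. quo x = \<zero>\<^bsub>H\<^esub>}" using a by (auto simp: H.f_hom QG)
  qed
  then show "x \<in> IQ \<Longrightarrow> quo x = \<zero>\<^bsub>H\<^esub>" by blast
qed

lemma quo_eq_iff: "x \<in> QG \<Longrightarrow> y \<in> QG \<Longrightarrow> quo x = quo y \<longleftrightarrow> x - y \<in> IQ"
  by (simp add: H.f_eq_iff quo_zero_iff QG)

lemma sra_grp_eq: "sra_grp scale \<omega> \<Gamma> c g = quo (wd [] g)"
  by (simp add: sra_grp_def quo_def skA_grp)

lemma sra_vec_eq: "sra_vec scale \<omega> \<Gamma> c v = quo (wd [v] id)"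
  by (simp add: sra_vec_def quo_def skA_vec)

lemma FQ_mult_span: "pm.span {x * y | x y. x \<in> FQ (Suc n) \<and> y \<in> FQ (Suc (Suc 0))} = FQ (Suc (Suc n))"
proof
  show "pm.span {x * y | x y. x \<in> FQ (Suc n) \<and> y \<in> FQ (Suc (Suc 0))} \<subseteq> FQ (Suc (Suc n))"
    using FQ_mult[of _ n _ "Suc (Suc 0)"] by (intro pm.span_minimal) auto
  show "FQ (Suc (Suc n)) \<subseteq> pm.span {x * y | x y. x \<in> FQ (Suc n) \<and> y \<in> FQ (Suc (Suc 0))}"
    unfolding FQ_span[of "Suc (Suc n)"]
  proof (rule pm.span_minimal, safe)
    fix u :: "'v list" and g assume g: "g \<in> \<Gamma>" "length u < Suc (Suc n)"
    have mem: "x * y \<in> pm.span {x * y | x y. x \<in> FQ (Suc n) \<and> y \<in> FQ (Suc (Suc 0))}"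
      if "x \<in> FQ (Suc n)" "y \<in> FQ (Suc (Suc 0))" for x y
      by (rule pm.span_base, rule CollectI, intro exI conjI, rule refl, rule that, rule that)
    show "wd u g \<in> pm.span {x * y | x y. x \<in> FQ (Suc n) \<and> y \<in> FQ (Suc (Suc 0))}"
    proof (cases u rule: rev_exhaust)
      case Nil
      then have e: "wd u g = wd [] id * wd [] g" by (simp del: wd_Nil_id)
      show ?thesis unfolding e by (rule mem; rule wd_FQ) (use g in simp_all)
    next
      case (snoc w v)
      then have e: "wd u g = wd w id * wd [v] g" "length w < Suc n" using g by simp_all
      show ?thesis unfolding e(1) by (rule mem; rule wd_FQ) (use g e(2) in simp_all)
    qed
  qed
qed

text \<open>The product g v equals (g v) g, and every letter has the form g v, so all words of
  length one arise; each further power adds one last letter. Degree 0 is separate because the zeroth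
  power contains only scalars.\<close>

lemma sra_filtration_eq: "sra_filtration scale \<omega> \<Gamma> c n = quo ` FQ (Suc n)"
proof -
  define W where "W = lin_span H (sra_grp scale \<omega> \<Gamma> c ` \<Gamma>)"
  define X where "X = lin_span H {sra_grp scale \<omega> \<Gamma> c g \<otimes>\<^bsub>H\<^esub> sra_vec scale \<omega> \<Gamma> c v | g v. g \<in> \<Gamma>}"
  let ?A = "{wd [] g | g. g \<in> \<Gamma>}" and ?B = "{wd [g v] g | g v. g \<in> \<Gamma>}"
  have AB: "?A \<subseteq> QG" "?B \<subseteq> QG" by (auto intro: wd_QG)
  have "{wd u g | u g. g \<in> \<Gamma> \<and> length u < Suc 0} = ?A" by auto
  then have A: "pm.span ?A = FQ (Suc 0)" by (simp add: FQ_span)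
  have "wd u g \<in> ?A \<union> ?B" if "g \<in> \<Gamma>" "length u < Suc (Suc 0)" for u g
  proof (cases u)
    case (Cons v w)
    \<comment> \<open>Writes the letter as a value of g, to match the shape of
      \<open>?B\<close>.\<close>
    then have "wd u g = wd [g (inv_into UNIV g v)] g" using that by simp
    then show ?thesis using that by blast
  qed (use that in auto)
  moreover have "z \<in> {wd u g | u g. g \<in> \<Gamma> \<and> length u < Suc (Suc 0)}" if "z \<in> ?A \<union> ?B" for z
  proof -
    from that obtain u g where "z = wd u g" "g \<in> \<Gamma>" "u = [] \<or> (\<exists>v. u = [v])" by blast
    then show ?thesis by (intro CollectI exI[of _ u] exI[of _ g]) auto
  qed
  ultimately have "{wd u g | u g. g \<in> \<Gamma> \<and> length u < Suc (Suc 0)} = ?A \<union> ?B" by blast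
  then have B: "pm.span (?A \<union> ?B) = FQ (Suc (Suc 0))" by (simp add: FQ_span)
  have "sra_grp scale \<omega> \<Gamma> c ` \<Gamma> = quo ` ?A" by (auto simp: sra_grp_eq)
  then have W: "W = quo ` pm.span ?A" unfolding W_def using H.lin_span_image[OF AB(1)] by simp
  have "quo (wd [] g) \<otimes>\<^bsub>H\<^esub> quo (wd [v] id) = quo (wd [g v] g)" if "g \<in> \<Gamma>" for g v
    using that by (subst H.f_hom(4)[symmetric]) (auto intro!: wd_QG)
  then have "{sra_grp scale \<omega> \<Gamma> c g \<otimes>\<^bsub>H\<^esub> sra_vec scale \<omega> \<Gamma> c v | g v. g \<in> \<Gamma>} = quo ` ?B"
    by (auto simp: sra_grp_eq sra_vec_eq image_iff) blast+
  then have X: "X = quo ` pm.span ?B" unfolding X_def using H.lin_span_image[OF AB(2)] by simp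
  have sp: "pm.span ?A \<subseteq> QG" "pm.span ?B \<subseteq> QG" using H.span_subset_R AB by auto
  have "W <+>\<^bsub>H\<^esub> X = quo ` {x + y | x y. x \<in> pm.span ?A \<and> y \<in> pm.span ?B}"
    unfolding W X set_add_def' using sp by (force simp: H.f_hom(3) subset_iff image_iff)
  also have "{x + y | x y. x \<in> pm.span ?A \<and> y \<in> pm.span ?B} = FQ (Suc (Suc 0))"
    unfolding B[symmetric] by (rule pm.span_Un[symmetric])
  finally have WX: "W <+>\<^bsub>H\<^esub> X = quo ` FQ (Suc (Suc 0))" .
  have pow: "subspace_power H (quo ` FQ (Suc (Suc 0))) (Suc n) = quo ` FQ (Suc (Suc n))" for n
  proof (induction n)
    case 0
    have one: "{1} \<subseteq> QG" using QG(3) by simp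
    have "lin_span H {\<one>\<^bsub>H\<^esub>} = quo ` pm.span {1}" using H.lin_span_image[OF one] by (simp add: H.f_hom)
    then have "subspace_power H (quo ` FQ (Suc (Suc 0))) (Suc 0) = quo ` pm.span {x * y | x y. x \<in> pm.span {1} \<and> y \<in> FQ (Suc (Suc 0))}"
      using H.subspace_mult_image[OF H.span_subset_R[OF one] FQ_QG] by simp
    also have "{x * y | x y. x \<in> pm.span {1} \<and> y \<in> FQ (Suc (Suc 0))} = FQ (Suc (Suc 0))"
    proof (intro equalityI subsetI)
      fix z assume "z \<in> {x * y | x y. x \<in> pm.span {1} \<and> y \<in> FQ (Suc (Suc 0))}"
      then show "z \<in> FQ (Suc (Suc 0))" by (auto simp: pm.span_singleton intro: pm.subspace_scale[OF subspace_FQ])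
    next
      fix z assume "z \<in> FQ (Suc (Suc 0))"
      then show "z \<in> {x * y | x y. x \<in> pm.span {1} \<and> y \<in> FQ (Suc (Suc 0))}"
        using pm.span_base[of 1 "{1}"] by (intro CollectI exI[of _ 1] exI[of _ z]) auto
    qed
    finally show ?case by (simp only: pm.span_eq_iff[THEN iffD2, OF subspace_FQ])
  next
    case (Suc n)
    then show ?case
      using H.subspace_mult_image[OF FQ_QG FQ_QG, of "Suc (Suc n)" "Suc (Suc 0)"] FQ_mult_span[of "Suc n"] by simp
  qed
  have "sra_filtration scale \<omega> \<Gamma> c n = (if n = 0 then W else subspace_power H (W <+>\<^bsub>H\<^esub> X) n)"
    unfolding sra_filtration_def Let_def W_def X_def ..
  also have "\<dots> = quo ` FQ (Suc n)"
    unfolding WX using W A pow[of "n - 1"] by (cases n) (auto simp del: subspace_power.simps)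
  finally show ?thesis .
qed

section \<open>The idempotent and the spherical subalgebra\<close>

definition eQ where "eQ = smul (1 / of_nat (card \<Gamma>)) (\<Sum>g\<in>\<Gamma>. wd [] g)"

lemma eQ_FQ: "eQ \<in> FQ (Suc 0)"
  unfolding eQ_def by (intro pm.subspace_scale pm.subspace_sum subspace_FQ wd_FQ) simp_all

lemma eQ_QG: "eQ \<in> QG"
  using eQ_FQ FQ_QG by blast

lemma wd_eQ: "g \<in> \<Gamma> \<Longrightarrow> wd u g * eQ = wd u id * eQ"
  using sum.reindex_bij_betw[OF bij_comp_left, of g "\<lambda>h. wd u h"]
  by (simp add: eQ_def sum_distrib_left)

text \<open>Forgets the group element and averages the word; \<open>sandwich\<close> shows that this
  is the invariant describing e x e.\<close>

definition flat :: "('v sw \<Rightarrow>\<^sub>0 complex) \<Rightarrow> ('v list \<Rightarrow>\<^sub>0 complex)"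
  where "flat = lin_ext (\<lambda>k. avg (mon (sw_word k)))"

lemma flat_wd: "flat (wd u g) = avg (mon u)"
  by (simp add: flat_def wd_def)

lemma flat_add: "flat (x + y) = flat x + flat y" and flat_smul: "flat (smul a x) = smul a (flat x)"
  by (simp_all add: flat_def lin_ext_add lin_ext_smul)

lemma flat_PG: "flat x \<in> PG"
  unfolding flat_def lin_ext_def by (intro pm.subspace_sum pm.subspace_scale subalgD(1)[OF subalg_PG] avg_PG)

lemma avg_deg_lt: "p \<in> deg_lt n \<Longrightarrow> avg p \<in> deg_lt n"
  by (simp add: deg_lt_iff_hcomp hcomp_avg) (simp add: avg_def)

lemma flat_deg_lt: "x \<in> FQ n \<Longrightarrow> flat x \<in> deg_lt n"
  unfolding FQ_span
proof (induction rule: pm.span_induct)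
  case base then show ?case unfolding flat_def by (rule subspace_lin_ext[OF subspace_deg_lt])
next
  case (step x)
  then obtain u g where "x = wd u g" "length u < n" by auto
  then show ?case using avg_deg_lt[of "mon u" n] by (simp add: flat_wd deg_lt_def)
qed

lemma flat_emb: "flat (emb p) = avg p"
proof (induction p rule: poly_mapping_linear_induct)
  case subspace
  then show ?case by (auto simp: pm.subspace_def emb_add emb_smul flat_add flat_smul avg_add avg_smul)
     (simp add: flat_def avg_def)
qed (simp add: emb_single flat_wd)

text \<open>The right idempotent absorbs g. The left one produces the translates of u followed by h,
  and each h is absorbed in turn, so the average of u remains.\<close>

lemma sandwich: "x \<in> QG \<Longrightarrow> eQ * x * eQ = emb (flat x) * eQ"
  unfolding QG_span
proof (induction rule: pm.span_induct)
  case base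
  then show ?case by (auto simp: pm.subspace_def flat_add flat_smul emb_add emb_smul ring_distribs) (simp add: flat_def)
next
  case (step x)
  then obtain u g where x: "x = wd u g" "g \<in> \<Gamma>" by auto
  have "eQ * x * eQ = eQ * (wd u id * eQ)"
    by (simp add: x(1) mult.assoc wd_eQ[OF x(2)])
  also have "\<dots> = smul (1 / of_nat (card \<Gamma>)) (\<Sum>h\<in>\<Gamma>. wd (map h u) h * eQ)"
  proof -
    have "eQ * wd u id = smul (1 / of_nat (card \<Gamma>)) (\<Sum>h\<in>\<Gamma>. wd (map h u) h)"
      by (simp add: eQ_def sum_distrib_right)
    then show ?thesis by (simp only: mult.assoc[symmetric] smul_mult_left sum_distrib_right)
  qed
  also have "\<dots> = smul (1 / of_nat (card \<Gamma>)) (\<Sum>h\<in>\<Gamma>. wd (map h u) id * eQ)"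
    by (intro arg_cong[where f = "smul _"] sum.cong refl wd_eQ)
  also have "\<dots> = emb (flat x) * eQ"
    by (simp add: x(1) flat_wd avg_def emb_smul emb_sum emb_single sum_distrib_right)
  finally show ?case .
qed

lemma eQ_idem: "eQ * eQ = eQ"
proof -
  have "flat 1 = 1"
    using flat_emb[of 1] avg_of_PG subalgD(3)[OF subalg_PG] by simp
  then show ?thesis using sandwich[OF QG(3)] by simp
qed

lemma sandwich_PG: "p \<in> PG \<Longrightarrow> eQ * emb p * eQ = emb p * eQ"
  by (simp add: sandwich[OF emb_QG] flat_emb avg_of_PG)

definition rho where "rho p = quo (emb p * eQ)"

lemma emb_eQ_QG: "emb p * eQ \<in> QG"
  by (intro QG(6) emb_QG eQ_QG)

lemma sra_idem_eq: "sra_idem scale \<omega> \<Gamma> c = quo eQ"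
proof -
  have "(\<Oplus>\<^bsub>H\<^esub>g\<in>\<Gamma>. quo (wd [] g)) = quo (\<Sum>g\<in>\<Gamma>. wd [] g)"
    by (rule H.f_finsum[OF fin_\<Gamma>, symmetric]) (rule wd_QG)
  moreover have "(\<Sum>g\<in>\<Gamma>. wd [] g) \<in> QG" by (intro pm.subspace_sum subspace_QG wd_QG)
  ultimately show ?thesis
    by (simp add: sra_idem_def Let_def sra_grp_eq eQ_def H.f_hom)
qed

lemma spherical_carrier: "carrier U = quo ` {eQ * x * eQ | x. x \<in> QG}"
proof -
  have "quo eQ \<otimes>\<^bsub>H\<^esub> quo x \<otimes>\<^bsub>H\<^esub> quo eQ = quo (eQ * x * eQ)" if "x \<in> QG" for x
    using that eQ_QG by (simp add: H.f_hom QG)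
  then show ?thesis
    unfolding spherical_def Let_def sra_idem_eq H.f_carrier[symmetric] by (auto simp: image_iff)
qed

lemma presents_spherical: "presents PG rho U"
  unfolding presents_def
proof (intro conjI ballI allI)
  show "subalg PG" by (rule subalg_PG)
  show "rho 0 = \<zero>\<^bsub>U\<^esub>" "rho 1 = \<one>\<^bsub>U\<^esub>"
    by (simp_all add: rho_def spherical_def Let_def sra_idem_eq H.f_hom)
  show "rho ` PG = carrier U"
  proof (intro equalityI subsetI)
    fix u assume "u \<in> rho ` PG"
    then obtain p where "p \<in> PG" "u = quo (eQ * emb p * eQ)" by (auto simp: rho_def sandwich_PG)
    then show "u \<in> carrier U" using emb_QG unfolding spherical_carrier by blast
  next
    fix u assume "u \<in> carrier U"
    then obtain x where "x \<in> QG" "u = quo (eQ * x * eQ)" unfolding spherical_carrier by blast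
    then have "u = rho (flat x)" by (simp add: rho_def sandwich)
    then show "u \<in> rho ` PG" using flat_PG by blast
  qed
  fix p assume p: "p \<in> PG"
  show "rho (smul a p) = a \<odot>\<^bsub>U\<^esub> rho p" for a
    by (simp add: rho_def spherical_def Let_def emb_smul H.f_hom emb_eQ_QG)
  fix q assume q: "q \<in> PG"
  show "rho (p + q) = rho p \<oplus>\<^bsub>U\<^esub> rho q"
    by (simp add: rho_def spherical_def Let_def emb_add ring_distribs H.f_hom emb_eQ_QG)
  \<comment> \<open>An invariant q satisfies e q e = q e, so the idempotent between p and q may be
    inserted; hence multiplicativity.\<close>
  have "emb (p * q) * eQ = (emb p * eQ) * (emb q * eQ)"
    using sandwich_PG[OF q] by (simp add: emb_mult mult.assoc)
  then show "rho (p * q) = rho p \<otimes>\<^bsub>U\<^esub> rho q"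
    by (simp add: rho_def spherical_def Let_def H.f_hom(4)[symmetric] emb_eQ_QG)
qed

text \<open>An element u of the spherical subalgebra equals e u e. For a low-degree lift y of u,
  \<open>flat y\<close> is then an invariant lift with the same degree bound.\<close>

lemma spherical_filtration_eq: "UF n = rho ` (PG \<inter> deg_lt (Suc n))"
proof (intro equalityI subsetI)
  fix u assume "u \<in> rho ` (PG \<inter> deg_lt (Suc n))"
  then obtain p where p: "p \<in> PG" "p \<in> deg_lt (Suc n)" "u = rho p" by blast
  have "emb p * eQ \<in> FQ (Suc n)" using FQ_mult[OF emb_deg_lt[OF p(2)] eQ_FQ] by simp
  moreover have "u \<in> carrier U" using presents_spherical p by (auto simp: presents_def)
  ultimately show "u \<in> UF n"
    using p by (auto simp: spherical_filtration_def sra_filtration_eq rho_def)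
next
  fix u assume "u \<in> UF n"
  then obtain x y where x: "x \<in> QG" "u = quo (eQ * x * eQ)" and y: "y \<in> FQ (Suc n)" "u = quo y"
    by (auto simp: spherical_filtration_def sra_filtration_eq spherical_carrier)
  have yQ: "y \<in> QG" using y FQ_QG by blast
  have "quo (eQ * y * eQ) = quo eQ \<otimes>\<^bsub>H\<^esub> u \<otimes>\<^bsub>H\<^esub> quo eQ" using y yQ eQ_QG by (simp add: H.f_hom QG)
  also have "\<dots> = quo ((eQ * eQ) * x * (eQ * eQ))" using x eQ_QG by (simp add: H.f_hom QG mult.assoc H.A.m_assoc)
  also have "\<dots> = u" using x by (simp add: eQ_idem)
  finally have "u = rho (flat y)" using yQ by (simp add: rho_def sandwich)
  then show "u \<in> rho ` (PG \<inter> deg_lt (Suc n))" using flat_PG flat_deg_lt y by blast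
qed

text \<open>A relation of S(V) is a relation of H up to lower order: x y - y x exceeds
  \<open>relB x y\<close> by \<open>kap x y\<close>, whose degree is two less. Taking the component
  \<open>hcomp n\<close> makes the claim linear in p, hence checkable on generators.\<close>

lemma emb_KS:
  assumes "p \<in> KS"
  shows "emb (hcomp n p) \<in> pm.span (IQ \<union> FQ n)"
proof -
  let ?W = "pm.span (IQ \<union> FQ n)"
  have lin: "wd u id * emb r * wd w id \<in> ?W" if "r \<in> tens_gens" for u r w
  proof -
    have "emb r \<in> IQ" using that ideal_span_base[OF subalg_UNIV that] emb_KT by (simp add: KT_def)
    then have "wd u id * emb r * wd w id \<in> IQ" by (intro IQ_mult wd_QG \<Gamma>_id)
    then show ?thesis by (intro pm.span_base) simp
  qed
  have com: "wd u id * emb r * wd w id \<in> ?W" if "r \<in> com_gens" "length u + length w + 2 = n" for u r w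
  proof -
    from that obtain x y where "r = mon [x, y] - mon [y, x]" by (auto simp: com_gens_def)
    then have e: "emb r = relB x y + kap x y" by (simp add: emb_diff emb_single relB_def)
    have "wd u id * relB x y * wd w id \<in> IQ"
      by (intro IQ_mult wd_QG \<Gamma>_id IQ_gens) (auto simp: com_rels_def)
    moreover have "wd u id * kap x y * wd w id \<in> FQ n"
      using FQ_mult[OF kap_wd_FQ(2)[of u x y] wd_FQ[of id w "Suc (length w)"]] FQ_mono[of "length u + Suc (length w)" n] that(2) by auto
    ultimately show ?thesis
      unfolding e by (simp add: ring_distribs del: wd_mult wd_mult_assoc) (intro pm.span_add pm.span_base; simp)
  qed
  have "emb (hcomp n (mon u * r * mon w)) \<in> ?W" if "r \<in> tens_gens \<union> com_gens" for u r w
  proof -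
    have e: "emb (mon u * r * mon w) = wd u id * emb r * wd w id"
      by (simp add: emb_mult emb_single)
    have "hcomp n (mon u * r * mon w) = 0 \<or>
        hcomp n (mon u * r * mon w) = mon u * r * mon w \<and>
        (r \<in> tens_gens \<or> length u + length w + 2 = n)"
      using that by (auto simp: tens_gens_def com_gens_def left_diff_distrib right_diff_distrib mult_single plus_list_def
          hcomp_diff hcomp_single)
    then show ?thesis using that lin com e by (auto simp: pm.span_zero)
  qed
  then have "pm.span {mon u * r * mon w | u r w. r \<in> tens_gens \<union> com_gens} \<subseteq> {p. hcomp n p \<in> {p. emb p \<in> ?W}}"
    by (intro pm.span_minimal subspace_hcomp subspace_emb) auto
  then show ?thesis using assms unfolding KS_eq by blast
qed

text \<open>The \<open>kap\<close> terms have degree below n, so in degree n only relations of S(V)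
  survive. The coefficient at the identity suffices, since by \<open>coef_eQ\<close> it determines p
  in p e.\<close>

lemma top_of_I:
  assumes "x \<in> I n"
  shows "hcomp n (coef id x) \<in> KS"
proof -
  have "g \<in> {x. coef id x \<in> {p. hcomp n p \<in> KS}}" if "g \<in> I_gens n" for g
  proof -
    from that consider
        (lin) u r w h where "g = wd u id * r * wd w h" "r \<in> lin_rels" "h \<in> \<Gamma>"
      | (com) u x y w h where "g = wd u id * relB x y * wd w h" "h \<in> \<Gamma>" "length u + length w + 2 \<le> n"
      unfolding I_gens_def by blast
    then show ?thesis
    proof cases
      case lin
      have "coef id g \<in> KS"
        using lin(2) KT_KS[THEN subsetD, OF tens_gens_word(1)] KT_KS[THEN subsetD, OF tens_gens_word(2)] unfolding lin(1) lin_rels_def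
        by (auto simp: left_diff_distrib right_diff_distrib coef_diff coef_smul coef_wd pm.subspace_0)
      then show ?thesis using hcomp_KS by simp
    next
      case com
      define k where "k = wd u id * kap x y * wd w h"
      have "wd u id * kap x y * wd w h \<in> FQ n"
        using FQ_mult[OF kap_wd_FQ(2)[of u x y] wd_FQ[OF com(2), of w "Suc (length w)"]] FQ_mono[of "length u + Suc (length w)" n] com(3) by auto
      then have k: "coef id k \<in> deg_lt n" unfolding k_def by (rule coef_FQ)
      have "g = wd (u @ x # y # w) h - wd (u @ y # x # w) h - k"
        by (simp add: com(1) relB_def k_def left_diff_distrib right_diff_distrib)
      moreover have "hcomp n (coef id k) = 0" using k by (simp add: deg_lt_iff_hcomp)
      ultimately have e: "hcomp n (coef id g) = hcomp n (coef id (wd (u @ x # y # w) h - wd (u @ y # x # w) h))"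
        by (simp add: coef_diff hcomp_diff)
      have "mon u * (mon [x, y] - mon [y, x]) * mon w \<in> KS"
        by (intro KS_mult KS_gens) (auto simp: com_gens_def)
      then have "coef id (wd (u @ x # y # w) h - wd (u @ y # x # w) h) \<in> KS"
        by (simp add: coef_diff coef_wd left_diff_distrib right_diff_distrib mult_single plus_list_def pm.subspace_0)
      then show ?thesis using hcomp_KS e by simp
    qed
  qed
  then have "I n \<subseteq> {x. coef id x \<in> {p. hcomp n p \<in> KS}}"
    unfolding I_def by (intro pm.span_minimal subspace_coef subspace_hcomp) auto
  then show ?thesis using assms by auto
qed

lemma coef_eQ: "coef id (emb p * eQ) = smul (1 / of_nat (card \<Gamma>)) p"
  using fin_\<Gamma> by (simp add: eQ_def coef_smul sum_distrib_left coef_sum coef_emb_wd)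

lemma rho_leading:
  assumes p: "p \<in> PG" "hcomp n p = p"
  shows "rho p \<in> rho ` (PG \<inter> deg_lt n) \<longleftrightarrow> p \<in> KS"
proof
  assume "rho p \<in> rho ` (PG \<inter> deg_lt n)"
  then obtain q where q: "q \<in> PG" "q \<in> deg_lt n" "rho p = rho q" by blast
  define x where "x = emb p * eQ - emb q * eQ"
  have "p \<in> deg_lt (Suc n)" using hcomp_deg_lt[of n p] p by simp
  then have "emb p * eQ \<in> FQ (Suc n)" "emb q * eQ \<in> FQ (Suc n)"
    using FQ_mult[OF emb_deg_lt eQ_FQ, of _ n] deg_lt_mono[OF _ q(2), of "Suc n"] by auto
  then have xF: "x \<in> FQ (Suc n)" unfolding x_def by (rule pm.subspace_diff[OF subspace_FQ])
  have "x \<in> IQ" using q(3) unfolding rho_def x_def by (simp add: quo_eq_iff emb_eQ_QG)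
  then obtain m where "x \<in> I m" by (auto simp: IQ_iff)
  \<comment> \<open>A priori the relation is derived through arbitrarily high degrees; PBW brings it
    down to n.\<close>
  then have "x \<in> I n" using xF by (rule PBW)
  then have "hcomp n (coef id x) \<in> KS" by (rule top_of_I)
  moreover have "hcomp n q = 0" using q(2) by (simp add: deg_lt_iff_hcomp)
  then have "hcomp n (coef id x) = smul (1 / of_nat (card \<Gamma>)) p"
    by (simp add: x_def coef_diff coef_eQ hcomp_diff hcomp_smul p)
  ultimately have "smul (1 / of_nat (card \<Gamma>)) p \<in> KS" by simp
  from pm.subspace_scale[OF subspace_KS this, of "of_nat (card \<Gamma>)"] show "p \<in> KS" using card_\<Gamma> by simp
next
  assume "p \<in> KS"
  then have "emb p \<in> pm.span (IQ \<union> FQ n)" using emb_KS[of p n] p by simp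
  then obtain a b where ab: "a \<in> IQ" "b \<in> FQ n" "emb p = a + b"
    unfolding pm.span_Un pm.span_eq_iff[THEN iffD2, OF subspace_IQ] pm.span_eq_iff[THEN iffD2, OF subspace_FQ] by auto
  have bQ: "b \<in> QG" using ab FQ_QG by blast
  \<comment> \<open>Sandwiching replaces the lower-order remainder b by the invariant
    \<open>flat b\<close> without raising its degree.\<close>
  have "emb p * eQ - emb (flat b) * eQ = eQ * emb p * eQ - eQ * b * eQ"
    using p bQ by (simp add: sandwich_PG sandwich)
  also have "\<dots> = eQ * a * eQ" unfolding ab(3) by (simp add: ring_distribs)
  also have "\<dots> \<in> IQ" using ab by (intro IQ_mult eQ_QG)
  finally have "rho p = rho (flat b)" unfolding rho_def by (simp add: quo_eq_iff emb_eQ_QG)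
  then show "rho p \<in> rho ` (PG \<inter> deg_lt n)" using flat_PG flat_deg_lt[OF ab(2)] by blast
qed

section \<open>Consequences for the spherical subalgebra\<close>

sublocale U: filtered_presentation PG rho U KS
proof (unfold_locales)
  show "presents PG rho U" by (rule presents_spherical)
qed (simp_all add: hcomp_PG hcomp_KS rho_leading)

lemma U_G: "U.G = UF"
  by (rule ext) (simp add: U.G_def spherical_filtration_eq)

lemma avg_KT: "p \<in> KT \<Longrightarrow> avg p \<in> KT"
  unfolding avg_def by (intro pm.subspace_scale pm.subspace_sum) (auto intro: free_act_KT)

lemma rho_eq_mod_KT: "p - q \<in> KT \<Longrightarrow> rho p = rho q"
  unfolding rho_def using IQ_mult(2)[OF emb_KT eQ_QG, of "p - q"] by (simp add: quo_eq_iff emb_eQ_QG emb_diff left_diff_distrib)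

text \<open>All vectors serve as letters upstairs, so finiteness is visible only modulo
  \<open>KT\<close>, where averages of basis words of bounded length suffice.\<close>

lemma finite_dim_spherical: "finite_dim U (UF n)"
proof -
  define Y where "Y = (\<lambda>w. avg (mon w)) ` {w. set w \<subseteq> Bas \<and> length w \<le> n}"
  have finY: "finite Y" unfolding Y_def by (intro finite_imageI finite_lists_length_le finite_Basis)
  have YPG: "Y \<subseteq> PG" unfolding Y_def using avg_PG by auto
  define N where "N = pm.span (KT \<union> Y)"
  have KT: "p \<in> N" if "p \<in> KT" for p unfolding N_def using that by (intro pm.span_base) simp
  have word: "avg (mon w) \<in> N" if "length w \<le> n" for w
  proof (rule multilinear_basis_induct[where E = "\<lambda>w. avg (mon w)" and n = "length w"])
    show "avg (mon (u @ (x + y) # v)) - avg (mon (u @ x # v)) - avg (mon (u @ y # v)) \<in> N" for u x y v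
      unfolding avg_diff[symmetric] by (intro KT avg_KT tens_gens_word)
    show "avg (mon (u @ scale a x # v)) - smul a (avg (mon (u @ x # v))) \<in> N" for u a x v
      unfolding avg_diff[symmetric] avg_smul[symmetric] by (intro KT avg_KT tens_gens_word)
    show "avg (mon v) \<in> N" if "set v \<subseteq> Bas" "length v = length w" for v
      unfolding N_def Y_def using that \<open>length w \<le> n\<close> by (intro pm.span_base) auto
  qed (simp_all add: N_def)
  have "UF n = rho ` pm.span Y"
    unfolding spherical_filtration_eq
  proof (intro equalityI subsetI)
    fix u assume "u \<in> rho ` (PG \<inter> deg_lt (Suc n))"
    then obtain p where p: "p \<in> PG" "p \<in> deg_lt (Suc n)" "u = rho p" by blast
    have "p \<in> pm.span (mon ` {w. length w \<le> n})"
      using p(2) by (intro poly_mapping_in_span) (auto simp: deg_lt_def)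
    moreover have "pm.span (mon ` {w. length w \<le> n}) \<subseteq> {p. avg p \<in> N}"
      using word by (intro pm.span_minimal subspace_avg) (auto simp: N_def)
    ultimately have "avg p \<in> N" by blast
    then have "p \<in> N" using avg_of_PG[OF p(1)] by simp
    then obtain a b where "a \<in> KT" "b \<in> pm.span Y" "p = a + b"
      unfolding N_def pm.span_Un pm.span_eq_iff[THEN iffD2, OF subspace_KT] by auto
    then have "rho p = rho b" "b \<in> pm.span Y" by (auto intro!: rho_eq_mod_KT)
    then show "u \<in> rho ` pm.span Y" using p by blast
  next
    fix u assume "u \<in> rho ` pm.span Y"
    moreover have "Y \<subseteq> deg_lt (Suc n)"
      unfolding Y_def by (intro image_subsetI avg_deg_lt) (simp add: deg_lt_def)
    then have "pm.span Y \<subseteq> PG \<inter> deg_lt (Suc n)"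
      using YPG subalgD(1)[OF subalg_PG] subspace_deg_lt by (intro pm.span_minimal pm.subspace_inter) auto
    ultimately show "u \<in> rho ` (PG \<inter> deg_lt (Suc n))" by blast
  qed
  then show ?thesis using U.finite_dim_image[OF finY YPG] by simp
qed

text \<open>The same finite set \<open>inv_gens\<close> generates the graded algebra, by Noether's
  bound, and the spherical subalgebra, by lifting.\<close>

lemma vaguely_commutative_spherical: "vaguely_commutative U"
proof -
  interpret gr: presentation PG U.gr_map "gr U U.G"
    by (rule presentation.intro, rule U.presents_gr)
  have eq: "U.gr_map p = U.gr_map q" if "p \<in> PG" "q \<in> PG" "p - q \<in> KS" for p q
    using that gr.f_eq_iff[OF that(1,2)] U.gr_map_eq_zero[OF subalgD(5)[OF subalg_PG that(1,2)]] by simp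
  have sub: "alg_gen inv_gens \<subseteq> PG" by (rule alg_gen_minimal[OF subalg_PG inv_gens_PG])
  have "finitely_generated U"
    by (rule U.finitely_generated_if[OF finite_inv_gens inv_gens_PG])
      (rule U.generators_lift[OF inv_gens_PG inv_gens_hcomp PG_generated])
  moreover have "finitely_generated (gr U U.G)"
    using gr.finitely_generated_if[OF finite_inv_gens inv_gens_PG] PG_generated eq sub by (metis subsetD)
  moreover have "commutative (gr U U.G)"
    by (rule gr.commutative_if) (intro eq KS_commute subalgD(6)[OF subalg_PG])
  ultimately show ?thesis
    unfolding vaguely_commutative_def using U.calgebra U.filtration_G finite_dim_spherical U_G by metis
qed

text \<open>\<open>PG\<close> presents both sides with kernel \<open>KS\<close>, and on both sides
  the n-th component is the image of its homogeneous elements of degree n.\<close>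

lemma gr_spherical_iso:
  "\<exists>\<phi>. graded_iso (gr U (UF)) (gr_component U (UF))
     (sym_invariants scale \<Gamma>) (sym_invariants_component scale \<Gamma>) \<phi>"
proof -
  have "U.gr_map p = \<zero>\<^bsub>gr U U.G\<^esub> \<longleftrightarrow> sig p = \<zero>\<^bsub>sym_invariants scale \<Gamma>\<^esub>" if "p \<in> PG" for p
    using U.gr_map_eq_zero[OF that] sig_zero_iff[of p] by (simp add: sym_invariants_def)
  from presents_same_kernel_iso[OF U.presents_gr presents_sym_invariants this]
  obtain \<phi> where \<phi>: "\<phi> \<in> ring_iso (gr U U.G) (sym_invariants scale \<Gamma>)"
    "\<And>a x. x \<in> carrier (gr U U.G) \<Longrightarrow> \<phi> (a \<odot>\<^bsub>gr U U.G\<^esub> x) = a \<odot>\<^bsub>sym_invariants scale \<Gamma>\<^esub> \<phi> x"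
    "\<And>p. p \<in> PG \<Longrightarrow> \<phi> (U.gr_map p) = sig p" by metis
  have "\<phi> ` gr_component U U.G n = sym_invariants_component scale \<Gamma> n" for n
    unfolding U.gr_component_eq sym_invariants_component_eq image_image using \<phi>(3) by (intro image_cong) auto
  then show ?thesis using \<phi>(1,2) unfolding graded_iso_def U_G by blast
qed

end

theorem proposition4p30:
  fixes scale :: "complex \<Rightarrow> 'v::ab_group_add \<Rightarrow> 'v"
    and \<omega> :: "'v \<Rightarrow> 'v \<Rightarrow> complex"
    and \<Gamma> :: "('v \<Rightarrow> 'v) set"
    and c :: "('v \<Rightarrow> 'v) \<Rightarrow> complex"
  assumes "symplectic_space scale \<omega>"
    and "subgroup \<Gamma> (Sp scale \<omega>)"
    and "finite \<Gamma>"
    and "conj_invariant scale \<Gamma> c"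
  defines "U \<equiv> spherical scale \<omega> \<Gamma> c"
    and "\<G> \<equiv> spherical_filtration scale \<omega> \<Gamma> c"
  shows "(\<exists>\<phi>. graded_iso (gr U \<G>) (gr_component U \<G>)
                (sym_invariants scale \<Gamma>) (sym_invariants_component scale \<Gamma>) \<phi>)
         \<and> vaguely_commutative U"
proof -
  from assms(1) obtain B where "finite_dimensional_vector_space scale B"
    and "skew_form scale \<omega>" "radical \<omega> = {0}" by (auto simp: symplectic_space_def)
  then interpret sra_data scale B \<omega> \<Gamma> c
    using assms(2-4) by (intro sra_data.intro sra_data_axioms.intro)
  show ?thesis unfolding U_def \<G>_def using gr_spherical_iso vaguely_commutative_spherical by blast
qed

end
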